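(* Up to reparametrization and isometry, the only $D_2$-elastic knot for the unknot class is the once covered circle of length one. Moreover, if a $D_2$-elastic knot for some tame knot class $\mathcal{K}$ is the once covered circle, then $\mathcal{K}$ is the unknot class. Finally, the unknot class is the only knot class $\mathcal{K}$ satisfying $$\inf\{E(\beta):\beta\in\mathscr{C}(\mathcal{K}),\ \beta\ D_2\text{-symmetric}\}=\inf\{E(\beta):\beta\in W^{2,2},\ \mathscr{L}(\beta)=1\}=(2\pi)^2.$$
   Context: Fix $q\in(2,4]$. $\mathscr{L}$ is length; $E(\gamma)=\int_\gamma\kappa^2ds$ (bending energy); $\mathrm{TP}_q(\gamma)=\iint_{(\mathbb{R}/\mathbb{Z})^2} r_{tp}(\gamma(s),\gamma(t))^{-q}|\gamma'(s)||\gamma'(t)|\,ds\,dt$ with $r_{tp}(\gamma(s),\gamma(t))$ the radius of the circle through $\gamma(s),\gamma(t)$ tangent to $\gamma$ at $\gamma(s)$; $E_\vartheta=E+\vartheta\mathrm{TP}_q^{1/(q-2)}$ for $\vartheta>0$. $\mathscr{C}(\mathcal{K})=\{\gamma\in W^{2,2}(\mathbb{R}/\mathbb{Z},\mathbb{R}^3):\mathscr{L}(\gamma)=1,|\gamma'|>0,\ \gamma\text{ embedded of knot type }\mathcal{K}\}$; the infimum over $W^{2,2}$ curves is over closed curves $\beta:\mathbb{R}/\mathbb{Z}\to\mathbb{R}^3$. $D_2$-symmetry: $R_1=\mathrm{diag}(1,-1,-1)$, $R_2=\mathrm{diag}(-1,1,-1)$, $R_3=\mathrm{diag}(-1,-1,1)$;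 on $\mathbb{R}/\mathbb{Z}$: $\psi_1(t)=-t+1/2$, $\psi_2(t)=t-1/2$, $\psi_3(t)=-t$. A curve $\gamma\in C^0(\mathbb{R}/\mathbb{Z},\mathbb{R}^3)$ of finite positive length is $D_2$-symmetric if $R_i\gamma(\psi_i(t))=\gamma(t)$ for all $t$, $i=1,2,3$. $D_2$-elastic knot: Let $\mathcal{K}$ be a tame knot class such that $\mathscr{C}(\mathcal{K})$ contains a $D_2$-symmetric curve. For $\vartheta>0$ a symmetric $E_\vartheta$-minimizer is an arclength parametrized $D_2$-symmetric $\Gamma_\vartheta\in\mathscr{C}(\mathcal{K})$ with $E_\vartheta(\Gamma_\vartheta)\le E_\vartheta(\beta)$ for all $D_2$-symmetric $\beta\in\mathscr{C}(\mathcal{K})$ (these exist for all $\vartheta>0$). A $D_2$-elastic knot for $\mathcal{K}$ is any arclength parametrized curve $\Gamma_0\in W^{2,2}(\mathbb{R}/\mathbb{Z},\mathbb{R}^3)$ which is the weak-$W^{2,2}$ and strong-$C^1$ limit of $\Gamma_{\vartheta_k}$ for some sequence $\vartheta_k\to0$ of symmetric $E_{\vartheta_k}$-minimizers. *)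

theory Defs
  imports "HOL-Analysis.Analysis"
begin

section \<open>Closed curves R/Z -> R^3, represented as 1-periodic maps real => real^3\<close>

definition periodic1 :: "(real \<Rightarrow> real^3) \<Rightarrow> bool" where
  "periodic1 \<gamma> \<longleftrightarrow> (\<forall>t. \<gamma> (t + 1) = \<gamma> t)"

definition d1 :: "(real \<Rightarrow> real^3) \<Rightarrow> real \<Rightarrow> real^3" where
  "d1 \<gamma> t = vector_derivative \<gamma> (at t)"

text \<open>g is a weak (L^1_loc) derivative of the first derivative of gamma.\<close>
definition is_d2 :: "(real \<Rightarrow> real^3) \<Rightarrow> (real \<Rightarrow> real^3) \<Rightarrow> bool" where
  "is_d2 \<gamma> g \<longleftrightarrow> (\<forall>a b. g absolutely_integrable_on {a..b}) \<and>
     (\<forall>a b. a \<le> b \<longrightarrow> (g has_integral (d1 \<gamma> b - d1 \<gamma> a)) {a..b})"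

definition W22 :: "(real \<Rightarrow> real^3) \<Rightarrow> bool" where
  "W22 \<gamma> \<longleftrightarrow> periodic1 \<gamma> \<and> (\<forall>t. (\<gamma> has_vector_derivative d1 \<gamma> t) (at t)) \<and>
     (\<exists>g. is_d2 \<gamma> g \<and> (\<lambda>t. norm (g t) ^ 2) integrable_on {0..1})"

text \<open>The (a.e. unique) weak second derivative.\<close>
definition d2 :: "(real \<Rightarrow> real^3) \<Rightarrow> real \<Rightarrow> real^3" where
  "d2 \<gamma> = (SOME g. is_d2 \<gamma> g \<and> (\<lambda>t. norm (g t) ^ 2) integrable_on {0..1})"

definition curve_length :: "(real \<Rightarrow> real^3) \<Rightarrow> real" where
  "curve_length \<gamma> = integral {0..1} (\<lambda>t. norm (d1 \<gamma> t))"

definition regular :: "(real \<Rightarrow> real^3) \<Rightarrow> bool" where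
  "regular \<gamma> \<longleftrightarrow> (\<forall>t. norm (d1 \<gamma> t) > 0)"

definition arclength :: "(real \<Rightarrow> real^3) \<Rightarrow> bool" where
  "arclength \<gamma> \<longleftrightarrow> (\<forall>t. norm (d1 \<gamma> t) = 1)"

text \<open>Bending energy  E = int kappa^2 ds = int_0^1 |g' x g''|^2 / |g'|^5 dt
  (parametrization invariant formula).\<close>
definition bending :: "(real \<Rightarrow> real^3) \<Rightarrow> ennreal" where
  "bending \<gamma> = (\<integral>\<^sup>+ t. ennreal (norm (cross3 (d1 \<gamma> t) (d2 \<gamma> t)) ^ 2 / norm (d1 \<gamma> t) ^ 5)
                     * indicator {0..1} t \<partial>lborel)"

text \<open>Inverse tangent-point radius 1/r_tp(gamma(s),gamma(t)): the circle through x = gamma(s)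
  and y = gamma(t) tangent to tau = gamma'(s) at x has radius
  |y-x|^2 / (2 dist(y-x, R tau)); the inverse is 0 when y-x is parallel to tau
  (infinite radius).\<close>
definition inv_rtp :: "(real \<Rightarrow> real^3) \<Rightarrow> real \<Rightarrow> real \<Rightarrow> real" where
  "inv_rtp \<gamma> s t = 2 * norm (cross3 (\<gamma> t - \<gamma> s) (d1 \<gamma> s))
                     / (norm (d1 \<gamma> s) * norm (\<gamma> t - \<gamma> s) ^ 2)"

definition TP :: "real \<Rightarrow> (real \<Rightarrow> real^3) \<Rightarrow> ennreal" where
  "TP q \<gamma> = (\<integral>\<^sup>+ p. ennreal (inv_rtp \<gamma> (fst p) (snd p) powr q
                 * norm (d1 \<gamma> (fst p)) * norm (d1 \<gamma> (snd p)))
               * indicator ({0..1} \<times> {0..1}) p \<partial>lborel)"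

definition ennpowr :: "ennreal \<Rightarrow> real \<Rightarrow> ennreal" where
  "ennpowr x a = (if x = \<infinity> then \<infinity> else ennreal (enn2real x powr a))"

definition E_theta :: "real \<Rightarrow> real \<Rightarrow> (real \<Rightarrow> real^3) \<Rightarrow> ennreal" where
  "E_theta q \<theta> \<gamma> = bending \<gamma> + ennreal \<theta> * ennpowr (TP q \<gamma>) (1 / (q - 2))"

definition knot_set :: "(real^3) set \<Rightarrow> bool" where
  "knot_set K \<longleftrightarrow> (\<exists>\<gamma>. continuous_on UNIV \<gamma> \<and> periodic1 \<gamma> \<and> inj_on \<gamma> {0..<1} \<and> K = \<gamma> ` {0..1})"

definition ambient_isotopic :: "(real^3) set \<Rightarrow> (real^3) set \<Rightarrow> bool" where
  "ambient_isotopic A B \<longleftrightarrow> (\<exists>H G :: real \<times> (real^3) \<Rightarrow> real^3.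
      continuous_on ({0..1} \<times> UNIV) H \<and> continuous_on ({0..1} \<times> UNIV) G \<and>
      (\<forall>t\<in>{0..1}. \<forall>x. G (t, H (t, x)) = x \<and> H (t, G (t, x)) = x) \<and>
      (\<forall>x. H (0, x) = x) \<and> (\<lambda>x. H (1, x)) ` A = B)"

definition polygonal :: "(real^3) set \<Rightarrow> bool" where
  "polygonal P \<longleftrightarrow> (\<exists>S. finite S \<and> P = (\<Union>(a, b)\<in>S. closed_segment a b))"

definition tame :: "(real^3) set \<Rightarrow> bool" where
  "tame K \<longleftrightarrow> knot_set K \<and> (\<exists>P. knot_set P \<and> polygonal P \<and> ambient_isotopic K P)"

definition knot_class_of :: "(real^3) set \<Rightarrow> (real^3) set set" where
  "knot_class_of K = {K'. knot_set K' \<and> ambient_isotopic K K'}"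

definition tame_knot_class :: "(real^3) set set \<Rightarrow> bool" where
  "tame_knot_class \<K> \<longleftrightarrow> (\<exists>K. tame K \<and> \<K> = knot_class_of K)"

definition circ :: "real \<Rightarrow> real^3" where
  "circ t = vector [cos (2 * pi * t) / (2 * pi), sin (2 * pi * t) / (2 * pi), 0]"

definition unknot :: "(real^3) set set" where
  "unknot = knot_class_of (circ ` {0..1})"

definition Cset :: "(real^3) set set \<Rightarrow> (real \<Rightarrow> real^3) set" where
  "Cset \<K> = {\<gamma>. W22 \<gamma> \<and> curve_length \<gamma> = 1 \<and> regular \<gamma> \<and> inj_on \<gamma> {0..<1} \<and> \<gamma> ` {0..1} \<in> \<K>}"

definition R1 :: "real^3 \<Rightarrow> real^3" where "R1 x = vector [x$1, - x$2, - x$3]"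
definition R2 :: "real^3 \<Rightarrow> real^3" where "R2 x = vector [- x$1, x$2, - x$3]"
definition R3 :: "real^3 \<Rightarrow> real^3" where "R3 x = vector [- x$1, - x$2, x$3]"

definition D2_symmetric :: "(real \<Rightarrow> real^3) \<Rightarrow> bool" where
  "D2_symmetric \<gamma> \<longleftrightarrow> (\<forall>t. R1 (\<gamma> (- t + 1/2)) = \<gamma> t \<and> R2 (\<gamma> (t - 1/2)) = \<gamma> t \<and> R3 (\<gamma> (- t)) = \<gamma> t)"

definition sym_minimizer :: "real \<Rightarrow> (real^3) set set \<Rightarrow> real \<Rightarrow> (real \<Rightarrow> real^3) \<Rightarrow> bool" where
  "sym_minimizer q \<K> \<theta> \<Gamma> \<longleftrightarrow> arclength \<Gamma> \<and> D2_symmetric \<Gamma> \<and> \<Gamma> \<in> Cset \<K> \<and>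
     (\<forall>\<beta>\<in>Cset \<K>. D2_symmetric \<beta> \<longrightarrow> E_theta q \<theta> \<Gamma> \<le> E_theta q \<theta> \<beta>)"

definition W22_inner :: "(real \<Rightarrow> real^3) \<Rightarrow> (real \<Rightarrow> real^3) \<Rightarrow> real" where
  "W22_inner u v = integral {0..1} (\<lambda>t. u t \<bullet> v t + d1 u t \<bullet> d1 v t + d2 u t \<bullet> d2 v t)"

definition weak_W22_conv :: "(nat \<Rightarrow> real \<Rightarrow> real^3) \<Rightarrow> (real \<Rightarrow> real^3) \<Rightarrow> bool" where
  "weak_W22_conv \<Gamma> \<Gamma>0 \<longleftrightarrow> (\<forall>v. W22 v \<longrightarrow> (\<lambda>k. W22_inner (\<Gamma> k) v) \<longlonglongrightarrow> W22_inner \<Gamma>0 v)"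

definition C1_conv :: "(nat \<Rightarrow> real \<Rightarrow> real^3) \<Rightarrow> (real \<Rightarrow> real^3) \<Rightarrow> bool" where
  "C1_conv \<Gamma> \<Gamma>0 \<longleftrightarrow> uniform_limit UNIV \<Gamma> \<Gamma>0 sequentially \<and>
     uniform_limit UNIV (\<lambda>k. d1 (\<Gamma> k)) (d1 \<Gamma>0) sequentially"

definition D2_elastic_knot :: "real \<Rightarrow> (real^3) set set \<Rightarrow> (real \<Rightarrow> real^3) \<Rightarrow> bool" where
  "D2_elastic_knot q \<K> \<Gamma>0 \<longleftrightarrow> tame_knot_class \<K> \<and> (\<exists>\<beta>\<in>Cset \<K>. D2_symmetric \<beta>) \<and>
     W22 \<Gamma>0 \<and> arclength \<Gamma>0 \<and>
     (\<exists>\<theta> \<Gamma>. (\<forall>k. \<theta> k > 0) \<and> \<theta> \<longlonglongrightarrow> 0 \<and> (\<forall>k. sym_minimizer q \<K> (\<theta> k) (\<Gamma> k)) \<and>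
             weak_W22_conv \<Gamma> \<Gamma>0 \<and> C1_conv \<Gamma> \<Gamma>0)"

definition isometry3 :: "(real^3 \<Rightarrow> real^3) \<Rightarrow> bool" where
  "isometry3 f \<longleftrightarrow> (\<forall>x y. dist (f x) (f y) = dist x y)"

text \<open>Reparametrizations of R/Z: lifts of homeomorphisms of R/Z (either orientation).\<close>
definition reparam :: "(real \<Rightarrow> real) \<Rightarrow> bool" where
  "reparam \<phi> \<longleftrightarrow> continuous_on UNIV \<phi> \<and>
     ((strict_mono \<phi> \<and> (\<forall>t. \<phi> (t + 1) = \<phi> t + 1)) \<or>
      (strict_mono (\<lambda>t. - \<phi> t) \<and> (\<forall>t. \<phi> (t + 1) = \<phi> t - 1)))"

definition is_once_covered_circle :: "(real \<Rightarrow> real^3) \<Rightarrow> bool" where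
  "is_once_covered_circle \<Gamma> \<longleftrightarrow> (\<exists>f \<phi>. isometry3 f \<and> reparam \<phi> \<and> (\<forall>t. \<Gamma> t = f (circ (\<phi> t))))"

end

theory Submission
  imports Defs
begin

text \<open>
  The unit tangent \<open>T\<close> of a closed curve of length one has mean zero over a period of length one, so
  Wirtinger's inequality gives \<open>E \<ge> (2\<pi>)\<^sup>2\<close> directly, without Fenchel's theorem. For
  fixed \<open>t\<close>, the direction of the chord from \<open>\<gamma>(t)\<close> to \<open>\<gamma>(s)\<close> runs on the sphere from \<open>T(t)\<close> to
  \<open>- T(t)\<close>, hence over a length of at least \<open>\<pi>\<close>; integrating over \<open>t\<close> and applying Jensen's
  inequality shows that the circle also minimizes \<open>TP\<^sub>q\<close>. So the round circle itself is a symmetric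
  \<open>E\<^sub>\<theta>\<close>-minimizer in the unknot class for every \<open>\<theta>\<close>, and every such minimizer has
  bending energy exactly \<open>(2\<pi>)\<^sup>2\<close>.

  For a symmetric curve, Picone's identity on a quarter period makes Wirtinger's inequality quantitative: if
  \<open>E \<le> (2\<pi>)\<^sup>2 + \<epsilon>\<close>, then \<open>T\<close> is uniformly \<open>\<surd>\<epsilon>\<close>-close to the tangent of a circle in the
  \<open>xz\<close>-plane. For \<open>\<epsilon> = 0\<close> this identifies the minimizers. For small \<open>\<epsilon>\<close> it shows that the projection to
  that plane is star-shaped about the origin, and a curve over a star-shaped planar curve is isotopic to the
  circle by an explicit isotopy.
\<close>

section \<open>Absolutely continuous functions and their densities\<close>

text \<open>The tangent of a \<open>W22\<close> curve is only absolutely continuous, and the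
  competitors have arbitrary regular parametrizations. Neither is repaired by changing the curve:
  derivatives enter as densities, determined up to null sets, and every one-dimensional inequality
  carries the speed as a weight and arclength as the phase. The quarter period is dictated by the
  symmetry. Tangent components 1 and 3 vanish there, one at each end, and component 2 has mean zero.
  The sharp constants are (2 pi)^2 for the former and (4 pi)^2 for the latter, so an energy excess
  bounds component 2 outright and, for the other two, bounds the defect in Picone's identity. The
  symmetry also places the circle: parameter 0 must lie on the third axis and parameter 1/4 on the
  first, hence the xz-plane, although \<open>circ\<close> lies in the xy-plane. The explicit isotopy
  replaces a stability theorem for knot types under C^1 convergence. For elastic knots it is applied
  to a minimizer late in the sequence, because membership in the class is known only for the
  minimizers.\<close>

definition has_density :: "(real \<Rightarrow> real) \<Rightarrow> (real \<Rightarrow> real) \<Rightarrow> real \<Rightarrow> real \<Rightarrow> bool" where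
  "has_density f g a b \<longleftrightarrow> g absolutely_integrable_on {a..b} \<and>
     (\<forall>c d. a \<le> c \<longrightarrow> c \<le> d \<longrightarrow> d \<le> b \<longrightarrow> (g has_integral (f d - f c)) {c..d})"

lemma has_densityD:
  assumes "has_density f g a b" "a \<le> c" "c \<le> d" "d \<le> b"
  shows "(g has_integral (f d - f c)) {c..d}"
  using assms by (simp add: has_density_def)

lemma has_density_abs: "has_density f g a b \<Longrightarrow> g absolutely_integrable_on {a..b}"
  by (simp add: has_density_def)

lemma has_density_sub:
  assumes "has_density f g a b" "a \<le> c" "d \<le> b"
  shows "has_density f g c d"
  using assms unfolding has_density_def
  by (smt (verit) absolutely_integrable_on_subinterval atLeastatMost_subset_iff)

lemma has_density_cont:
  assumes "has_density f g a b"
  shows "continuous_on {a..b} f"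
proof (cases "a \<le> b")
  case True
  have gi: "g integrable_on {a..b}"
    using has_density_abs[OF assms] by (rule absolutely_integrable_on_def[THEN iffD1, THEN conjunct1])
  have "continuous_on {a..b} (\<lambda>x. f a + integral {a..x} g)"
    by (intro continuous_intros indefinite_integral_continuous_1 gi)
  moreover have "f a + integral {a..x} g = f x" if "x \<in> {a..b}" for x
    using integral_unique[OF has_densityD[OF assms, of a x]] that by auto
  ultimately show ?thesis by (metis (no_types, lifting) continuous_on_cong)
qed auto

lemma has_density_add:
  assumes "has_density f g a b" "has_density f' g' a b"
  shows "has_density (\<lambda>t. f t + f' t) (\<lambda>t. g t + g' t) a b"
  unfolding has_density_def
proof (intro conjI allI impI)
  show "(\<lambda>t. g t + g' t) absolutely_integrable_on {a..b}"
    using assms has_density_abs by (blast intro: set_integral_add)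
  fix c d assume "a \<le> c" "c \<le> d" "d \<le> b"
  from has_integral_add[OF has_densityD[OF assms(1) this] has_densityD[OF assms(2) this]]
  show "((\<lambda>t. g t + g' t) has_integral f d + f' d - (f c + f' c)) {c..d}"
    by (simp add: algebra_simps)
qed

lemma has_density_cmul:
  assumes "has_density f g a b"
  shows "has_density (\<lambda>t. k * f t) (\<lambda>t. k * g t) a b"
  unfolding has_density_def
proof (intro conjI allI impI)
  show "(\<lambda>t. k * g t) absolutely_integrable_on {a..b}"
    using assms has_density_abs by auto
  fix c d assume "a \<le> c" "c \<le> d" "d \<le> b"
  from has_integral_mult_right[OF has_densityD[OF assms(1) this], of k]
  show "((\<lambda>t. k * g t) has_integral k * f d - k * f c) {c..d}"
    by (simp add: algebra_simps)
qed

lemma has_density_diff: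
  assumes "has_density f g a b" "has_density f' g' a b"
  shows "has_density (\<lambda>t. f t - f' t) (\<lambda>t. g t - g' t) a b"
  using has_density_add[OF assms(1) has_density_cmul[OF assms(2), of "-1"]] by simp

lemma has_density_const: "has_density (\<lambda>t. k) (\<lambda>t. 0) a b"
  unfolding has_density_def by (auto simp: absolutely_integrable_on_def)

lemma has_density_C1:
  assumes "\<And>t. t \<in> {a..b} \<Longrightarrow> (f has_real_derivative g t) (at t)" "continuous_on {a..b} g"
  shows "has_density f g a b"
  unfolding has_density_def
proof (intro conjI allI impI)
  show "g absolutely_integrable_on {a..b}"
    using assms(2) by (rule absolutely_integrable_continuous_real)
  fix c d assume "a \<le> c" "c \<le> d" "d \<le> b"
  then show "(g has_integral f d - f c) {c..d}"
    by (intro fundamental_theorem_of_calculus)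
      (auto intro!: has_field_derivative_at_within assms(1) simp flip: has_real_derivative_iff_has_vector_derivative)
qed

lemma abs_int_mult_cont:
  fixes u :: "real \<Rightarrow> real"
  assumes "g absolutely_integrable_on {a..b}" "continuous_on {a..b} u"
  shows "(\<lambda>t. u t * g t) absolutely_integrable_on {a..b}"
proof -
  have "u \<in> borel_measurable (lebesgue_on {a..b})"
    by (rule continuous_imp_measurable_on_sets_lebesgue) (use assms in auto)
  moreover have "bounded (u ` {a..b})"
    by (intro compact_imp_bounded compact_continuous_image assms) auto
  ultimately show ?thesis
    using absolutely_integrable_bounded_measurable_product_real[of u "{a..b}" g] assms(1) by auto
qed

text \<open>Cut the interval into \<open>N\<close> equal pieces shorter than
  \<open>\<delta>\<close>, telescope, and let \<open>e\<close> tend to 0. With \<open>\<Psi>\<close>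
  the integral of the modulus of a density, this replaces the fact that an absolutely continuous
  function with zero derivative almost everywhere is constant.\<close>

lemma locally_small_increments_imp_const:
  fixes \<Phi> \<Psi> :: "real \<Rightarrow> real"
  assumes "a \<le> b"
    and small: "\<And>e. e > 0 \<Longrightarrow> \<exists>\<delta>>0. \<forall>c d. a \<le> c \<longrightarrow> c \<le> d \<longrightarrow> d \<le> b \<longrightarrow> d - c < \<delta> \<longrightarrow>
        \<bar>\<Phi> d - \<Phi> c\<bar> \<le> e * (\<Psi> d - \<Psi> c)"
  shows "\<Phi> b = \<Phi> a"
proof -
  have bd: "\<bar>\<Phi> b - \<Phi> a\<bar> \<le> e * (\<Psi> b - \<Psi> a)" if e: "e > 0" for e
  proof -
    obtain \<delta> where \<delta>: "\<delta> > 0" and D: "\<And>c d. a \<le> c \<Longrightarrow> c \<le> d \<Longrightarrow> d \<le> b \<Longrightarrow> d - c < \<delta> \<Longrightarrow>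
        \<bar>\<Phi> d - \<Phi> c\<bar> \<le> e * (\<Psi> d - \<Psi> c)"
      using small[OF e] by blast
    obtain N :: nat where N: "(b - a) / \<delta> < real N" using reals_Archimedean2 by blast
    have N0: "0 < N"
    proof (rule ccontr)
      assume "\<not> 0 < N"
      then have "(b - a) / \<delta> < 0" using N by simp
      then show False using \<open>a \<le> b\<close> \<delta> by (simp add: divide_less_0_iff)
    qed
    define h where "h = (b - a) / real N"
    have h0: "h \<ge> 0" using \<open>a \<le> b\<close> by (simp add: h_def)
    have hN: "h * real N = b - a" using N0 by (simp add: h_def)
    have hd: "h < \<delta>" using N N0 \<delta> by (simp add: h_def field_simps)
    define p where "p i = a + h * real i" for i
    have "k \<le> N \<Longrightarrow> \<bar>\<Phi> (p k) - \<Phi> (p 0)\<bar> \<le> e * (\<Psi> (p k) - \<Psi> (p 0))" for k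
    proof (induction k)
      case (Suc k)
      have "h * real (Suc k) \<le> h * real N" using Suc.prems h0 by (intro mult_left_mono) auto
      then have pb: "p (Suc k) \<le> b" using hN by (simp add: p_def)
      have "\<bar>\<Phi> (p (Suc k)) - \<Phi> (p k)\<bar> \<le> e * (\<Psi> (p (Suc k)) - \<Psi> (p k))"
        using h0 hd pb by (intro D) (auto simp: p_def algebra_simps)
      with Suc show ?case by (simp add: algebra_simps)
    qed simp
    from this[of N] show ?thesis using hN by (simp add: p_def)
  qed
  have "\<bar>\<Phi> b - \<Phi> a\<bar> \<le> 0"
  proof (rule field_le_epsilon)
    fix e :: real assume "e > 0"
    define K where "K = \<bar>\<Psi> b - \<Psi> a\<bar> + 1"
    have K: "K > 0" "\<Psi> b - \<Psi> a \<le> K" by (auto simp: K_def)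
    have "\<bar>\<Phi> b - \<Phi> a\<bar> \<le> e / K * (\<Psi> b - \<Psi> a)" by (rule bd) (use \<open>e > 0\<close> K in simp)
    also have "\<dots> \<le> e / K * K" using K \<open>e > 0\<close> by (intro mult_left_mono) auto
    finally show "\<bar>\<Phi> b - \<Phi> a\<bar> \<le> 0 + e" using K by simp
  qed
  then show ?thesis by simp
qed

text \<open>Since \<open>f\<close> need not have a pointwise derivative, the difference
  \<open>\<Phi>\<close> between \<open>\<phi> (f t)\<close> and the integral of the claimed density
  is shown to be constant. On a short interval the mean value theorem for \<open>\<phi>\<close>
  leaves the integral of \<open>(\<phi>' (f \<tau>) - \<phi>' (f t)) * g t\<close>, which uniform
  continuity bounds by \<open>e\<close> times the integral of the modulus of
  \<open>g\<close>.\<close>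

lemma has_density_chain:
  assumes f: "has_density f g a b"
    and S: "\<And>t. t \<in> {a..b} \<Longrightarrow> f t \<in> S"
    and der: "\<And>x. x \<in> S \<Longrightarrow> (\<phi> has_real_derivative \<phi>' x) (at x)"
    and cont: "continuous_on S \<phi>'"
  shows "has_density (\<lambda>t. \<phi> (f t)) (\<lambda>t. \<phi>' (f t) * g t) a b"
proof -
  have fc: "continuous_on {a..b} f" by (rule has_density_cont[OF f])
  have uc: "continuous_on {a..b} (\<lambda>t. \<phi>' (f t))"
    by (rule continuous_on_compose2[OF cont fc]) (use S in auto)
  have ai: "(\<lambda>t. \<phi>' (f t) * g t) absolutely_integrable_on {a..b}"
    by (rule abs_int_mult_cont[OF has_density_abs[OF f] uc])
  have main: "integral {c..d} (\<lambda>t. \<phi>' (f t) * g t) = \<phi> (f d) - \<phi> (f c)"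
    if cd: "a \<le> c" "c \<le> d" "d \<le> b" for c d
  proof -
    define h where "h t = \<phi>' (f t) * g t" for t
    have hi: "h integrable_on {u..v}" if "a \<le> u" "v \<le> b" for u v
      using ai that unfolding absolutely_integrable_on_def h_def
      by (metis atLeastatMost_subset_iff integrable_on_subinterval)
    have gabs: "(\<lambda>t. \<bar>g t\<bar>) integrable_on {u..v}" if "a \<le> u" "v \<le> b" for u v
      using has_density_abs[OF f] that unfolding absolutely_integrable_on_def real_norm_def
      by (metis atLeastatMost_subset_iff integrable_on_subinterval)
    define \<Phi> where "\<Phi> t = \<phi> (f t) - integral {c..t} h" for t
    define \<Psi> where "\<Psi> t = integral {c..t} (\<lambda>t. \<bar>g t\<bar>)" for t
    have split: "integral {c..v} k = integral {c..u} k + integral {u..v} k"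
      if "k integrable_on {c..v}" "c \<le> u" "u \<le> v" for k :: "real \<Rightarrow> real" and u v
      using Henstock_Kurzweil_Integration.integral_combine[of c u v k] that by simp
    have "\<Phi> d = \<Phi> c"
    proof (rule locally_small_increments_imp_const[OF cd(2), where \<Psi>=\<Psi>])
      fix e :: real assume e: "e > 0"
      have "uniformly_continuous_on {a..b} (\<lambda>t. \<phi>' (f t))"
        by (rule compact_uniformly_continuous[OF uc]) auto
      then obtain \<delta> where \<delta>: "\<delta> > 0" and
        D: "\<And>s t. s \<in> {a..b} \<Longrightarrow> t \<in> {a..b} \<Longrightarrow> dist s t < \<delta> \<Longrightarrow> dist (\<phi>' (f s)) (\<phi>' (f t)) < e"
        unfolding uniformly_continuous_on_def using e by metis
      have "\<bar>\<Phi> v - \<Phi> u\<bar> \<le> e * (\<Psi> v - \<Psi> u)"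
        if uv: "c \<le> u" "u \<le> v" "v \<le> d" "v - u < \<delta>" for u v
      proof -
        obtain \<tau> where \<tau>: "\<tau> \<in> {u..v}" "\<phi> (f v) - \<phi> (f u) = \<phi>' (f \<tau>) * (f v - f u)"
        proof (cases "f u = f v")
          case True
          then show ?thesis using that[of u] uv by simp
        next
          case False
          define lo hi where "lo = min (f u) (f v)" and "hi = max (f u) (f v)"
          have "lo < hi" using False by (auto simp: lo_def hi_def)
          \<comment> \<open>The mean value point lies between \<open>f u\<close> and
            \<open>f v\<close>; the intermediate value theorem pulls it back to a parameter. It also
            puts every value in between inside \<open>S\<close>, so an arbitrary set
            \<open>S\<close> is allowed.\<close>
          have conn: "\<exists>\<tau>\<in>{u..v}. f \<tau> = y" if y: "lo \<le> y" "y \<le> hi" for y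
          proof -
            have fcuv: "continuous_on {u..v} f" using fc uv cd by (rule_tac continuous_on_subset) auto
            show ?thesis
            proof (cases "f u \<le> f v")
              case True
              then show ?thesis using IVT'[of f u y v] y uv fcuv by (auto simp: lo_def hi_def)
            next
              case False
              then show ?thesis using IVT2'[of f v y u] y uv fcuv by (auto simp: lo_def hi_def)
            qed
          qed
          have inS: "y \<in> S" if "lo \<le> y" "y \<le> hi" for y
            using conn[OF that] S uv cd by force
          obtain z where z: "lo < z" "z < hi" "\<phi> hi - \<phi> lo = (hi - lo) * \<phi>' z"
            using MVT2[OF \<open>lo < hi\<close>, of \<phi> \<phi>'] der inS by blast
          obtain \<tau> where "\<tau> \<in> {u..v}" "f \<tau> = z" using conn z by (meson less_imp_le)
          moreover have "\<phi> (f v) - \<phi> (f u) = \<phi>' z * (f v - f u)"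
            using z(3) False by (auto simp: lo_def hi_def min_def max_def algebra_simps split: if_splits)
          ultimately show ?thesis using that by blast
        qed
        have gi: "(g has_integral (f v - f u)) {u..v}" using has_densityD[OF f] uv cd by auto
        have i1: "((\<lambda>t. \<phi>' (f \<tau>) * g t) has_integral (\<phi> (f v) - \<phi> (f u))) {u..v}"
          unfolding \<tau>(2) by (rule has_integral_mult_right[OF gi])
        have i2: "(h has_integral integral {u..v} h) {u..v}"
          using hi uv cd by (auto intro: integrable_integral)
        have i3: "((\<lambda>t. (\<phi>' (f \<tau>) - \<phi>' (f t)) * g t) has_integral (\<Phi> v - \<Phi> u)) {u..v}"
          using has_integral_diff[OF i1 i2] split[of h v u] hi[of c v] uv cd
          by (simp add: h_def \<Phi>_def algebra_simps)
        have i4: "((\<lambda>t. e * \<bar>g t\<bar>) has_integral e * (\<Psi> v - \<Psi> u)) {u..v}"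
          using has_integral_mult_right[OF integrable_integral[OF gabs[of u v]], of e]
            split[of "\<lambda>t. \<bar>g t\<bar>" v u] gabs[of c v] uv cd
          by (simp add: \<Psi>_def)
        have "norm (integral {u..v} (\<lambda>t. (\<phi>' (f \<tau>) - \<phi>' (f t)) * g t)) \<le> integral {u..v} (\<lambda>t. e * \<bar>g t\<bar>)"
        proof (rule integral_norm_bound_integral)
          fix t assume t: "t \<in> {u..v}"
          have "dist (\<phi>' (f \<tau>)) (\<phi>' (f t)) < e"
            using D[of \<tau> t] \<tau>(1) t uv cd by (auto simp: dist_real_def)
          then show "norm ((\<phi>' (f \<tau>) - \<phi>' (f t)) * g t) \<le> e * \<bar>g t\<bar>"
            by (simp add: abs_mult dist_real_def mult_right_mono)
        qed (use i3 i4 in auto)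
        then show ?thesis unfolding integral_unique[OF i3] integral_unique[OF i4] by simp
      qed
      with \<delta> show "\<exists>\<delta>>0. \<forall>u v. c \<le> u \<longrightarrow> u \<le> v \<longrightarrow> v \<le> d \<longrightarrow> v - u < \<delta> \<longrightarrow>
        \<bar>\<Phi> v - \<Phi> u\<bar> \<le> e * (\<Psi> v - \<Psi> u)" by blast
    qed
    then show ?thesis by (simp add: \<Phi>_def h_def[abs_def])
  qed
  show ?thesis unfolding has_density_def
  proof (intro conjI allI impI ai)
    fix c d assume cd: "a \<le> c" "c \<le> d" "d \<le> b"
    have "(\<lambda>t. \<phi>' (f t) * g t) integrable_on {c..d}"
      using ai cd unfolding absolutely_integrable_on_def
      by (metis atLeastatMost_subset_iff integrable_on_subinterval)
    then show "((\<lambda>t. \<phi>' (f t) * g t) has_integral \<phi> (f d) - \<phi> (f c)) {c..d}"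
      using main[OF cd] by (metis integrable_integral)
  qed
qed

lemma has_density_square:
  assumes "has_density f g a b"
  shows "has_density (\<lambda>t. (f t)\<^sup>2) (\<lambda>t. 2 * f t * g t) a b"
proof -
  have "((\<lambda>x. x\<^sup>2) has_real_derivative 2 * x) (at x)" for x :: real
    by (auto intro!: derivative_eq_intros)
  then show ?thesis
    by (intro has_density_chain[OF assms, where S=UNIV and \<phi>="\<lambda>x. x\<^sup>2" and \<phi>'="\<lambda>x. 2*x"])
      (auto intro!: continuous_intros)
qed

lemma has_density_mult:
  assumes "has_density f g a b" "has_density f' g' a b"
  shows "has_density (\<lambda>t. f t * f' t) (\<lambda>t. f t * g' t + g t * f' t) a b"
proof -
  \<comment> \<open>Polarization reduces the product rule to the chain rule for squares.\<close>
  have "has_density (\<lambda>t. (1/2) * ((f t + f' t)\<^sup>2 - (f t)\<^sup>2 - (f' t)\<^sup>2))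
    (\<lambda>t. (1/2) * (2 * (f t + f' t) * (g t + g' t) - 2 * f t * g t - 2 * f' t * g' t)) a b"
    by (intro has_density_cmul has_density_diff has_density_square has_density_add assms)
  then show ?thesis by (simp add: power2_eq_square algebra_simps)
qed

lemma has_density_cong:
  assumes "has_density f g a b" "\<And>t. t \<in> {a..b} \<Longrightarrow> f t = f' t" "\<And>t. t \<in> {a..b} \<Longrightarrow> g t = g' t"
  shows "has_density f' g' a b"
  unfolding has_density_def
proof (intro conjI allI impI)
  show "g' absolutely_integrable_on {a..b}"
    using has_density_abs[OF assms(1)] assms(3)
    by (subst set_integrable_cong[OF refl refl, of _ g' g]) auto
  fix c d assume cd: "a \<le> c" "c \<le> d" "d \<le> b"
  have "(g has_integral f' d - f' c) {c..d}"
    using has_densityD[OF assms(1) cd] assms(2) cd by auto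
  then show "(g' has_integral f' d - f' c) {c..d}"
    by (rule has_integral_eq[rotated]) (use cd assms(3) in auto)
qed

text \<open>The integral of (u - k w)^2 / w is a nonnegative quadratic in \<open>k\<close>, and its
  minimum gives the inequality. It is used with two weights: the speed, and the speed over the
  square of a sine.\<close>

lemma weighted_Cauchy_Schwarz:
  fixes u w :: "real \<Rightarrow> real"
  assumes "a \<le> b" and u: "u integrable_on {a..b}" and uw: "(\<lambda>t. (u t)\<^sup>2 / w t) integrable_on {a..b}"
    and w: "w integrable_on {a..b}" and pos: "\<And>t. t \<in> {a..b} \<Longrightarrow> w t > 0"
  shows "(integral {a..b} u)\<^sup>2 \<le> integral {a..b} (\<lambda>t. (u t)\<^sup>2 / w t) * integral {a..b} w"
proof -
  define U Q W where "U = integral {a..b} u" and "Q = integral {a..b} (\<lambda>t. (u t)\<^sup>2 / w t)"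
    and "W = integral {a..b} w"
  have key: "0 \<le> Q - 2 * k * U + k\<^sup>2 * W" for k
  proof -
    have "((\<lambda>t. (u t)\<^sup>2 / w t - 2 * k * u t + k\<^sup>2 * w t) has_integral (Q - 2 * k * U + k\<^sup>2 * W)) {a..b}"
      unfolding Q_def U_def W_def
      by (intro has_integral_add has_integral_diff has_integral_mult_right integrable_integral u uw w)
    moreover have "(u t)\<^sup>2 / w t - 2 * k * u t + k\<^sup>2 * w t = (u t - k * w t)\<^sup>2 / w t" if "t \<in> {a..b}" for t
      using pos[OF that] by (simp add: field_simps power2_eq_square)
    ultimately show ?thesis
      by (smt (verit) has_integral_nonneg pos zero_le_divide_iff zero_le_power2)
  qed
  have W0: "W \<ge> 0" unfolding W_def using pos by (intro integral_nonneg w) (auto intro: less_imp_le)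
  show ?thesis
  proof (cases "W = 0")
    \<comment> \<open>This covers \<open>a = b\<close>: an affine function of \<open>k\<close> that
      stays nonnegative has slope zero.\<close>
    case True
    have "U = 0"
    proof (rule ccontr)
      assume "U \<noteq> 0"
      then show False using key[of "(Q + 1) / (2 * U)"] True by simp
    qed
    then show ?thesis using True by (simp add: U_def W_def)
  next
    case False
    then have "W > 0" using W0 by simp
    have "0 \<le> Q - 2 * (U / W) * U + (U / W)\<^sup>2 * W" by (rule key)
    then have "U\<^sup>2 \<le> Q * W" using \<open>W > 0\<close> by (simp add: field_simps power2_eq_square)
    then show ?thesis by (simp add: U_def W_def Q_def)
  qed
qed

section \<open>Picone's identity and Poincare inequalities with a weight\<close>

lemma has_density_reflect:
  assumes "has_density f g a b"
  shows "has_density (\<lambda>t. f (- t)) (\<lambda>t. - g (- t)) (- b) (- a)"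
  unfolding has_density_def
proof (intro conjI allI impI)
  have "(\<lambda>t. g (- t)) absolutely_integrable_on {-b..-a}"
    using has_density_abs[OF assms] Henstock_Kurzweil_Integration.integrable_reflect_real[where f="\<lambda>t. \<bar>g t\<bar>"]
    unfolding absolutely_integrable_on_def by simp
  then show "(\<lambda>t. - g (- t)) absolutely_integrable_on {-b..-a}"
    unfolding absolutely_integrable_on_def by (simp add: integrable_neg_iff)
  fix c d assume "- b \<le> c" "c \<le> d" "d \<le> - a"
  then have "(g has_integral f (- c) - f (- d)) {-d..-c}" by (intro has_densityD[OF assms]) auto
  then have "((\<lambda>t. g (- t)) has_integral f (- c) - f (- d)) {c..d}"
    using has_integral_reflect_real[of g "f (- c) - f (- d)" "-c" "-d"] by simp
  then show "((\<lambda>t. - g (- t)) has_integral f (- d) - f (- c)) {c..d}"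
    by (drule_tac has_integral_neg) simp
qed

text \<open>Below pi/2 this is x <= tan x; beyond it the cotangent is not positive. It controls the
  coefficient in Picone's identity where that coefficient blows up, at a zero of
  \<open>f\<close>.\<close>

lemma cot_le_inverse:
  assumes "0 < x" "x < pi" shows "cot x \<le> 1 / x"
proof (cases "x < pi/2")
  case True
  have "arctan (tan x) \<le> tan x"
    using tan_gt_zero[of x] True assms by (intro arctan_le_self) auto
  moreover have "arctan (tan x) = x" using True assms by (intro arctan_tan) auto
  ultimately have "x \<le> tan x" by simp
  then show ?thesis using assms True by (simp add: cot_altdef tan_gt_zero divide_simps inverse_eq_divide)
next
  case False
  have "cos x \<le> cos (pi/2)" using False assms by (intro cos_monotone_0_pi_le) auto
  then have "cos x \<le> 0" by simp
  moreover have "sin x > 0" using assms by (intro sin_gt_zero) auto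
  ultimately have "cot x \<le> 0" by (simp add: cot_def divide_le_0_iff)
  then show ?thesis using assms by (smt (verit) divide_pos_pos)
qed

text \<open>For a curve, \<open>l\<close> is the speed and \<open>\<sigma>\<close> the arclength.
  With ds = l dt, \<open>dirichlet\<close> below is the integral of (df/ds)^2 ds and
  \<open>mass\<close> that of f^2 ds, so the sharp constants depend on
  \<open>\<sigma> b - \<sigma> a\<close> alone and the curve keeps its parameter.\<close>

locale weight =
  fixes l \<sigma> :: "real \<Rightarrow> real"
  assumes l_cont: "continuous_on UNIV l" and l_pos: "\<And>t. l t > 0"
    and \<sigma>_deriv: "\<And>t. (\<sigma> has_real_derivative l t) (at t)"
begin

lemma \<sigma>_cont: "continuous_on A \<sigma>"
  using \<sigma>_deriv by (meson DERIV_isCont continuous_at_imp_continuous_on)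

lemma \<sigma>_mono: "a < b \<Longrightarrow> \<sigma> a < \<sigma> b"
  using DERIV_pos_imp_increasing[of a b \<sigma>] \<sigma>_deriv l_pos by blast

lemma \<sigma>_le: "a \<le> b \<Longrightarrow> \<sigma> a \<le> \<sigma> b"
  using \<sigma>_mono by (metis less_eq_real_def)

lemma \<sigma>_inj: "\<sigma> a = \<sigma> b \<longleftrightarrow> a = b"
  by (metis \<sigma>_mono less_irrefl linorder_neqE_linordered_idom)

lemma l_cont_on: "continuous_on A l"
  using l_cont continuous_on_subset by blast

lemma l_integral: "a \<le> b \<Longrightarrow> (l has_integral \<sigma> b - \<sigma> a) {a..b}"
  using has_density_C1[of a b \<sigma> l] \<sigma>_deriv l_cont_on has_densityD by blast

definition H1 :: "(real \<Rightarrow> real) \<Rightarrow> (real \<Rightarrow> real) \<Rightarrow> real \<Rightarrow> real \<Rightarrow> bool" where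
  "H1 f m a b \<longleftrightarrow> has_density f m a b \<and> (\<lambda>t. (m t)\<^sup>2 / l t) integrable_on {a..b}"

definition dirichlet :: "(real \<Rightarrow> real) \<Rightarrow> real \<Rightarrow> real \<Rightarrow> real" where
  "dirichlet m a b = integral {a..b} (\<lambda>t. (m t)\<^sup>2 / l t)"

definition mass :: "(real \<Rightarrow> real) \<Rightarrow> real \<Rightarrow> real \<Rightarrow> real" where
  "mass f a b = integral {a..b} (\<lambda>t. (f t)\<^sup>2 * l t)"

lemma H1_sub: "H1 f m a b \<Longrightarrow> a \<le> c \<Longrightarrow> d \<le> b \<Longrightarrow> H1 f m c d"
  unfolding H1_def by (meson atLeastatMost_subset_iff has_density_sub integrable_on_subinterval)

lemma H1_cont: "H1 f m a b \<Longrightarrow> continuous_on {a..b} f"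
  unfolding H1_def using has_density_cont by blast

lemma H1_shift: "H1 f m a b \<Longrightarrow> H1 (\<lambda>t. f t - k) m a b"
  unfolding H1_def using has_density_diff[OF _ has_density_const, of f m a b k] by simp

lemma dirichlet_has_integral:
  "H1 f m a b \<Longrightarrow> ((\<lambda>t. (m t)\<^sup>2 / l t) has_integral dirichlet m a b) {a..b}"
  unfolding H1_def dirichlet_def by auto

lemma mass_has_integral:
  assumes "continuous_on {a..b} f"
  shows "((\<lambda>t. (f t)\<^sup>2 * l t) has_integral mass f a b) {a..b}"
  unfolding mass_def
  by (intro integrable_integral integrable_continuous_real continuous_intros assms l_cont_on)

lemma dirichlet_split:
  assumes "H1 f m a b" "a \<le> c" "c \<le> b"
  shows "dirichlet m a b = dirichlet m a c + dirichlet m c b"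
  using assms unfolding dirichlet_def H1_def
  by (simp add: Henstock_Kurzweil_Integration.integral_combine)

lemma mass_split:
  assumes "continuous_on {a..b} f" "a \<le> c" "c \<le> b"
  shows "mass f a b = mass f a c + mass f c b"
  using mass_has_integral[OF assms(1)] assms unfolding mass_def
  by (simp add: Henstock_Kurzweil_Integration.integral_combine has_integral_integrable)

lemma dirichlet_nonneg: "H1 f m a b \<Longrightarrow> dirichlet m a b \<ge> 0"
  by (rule has_integral_nonneg[OF dirichlet_has_integral]) (auto simp: l_pos less_imp_le)

lemma mass_nonneg: "continuous_on {a..b} f \<Longrightarrow> mass f a b \<ge> 0"
  by (rule has_integral_nonneg[OF mass_has_integral]) (auto simp: l_pos less_imp_le)

text \<open>Cauchy-Schwarz against the speed: Hoelder continuity of exponent 1/2 in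
  arclength.\<close>

lemma H1_increment:
  assumes "H1 f m a b" "a \<le> b"
  shows "(f b - f a)\<^sup>2 \<le> dirichlet m a b * (\<sigma> b - \<sigma> a)"
proof -
  have m: "(m has_integral f b - f a) {a..b}" using assms by (auto simp: H1_def intro: has_densityD)
  have "(integral {a..b} m)\<^sup>2 \<le> integral {a..b} (\<lambda>t. (m t)\<^sup>2 / l t) * integral {a..b} l"
    using assms m l_integral[of a b] l_pos
    by (intro weighted_Cauchy_Schwarz) (auto simp: H1_def)
  then show ?thesis using m l_integral[of a b] assms by (simp add: dirichlet_def integral_unique)
qed

text \<open>Completing the square with the solution \<open>V\<close> of the Riccati equation \<open>V' = - (\<omega>\<^sup>2 + V\<^sup>2) l\<close>.\<close>
lemma Picone_identity:
  assumes f: "H1 f m c d" and cd: "c \<le> d"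
    and nz: "\<And>t. t \<in> {c..d} \<Longrightarrow> sin (\<omega> * (\<sigma> t - s0)) \<noteq> 0"
  defines "V \<equiv> \<lambda>t. \<omega> * cot (\<omega> * (\<sigma> t - s0))"
  shows "((\<lambda>t. (m t - l t * V t * f t)\<^sup>2 / l t) has_integral
     dirichlet m c d - \<omega>\<^sup>2 * mass f c d - (V d * (f d)\<^sup>2 - V c * (f c)\<^sup>2)) {c..d}"
proof -
  define V' where "V' t = - (\<omega>\<^sup>2 + (V t)\<^sup>2) * l t" for t
  have dV: "(V has_real_derivative V' t) (at t)" if t: "t \<in> {c..d}" for t
  proof -
    define s where "s = \<omega> * (\<sigma> t - s0)"
    have s: "sin s \<noteq> 0" using nz[OF t] by (simp add: s_def)
    have "(V has_real_derivative \<omega> * (- inverse ((sin s)\<^sup>2) * (\<omega> * l t))) (at t)"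
      unfolding V_def s_def
      by (rule DERIV_cmult, rule DERIV_chain2[OF DERIV_cot])
        (use s in \<open>auto simp: s_def intro!: derivative_eq_intros \<sigma>_deriv\<close>)
    moreover have "inverse ((sin s)\<^sup>2) = 1 + (cot s)\<^sup>2"
      using s sin_cos_squared_add[of s] by (simp add: cot_def field_simps)
    ultimately show ?thesis
      unfolding V'_def V_def s_def[symmetric] by (simp add: power_mult_distrib power2_eq_square algebra_simps)
  qed
  have Vc: "continuous_on {c..d} V"
    using dV by (meson DERIV_isCont continuous_at_imp_continuous_on)
  have dens: "has_density V V' c d"
    by (rule has_density_C1[OF dV]) (auto simp: V'_def intro!: continuous_intros Vc l_cont_on)
  have fd: "has_density f m c d" using f by (simp add: H1_def)
  have "has_density (\<lambda>t. (f t)\<^sup>2 * V t) (\<lambda>t. (f t)\<^sup>2 * V' t + 2 * f t * m t * V t) c d"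
    by (rule has_density_mult[OF has_density_square[OF fd] dens])
  from has_densityD[OF this order_refl cd order_refl]
  have i: "((\<lambda>t. (f t)\<^sup>2 * V' t + 2 * f t * m t * V t) has_integral (f d)\<^sup>2 * V d - (f c)\<^sup>2 * V c) {c..d}" .
  have "((\<lambda>t. (m t)\<^sup>2 / l t - \<omega>\<^sup>2 * ((f t)\<^sup>2 * l t) - ((f t)\<^sup>2 * V' t + 2 * f t * m t * V t)) has_integral
     dirichlet m c d - \<omega>\<^sup>2 * mass f c d - (V d * (f d)\<^sup>2 - V c * (f c)\<^sup>2)) {c..d}"
    using has_integral_diff[OF has_integral_diff[OF dirichlet_has_integral[OF f]
       has_integral_mult_right[OF mass_has_integral[OF H1_cont[OF f]], of "\<omega>\<^sup>2"]] i]
    by (simp add: algebra_simps)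
  moreover have "(m t)\<^sup>2 / l t - \<omega>\<^sup>2 * ((f t)\<^sup>2 * l t) - ((f t)\<^sup>2 * V' t + 2 * f t * m t * V t)
     = (m t - l t * V t * f t)\<^sup>2 / l t" for t
    using l_pos[of t] by (simp add: V'_def field_simps power2_eq_square)
  ultimately show ?thesis by simp
qed

lemma sin_phase_pos:
  assumes "\<omega> > 0" "a < t" "t \<le> b" "\<omega> * (\<sigma> b - \<sigma> a) < pi"
  shows "sin (\<omega> * (\<sigma> t - \<sigma> a)) > 0" "0 < \<omega> * (\<sigma> t - \<sigma> a)" "\<omega> * (\<sigma> t - \<sigma> a) < pi"
proof -
  show p: "0 < \<omega> * (\<sigma> t - \<sigma> a)" using assms \<sigma>_mono[of a t] by simp
  have "\<omega> * (\<sigma> t - \<sigma> a) \<le> \<omega> * (\<sigma> b - \<sigma> a)" using assms \<sigma>_le[of t b] by (intro mult_left_mono) auto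
  then show q: "\<omega> * (\<sigma> t - \<sigma> a) < pi" using assms(4) by linarith
  show "sin (\<omega> * (\<sigma> t - \<sigma> a)) > 0" by (rule sin_gt_zero[OF p q])
qed

text \<open>The coefficient \<open>V\<close> is infinite at the zero \<open>a\<close>, so the
  identity is applied on \<open>{u..b}\<close> and \<open>u\<close> tends to \<open>a\<close>. There
  the boundary term is at most f(u)^2 over the arclength from \<open>a\<close> to \<open>u\<close>,
  hence at most the Dirichlet integral on \<open>{a..u}\<close>. The defect \<open>D\<close> is kept
  on \<open>{c..b}\<close> because stability is read off from it.\<close>

lemma Picone_left:
  assumes f: "H1 f m a b" and f0: "f a = 0" and \<omega>: "\<omega> > 0" "\<omega> * (\<sigma> b - \<sigma> a) < pi"
    and c: "a < c" "c \<le> b"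
  defines "V \<equiv> \<lambda>t. \<omega> * cot (\<omega> * (\<sigma> t - \<sigma> a))"
  defines "D \<equiv> \<lambda>t. (m t - l t * V t * f t)\<^sup>2 / l t"
  shows "D integrable_on {c..b}"
    and "integral {c..b} D + \<omega>\<^sup>2 * mass f a b + V b * (f b)\<^sup>2 \<le> dirichlet m a b"
proof -
  have fc: "continuous_on {a..b} f" using f by (rule H1_cont)
  have DI: "(D has_integral dirichlet m u b - \<omega>\<^sup>2 * mass f u b - (V b * (f b)\<^sup>2 - V u * (f u)\<^sup>2)) {u..b}"
    if u: "a < u" "u \<le> b" for u
    unfolding D_def V_def
  proof (rule Picone_identity[OF H1_sub[OF f]])
    show "sin (\<omega> * (\<sigma> t - \<sigma> a)) \<noteq> 0" if "t \<in> {u..b}" for t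
      using sin_phase_pos(1)[OF \<omega>(1) _ _ \<omega>(2), of t] that u by auto
  qed (use u in auto)
  show int: "D integrable_on {c..b}" using DI[OF c] by auto
  have D0: "D t \<ge> 0" for t unfolding D_def using l_pos[of t] by simp
  \<comment> \<open>\<open>K\<close> is the slack in the claim. For each \<open>u\<close> it is at
    least minus a multiple of the mass on \<open>{a..u}\<close>, which vanishes as \<open>u\<close>
    tends to \<open>a\<close>.\<close>
  define K where "K = dirichlet m a b - V b * (f b)\<^sup>2 - \<omega>\<^sup>2 * mass f a b - integral {c..b} D"
  have bound: "K + \<omega>\<^sup>2 * mass f a u \<ge> 0" if u: "a < u" "u \<le> c" for u
  proof -
    have ph: "0 < \<omega> * (\<sigma> u - \<sigma> a)" "\<omega> * (\<sigma> u - \<sigma> a) < pi"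
      using sin_phase_pos[OF \<omega>(1) u(1) _ \<omega>(2)] u c by auto
    have pos: "\<sigma> u - \<sigma> a > 0" using \<sigma>_mono u by simp
    have "V u \<le> \<omega> * (1 / (\<omega> * (\<sigma> u - \<sigma> a)))" unfolding V_def
      using cot_le_inverse[OF ph] \<omega> by (intro mult_left_mono) auto
    also have "\<dots> = 1 / (\<sigma> u - \<sigma> a)" using \<omega> by simp
    finally have "V u * (f u)\<^sup>2 \<le> 1 / (\<sigma> u - \<sigma> a) * (f u)\<^sup>2" by (rule mult_right_mono) simp
    also have "\<dots> \<le> dirichlet m a u"
      using H1_increment[OF H1_sub[OF f order_refl, of u]] u c f0 pos by (simp add: field_simps)
    finally have V: "V u * (f u)\<^sup>2 \<le> dirichlet m a u" .
    have "integral {c..b} D \<le> integral {u..b} D"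
      using DI[of u] DI[of c] u c D0 by (intro integral_subset_le) auto
    also have "\<dots> = dirichlet m u b - \<omega>\<^sup>2 * mass f u b - (V b * (f b)\<^sup>2 - V u * (f u)\<^sup>2)"
      using DI[of u] u c by (simp add: integral_unique)
    finally show ?thesis
      using V dirichlet_split[OF f, of u] mass_split[OF fc, of u] u c by (simp add: K_def algebra_simps)
  qed
  have "K \<ge> 0"
  proof (rule ccontr)
    assume "\<not> K \<ge> 0"
    then have K: "- K / \<omega>\<^sup>2 > 0" using \<omega> by (simp add: divide_neg_pos)
    have "continuous_on {a..b} (\<lambda>u. mass f a u)" unfolding mass_def
      by (rule indefinite_integral_continuous_1)
        (use mass_has_integral[OF fc] in auto)
    moreover have "a \<in> {a..b}" using c by simp
    ultimately obtain \<delta> where "\<delta> > 0" and \<delta>: "\<And>u. u \<in> {a..b} \<Longrightarrow> dist u a < \<delta> \<Longrightarrow> dist (mass f a u) (mass f a a) < - K / \<omega>\<^sup>2"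
      unfolding continuous_on_iff using K by blast
    define u where "u = min c (a + \<delta>/2)"
    have u: "a < u" "u \<le> c" "dist u a < \<delta>" using c \<open>\<delta> > 0\<close> by (auto simp: u_def dist_real_def)
    have "mass f a u < - K / \<omega>\<^sup>2" using \<delta>[of u] u c by (simp add: mass_def dist_real_def)
    then have "K + \<omega>\<^sup>2 * mass f a u < 0" using \<omega> by (simp add: field_simps)
    then show False using bound[OF u(1,2)] by simp
  qed
  then show "integral {c..b} D + \<omega>\<^sup>2 * mass f a b + V b * (f b)\<^sup>2 \<le> dirichlet m a b"
    by (simp add: K_def)
qed

text \<open>Picone's inequality with \<open>c = b\<close>, where the defect is an integral over a
  point. At phase pi/2 the cotangent vanishes and the sharp inequality for a zero at one end and a
  free other end remains. At other phases the boundary term matters: \<open>Wirtinger\<close>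
  cancels two such terms against each other.\<close>

lemma Poincare_left:
  assumes f: "H1 f m a b" and f0: "f a = 0" and "a \<le> b" and \<omega>: "\<omega> > 0" "\<omega> * (\<sigma> b - \<sigma> a) < pi"
  shows "\<omega>\<^sup>2 * mass f a b + \<omega> * cot (\<omega> * (\<sigma> b - \<sigma> a)) * (f b)\<^sup>2 \<le> dirichlet m a b"
proof (cases "a = b")
  case True
  then show ?thesis using f0 by (simp add: mass_def dirichlet_def)
next
  case False
  with \<open>a \<le> b\<close> have "a < b" by simp
  with Picone_left(2)[OF f f0 \<omega> this] show ?thesis by simp
qed

text \<open>Picone's defect is a weighted square of the derivative of f / sin, so a small excess
  \<open>\<epsilon>\<close> makes this quotient nearly constant. Hence \<open>f\<close> is nearly a
  multiple of the sine, with the factor given by its value at \<open>b\<close>, where the sine is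
  1.\<close>

lemma sine_stability_left:
  assumes f: "H1 f m a b" and f0: "f a = 0" and \<omega>: "\<omega> \<ge> 1" "\<omega> * (\<sigma> b - \<sigma> a) = pi / 2"
    and \<epsilon>: "dirichlet m a b \<le> \<omega>\<^sup>2 * mass f a b + \<epsilon>"
    and c: "a \<le> c" "c \<le> b"
  shows "(f c - f b * sin (\<omega> * (\<sigma> c - \<sigma> a)))\<^sup>2 \<le> \<epsilon>"
proof (cases "c = a")
  case True
  have "0 \<le> \<epsilon>" using Poincare_left[OF f f0 _ _, of \<omega>] \<epsilon> \<omega> c by (simp add: cot_def)
  then show ?thesis using True f0 by simp
next
  case False
  then have ac: "a < c" using c by simp
  have w0: "\<omega> > 0" using \<omega> by simp
  have wpi: "\<omega> * (\<sigma> b - \<sigma> a) < pi" using \<omega> pi_gt_zero by linarith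
  define \<theta> where "\<theta> t = \<omega> * (\<sigma> t - \<sigma> a)" for t
  define V where "V t = \<omega> * cot (\<theta> t)" for t
  define D where "D t = (m t - l t * V t * f t)\<^sup>2 / l t" for t
  have D: "D integrable_on {c..b}" "integral {c..b} D \<le> \<epsilon>"
    using Picone_left[OF f f0 w0 wpi ac c(2)] \<epsilon> \<omega>
    unfolding D_def[abs_def] V_def \<theta>_def by (auto simp: cot_def)
  have sp: "sin (\<theta> t) > 0" if "t \<in> {c..b}" for t
    unfolding \<theta>_def using sin_phase_pos(1)[OF w0 _ _ wpi, of t] that ac by auto
  have \<theta>d: "(\<theta> has_real_derivative \<omega> * l t) (at t)" for t
    unfolding \<theta>_def by (auto intro!: derivative_eq_intros \<sigma>_deriv)
  have \<theta>c: "continuous_on A \<theta>" for A unfolding \<theta>_def by (intro continuous_intros \<sigma>_cont)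
  define S where "S t = inverse (sin (\<theta> t))" for t
  define S' where "S' t = - (\<omega> * l t * cos (\<theta> t) * (S t)\<^sup>2)" for t
  have Sc: "continuous_on {c..b} S" unfolding S_def
    using sp by (intro continuous_intros \<theta>c) (auto simp: less_le)
  have "has_density S S' c b"
  proof (rule has_density_C1)
    fix t assume t: "t \<in> {c..b}"
    show "(S has_real_derivative S' t) (at t)"
      using DERIV_inverse'[OF DERIV_chain2[OF DERIV_sin \<theta>d], of t] sp[OF t]
      by (simp add: S_def[abs_def] S'_def power2_eq_square mult_ac)
  next
    show "continuous_on {c..b} S'" unfolding S'_def
      by (intro continuous_intros Sc \<theta>c l_cont_on)
  qed
  moreover have "has_density f m c b" using H1_sub[OF f c(1) order_refl] by (simp add: H1_def)
  ultimately have "has_density (\<lambda>t. f t * S t) (\<lambda>t. f t * S' t + m t * S t) c b"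
    by (rule has_density_mult[rotated])
  then have hs: "((\<lambda>t. f t * S' t + m t * S t) has_integral f b * S b - f c * S c) {c..b}"
    using has_densityD c by blast
  define u where "u t = f t * S' t + m t * S t" for t
  \<comment> \<open>The weight for which u^2 / w is exactly Picone's defect.\<close>
  define w where "w t = l t * (S t)\<^sup>2" for t
  have u_eq: "u t = (m t - l t * V t * f t) * S t" if "t \<in> {c..b}" for t
    using sp[OF that] by (simp add: u_def S'_def V_def cot_def S_def field_simps power2_eq_square)
  have uw: "(u t)\<^sup>2 / w t = D t" if "t \<in> {c..b}" for t
    using sp[OF that] l_pos[of t] unfolding u_eq[OF that] w_def D_def S_def
    by (simp add: field_simps)
  have wpos: "w t > 0" if "t \<in> {c..b}" for t using sp[OF that] l_pos[of t] by (simp add: w_def S_def)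
  \<comment> \<open>The weight has the explicit primitive
    \<open>- cot (\<theta> t) / \<omega>\<close>, which vanishes at \<open>b\<close>. Its growth as
    \<open>c\<close> approaches \<open>a\<close> is absorbed by the factor sin^2 when the quotient
    is multiplied back.\<close>
  have wd: "(w has_integral cot (\<theta> c) / \<omega>) {c..b}"
  proof -
    have "has_density (\<lambda>t. - cot (\<theta> t) / \<omega>) w c b"
    proof (rule has_density_C1)
      fix t assume t: "t \<in> {c..b}"
      have "((\<lambda>t. cot (\<theta> t)) has_real_derivative - inverse ((sin (\<theta> t))\<^sup>2) * (\<omega> * l t)) (at t)"
        by (rule DERIV_chain2[OF DERIV_cot \<theta>d]) (use sp[OF t] in auto)
      from DERIV_cdivide[OF DERIV_minus[OF this], of \<omega>]
      show "((\<lambda>t. - cot (\<theta> t) / \<omega>) has_real_derivative w t) (at t)"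
        using w0 by (simp add: w_def S_def power_inverse field_simps)
    next
      show "continuous_on {c..b} w" unfolding w_def by (intro continuous_intros Sc l_cont_on)
    qed
    then have "(w has_integral (- cot (\<theta> b) / \<omega>) - (- cot (\<theta> c) / \<omega>)) {c..b}"
      using has_densityD c by blast
    moreover have "cot (\<theta> b) = 0" by (simp add: \<theta>_def \<omega> cot_def)
    ultimately show ?thesis by simp
  qed
  have "(integral {c..b} u)\<^sup>2 \<le> integral {c..b} (\<lambda>t. (u t)\<^sup>2 / w t) * integral {c..b} w"
  proof (intro weighted_Cauchy_Schwarz)
    show "(\<lambda>t. (u t)\<^sup>2 / w t) integrable_on {c..b}"
      by (rule integrable_eq[OF D(1)]) (use uw in auto)
    show "u integrable_on {c..b}" using hs by (auto simp: u_def[abs_def])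
  qed (use wd wpos c in auto)
  also have "integral {c..b} (\<lambda>t. (u t)\<^sup>2 / w t) = integral {c..b} D"
    by (rule integral_cong) (use uw in auto)
  finally have CS: "(f b * S b - f c * S c)\<^sup>2 \<le> integral {c..b} D * (cot (\<theta> c) / \<omega>)"
    using wd hs by (simp add: integral_unique u_def[abs_def])
  have thc: "\<theta> c \<le> pi/2" "\<theta> c \<ge> 0"
  proof -
    have "\<omega> * (\<sigma> c - \<sigma> a) \<le> \<omega> * (\<sigma> b - \<sigma> a)" using w0 \<sigma>_le[of c b] c by (intro mult_left_mono) auto
    then show "\<theta> c \<le> pi/2" using \<omega> by (simp add: \<theta>_def)
    show "\<theta> c \<ge> 0" using w0 \<sigma>_le[of a c] c by (simp add: \<theta>_def)
  qed
  have sc: "sin (\<theta> c) > 0" "cos (\<theta> c) \<ge> 0" using sp c thc by (auto intro: cos_ge_zero)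
  have Dnn: "integral {c..b} D \<ge> 0" using D(1) l_pos by (intro integral_nonneg) (auto simp: D_def less_imp_le)
  have "sin (\<theta> b) = 1" by (simp add: \<theta>_def \<omega>)
  then have "(f c - f b * sin (\<theta> c))\<^sup>2 = (f b * S b - f c * S c)\<^sup>2 * (sin (\<theta> c))\<^sup>2"
    unfolding power_mult_distrib[symmetric] S_def using sc(1)
    by (simp add: left_diff_distrib power2_commute mult.assoc)
  also have "\<dots> \<le> integral {c..b} D * (cot (\<theta> c) / \<omega>) * (sin (\<theta> c))\<^sup>2"
    by (rule mult_right_mono[OF CS]) simp
  also have "\<dots> = integral {c..b} D * (sin (\<theta> c) * cos (\<theta> c) / \<omega>)"
    using sc(1) by (simp add: cot_def power2_eq_square)
  also have "\<dots> \<le> integral {c..b} D * 1"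
  proof (rule mult_left_mono[OF _ Dnn])
    have "sin (\<theta> c) * cos (\<theta> c) \<le> 1 * 1" using sc by (intro mult_mono) auto
    then show "sin (\<theta> c) * cos (\<theta> c) / \<omega> \<le> 1" using \<omega> by (simp add: field_simps)
  qed
  finally show ?thesis using D(2) by (simp add: \<theta>_def)
qed

section \<open>Zeros at the right end, by the reflection t -> -t\<close>

lemma reflected_weight: "weight (\<lambda>t. l (- t)) (\<lambda>t. - \<sigma> (- t))"
proof
  show "continuous_on UNIV (\<lambda>t. l (- t))"
    by (intro continuous_on_compose2[OF l_cont]) (auto intro!: continuous_intros)
  show "((\<lambda>t. - \<sigma> (- t)) has_real_derivative l (- t)) (at t)" for t
    by (auto intro!: derivative_eq_intros DERIV_chain2[OF \<sigma>_deriv])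
qed (rule l_pos)

lemma reflected:
  assumes "H1 f m a b"
  shows "weight.H1 (\<lambda>t. l (- t)) (\<lambda>t. f (- t)) (\<lambda>t. - m (- t)) (- b) (- a)"
    and "weight.dirichlet (\<lambda>t. l (- t)) (\<lambda>t. - m (- t)) (- b) (- a) = dirichlet m a b"
    and "weight.mass (\<lambda>t. l (- t)) (\<lambda>t. f (- t)) (- b) (- a) = mass f a b"
proof -
  interpret R: weight "\<lambda>t. l (- t)" "\<lambda>t. - \<sigma> (- t)" by (rule reflected_weight)
  show "R.H1 (\<lambda>t. f (- t)) (\<lambda>t. - m (- t)) (- b) (- a)"
    using assms has_density_reflect[of f m a b]
      Henstock_Kurzweil_Integration.integrable_reflect_real[of "\<lambda>t. (m t)\<^sup>2 / l t" b a]
    by (simp add: R.H1_def H1_def)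
  show "R.dirichlet (\<lambda>t. - m (- t)) (- b) (- a) = dirichlet m a b"
    using Henstock_Kurzweil_Integration.integral_reflect_real[of b a "\<lambda>t. (m t)\<^sup>2 / l t"]
    by (simp add: R.dirichlet_def dirichlet_def)
  show "R.mass (\<lambda>t. f (- t)) (- b) (- a) = mass f a b"
    using Henstock_Kurzweil_Integration.integral_reflect_real[of b a "\<lambda>t. (f t)\<^sup>2 * l t"]
    by (simp add: R.mass_def mass_def)
qed

lemma Poincare_right:
  assumes f: "H1 f m a b" and f0: "f b = 0" and "a \<le> b" and \<omega>: "\<omega> > 0" "\<omega> * (\<sigma> b - \<sigma> a) < pi"
  shows "\<omega>\<^sup>2 * mass f a b + \<omega> * cot (\<omega> * (\<sigma> b - \<sigma> a)) * (f a)\<^sup>2 \<le> dirichlet m a b"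
proof -
  interpret R: weight "\<lambda>t. l (- t)" "\<lambda>t. - \<sigma> (- t)" by (rule reflected_weight)
  from R.Poincare_left[OF reflected(1)[OF f], of \<omega>] show ?thesis
    using assms unfolding reflected(2)[OF f] reflected(3)[OF f] by (simp add: algebra_simps)
qed

lemma sine_stability_right:
  assumes f: "H1 f m a b" and f0: "f b = 0" and \<omega>: "\<omega> \<ge> 1" "\<omega> * (\<sigma> b - \<sigma> a) = pi / 2"
    and \<epsilon>: "dirichlet m a b \<le> \<omega>\<^sup>2 * mass f a b + \<epsilon>"
    and c: "a \<le> c" "c \<le> b"
  shows "(f c - f a * sin (\<omega> * (\<sigma> b - \<sigma> c)))\<^sup>2 \<le> \<epsilon>"
proof -
  interpret R: weight "\<lambda>t. l (- t)" "\<lambda>t. - \<sigma> (- t)" by (rule reflected_weight)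
  from R.sine_stability_left[OF reflected(1)[OF f], of \<omega> \<epsilon> "- c"] show ?thesis
    using assms unfolding reflected(2)[OF f] reflected(3)[OF f] by (simp add: algebra_simps)
qed

lemma mass_shift:
  assumes f: "continuous_on {a..b} f" and mean: "((\<lambda>t. f t * l t) has_integral 0) {a..b}" and "a \<le> b"
  shows "mass (\<lambda>t. f t - k) a b = mass f a b + k\<^sup>2 * (\<sigma> b - \<sigma> a)"
proof -
  have "((\<lambda>t. (f t)\<^sup>2 * l t - 2 * k * (f t * l t) + k\<^sup>2 * l t) has_integral
      mass f a b - 2 * k * 0 + k\<^sup>2 * (\<sigma> b - \<sigma> a)) {a..b}"
    by (intro has_integral_add has_integral_diff has_integral_mult_right mass_has_integral f mean
        l_integral \<open>a \<le> b\<close>)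
  moreover have "(f t)\<^sup>2 * l t - 2 * k * (f t * l t) + k\<^sup>2 * l t = (f t - k)\<^sup>2 * l t" for t
    by (simp add: power2_eq_square algebra_simps)
  ultimately show ?thesis unfolding mass_def by (simp add: integral_unique)
qed

text \<open>A mean zero function has the least mass among its translates by constants. Since the
  Dirichlet integral ignores constants, a Poincare inequality may be proved for whichever translate
  has convenient zeros.\<close>

lemma mass_le_shift:
  assumes "continuous_on {a..b} f" "((\<lambda>t. f t * l t) has_integral 0) {a..b}" "a \<le> b"
  shows "mass f a b \<le> mass (\<lambda>t. f t - k) a b"
  using mass_shift[OF assms, of k] \<sigma>_le[OF assms(3)] by simp

section \<open>Sharp inequalities on arcs of length one half, one and one quarter\<close>

lemma phase_point:
  assumes "a \<le> b" "\<sigma> a \<le> y" "y \<le> \<sigma> b"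
  obtains c where "a \<le> c" "c \<le> b" "\<sigma> c = y"
  using IVT'[of \<sigma> a y b] assms \<sigma>_cont by blast

text \<open>Cutting at the midpoint in arclength gives two arcs of phase pi/2, each with a zero at
  its outer end. The cut contributes nothing, because the cotangent vanishes there.\<close>

lemma Dirichlet_half:
  assumes f: "H1 f m a b" and "f a = 0" "f b = 0" "a \<le> b" and len: "\<sigma> b - \<sigma> a = 1/2"
  shows "(2 * pi)\<^sup>2 * mass f a b \<le> dirichlet m a b"
proof -
  obtain c where c: "a \<le> c" "c \<le> b" "\<sigma> c = \<sigma> a + 1/4"
    using phase_point[OF \<open>a \<le> b\<close>, of "\<sigma> a + 1/4"] len by auto
  have ct: "2 * pi * (\<sigma> c - \<sigma> a) = pi/2" "2 * pi * (\<sigma> b - \<sigma> c) = pi/2"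
    using c len by auto
  have "(2 * pi)\<^sup>2 * mass f a c \<le> dirichlet m a c"
    using Poincare_left[OF H1_sub[OF f order_refl c(2)], of "2 * pi"] assms c unfolding ct by (simp add: cot_def)
  moreover have "(2 * pi)\<^sup>2 * mass f c b \<le> dirichlet m c b"
    using Poincare_right[OF H1_sub[OF f c(1) order_refl], of "2 * pi"] assms c unfolding ct by (simp add: cot_def)
  ultimately show ?thesis
    using dirichlet_split[OF f c(1,2)] mass_split[OF H1_cont[OF f] c(1,2)] by (simp add: algebra_simps)
qed

lemma phase_inverse:
  assumes "a \<le> b"
  obtains \<tau> where "continuous_on {\<sigma> a..\<sigma> b} \<tau>" "\<And>s. s \<in> {\<sigma> a..\<sigma> b} \<Longrightarrow> \<tau> s \<in> {a..b} \<and> \<sigma> (\<tau> s) = s"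
proof
  define \<tau> where "\<tau> = inv_into {a..b} \<sigma>"
  have img: "\<sigma> ` {a..b} = {\<sigma> a..\<sigma> b}"
  proof
    show "{\<sigma> a..\<sigma> b} \<subseteq> \<sigma> ` {a..b}"
    proof
      fix y assume "y \<in> {\<sigma> a..\<sigma> b}"
      then obtain c where "a \<le> c" "c \<le> b" "\<sigma> c = y" using phase_point[OF assms, of y] by auto
      then show "y \<in> \<sigma> ` {a..b}" by auto
    qed
  qed (auto intro: \<sigma>_le)
  have inj: "inj_on \<sigma> {a..b}" by (simp add: inj_on_def \<sigma>_inj)
  have "\<tau> (\<sigma> t) = t" if "t \<in> {a..b}" for t using that inj by (simp add: \<tau>_def)
  then show "continuous_on {\<sigma> a..\<sigma> b} \<tau>"
    unfolding img[symmetric] by (intro continuous_on_inv \<sigma>_cont) auto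
  show "\<tau> s \<in> {a..b} \<and> \<sigma> (\<tau> s) = s" if "s \<in> {\<sigma> a..\<sigma> b}" for s
    using that unfolding img[symmetric] \<tau>_def by (metis f_inv_into_f inv_into_into)
qed

text \<open>Some pair of points at arclength distance 1/2 has equal values. Subtracting that value
  produces two zeros that cut the closed curve into two arcs of length 1/2.
  \<open>Dirichlet_half\<close> handles the arc between them. The other arc passes through the base
  point and is treated as two pieces, whose boundary terms there, cot(alpha) and cot(pi - alpha)
  times the same square, cancel.\<close>

lemma Wirtinger:
  assumes f: "H1 f m a b" and per: "f a = f b" and "a \<le> b" and len: "\<sigma> b - \<sigma> a = 1"
    and mean: "((\<lambda>t. f t * l t) has_integral 0) {a..b}"
  shows "(2 * pi)\<^sup>2 * mass f a b \<le> dirichlet m a b"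
proof -
  obtain \<tau> where \<tau>c: "continuous_on {\<sigma> a..\<sigma> b} \<tau>"
    and \<tau>: "\<And>s. s \<in> {\<sigma> a..\<sigma> b} \<Longrightarrow> \<tau> s \<in> {a..b} \<and> \<sigma> (\<tau> s) = s"
    using phase_inverse[OF \<open>a \<le> b\<close>] by blast
  have fc: "continuous_on {a..b} f" by (rule H1_cont[OF f])
  have f\<tau>: "continuous_on {\<sigma> a..\<sigma> b} (\<lambda>s. f (\<tau> s))"
    by (rule continuous_on_compose2[OF fc \<tau>c]) (use \<tau> in auto)
  \<comment> \<open>The difference of antipodal values changes sign over half a period.\<close>
  define g where "g s = f (\<tau> (s + 1/2)) - f (\<tau> s)" for s
  have gc: "continuous_on {\<sigma> a..\<sigma> a + 1/2} g" unfolding g_def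
    by (intro continuous_intros continuous_on_compose2[OF f\<tau>]) (use len in auto)
  have ends: "\<tau> (\<sigma> a) = a" "\<tau> (\<sigma> b) = b"
    using \<tau>[of "\<sigma> a"] \<tau>[of "\<sigma> b"] len \<sigma>_inj by auto
  have "\<sigma> a + 1/2 + 1/2 = \<sigma> b" using len by simp
  then have "g (\<sigma> a + 1/2) = - g (\<sigma> a)" using ends per by (simp add: g_def)
  then have "\<exists>s. \<sigma> a \<le> s \<and> s \<le> \<sigma> a + 1/2 \<and> g s = 0"
    using IVT'[of g "\<sigma> a" 0 "\<sigma> a + 1/2"] IVT2'[of g "\<sigma> a + 1/2" 0 "\<sigma> a"] gc by force
  then obtain s where s: "\<sigma> a \<le> s" "s \<le> \<sigma> a + 1/2" "g s = 0" by blast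
  define t0 t1 where "t0 = \<tau> s" and "t1 = \<tau> (s + 1/2)"
  have t0: "a \<le> t0" "t0 \<le> b" "\<sigma> t0 = s" and t1: "a \<le> t1" "t1 \<le> b" "\<sigma> t1 = s + 1/2"
    using \<tau>[of s] \<tau>[of "s + 1/2"] s len by (auto simp: t0_def t1_def)
  have feq: "f t1 = f t0" using s(3) by (simp add: g_def t0_def t1_def)
  have "t0 \<le> t1" using \<sigma>_mono[of t1 t0] t0 t1 by (rule_tac leI) auto
  define F where "F t = f t - f t0" for t
  have F: "H1 F m a b" unfolding F_def by (rule H1_shift[OF f])
  have F0: "F t0 = 0" "F t1 = 0" "F a = F b" using feq per by (auto simp: F_def)
  have Fc: "continuous_on {a..b} F" by (rule H1_cont[OF F])
  have "(2 * pi)\<^sup>2 * mass F a b \<le> dirichlet m a b"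
  proof (cases "s = \<sigma> a \<or> s = \<sigma> a + 1/2")
    \<comment> \<open>A zero at the base point makes one piece degenerate and the cotangent
      singular. Then \<open>a\<close>, the midpoint \<open>h\<close> and \<open>b\<close> are all
      zeros, and \<open>Dirichlet_half\<close> covers both halves.\<close>
    case True
    define h where "h = \<tau> (\<sigma> a + 1/2)"
    have h: "a \<le> h" "h \<le> b" "\<sigma> h = \<sigma> a + 1/2" using \<tau>[of "\<sigma> a + 1/2"] len by (auto simp: h_def)
    have "F a = 0 \<and> F h = 0 \<and> F b = 0"
      using True
    proof
      assume "s = \<sigma> a"
      then have "t0 = a" "t1 = h" using ends by (auto simp: t0_def t1_def h_def)
      then show ?thesis using F0 by simp
    next
      assume "s = \<sigma> a + 1/2"
      then have "t0 = h" "t1 = b" using t1 len \<sigma>_inj[of t1 b] by (auto simp: t0_def h_def)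
      then show ?thesis using F0 by simp
    qed
    then have "(2 * pi)\<^sup>2 * mass F a h \<le> dirichlet m a h" "(2 * pi)\<^sup>2 * mass F h b \<le> dirichlet m h b"
      using Dirichlet_half[OF H1_sub[OF F order_refl h(2)]] Dirichlet_half[OF H1_sub[OF F h(1) order_refl]]
        h len by auto
    then show ?thesis
      using dirichlet_split[OF F h(1,2)] mass_split[OF Fc h(1,2)] by (simp add: algebra_simps)
  next
    case False
    then have s': "\<sigma> a < s" "s < \<sigma> a + 1/2" using s by auto
    define \<alpha> where "\<alpha> = 2 * pi * (\<sigma> t0 - \<sigma> a)"
    have \<beta>: "2 * pi * (\<sigma> b - \<sigma> t1) = pi - \<alpha>" using t0 t1 len by (simp add: \<alpha>_def algebra_simps)
    have "(2 * pi)\<^sup>2 * mass F a t0 + 2 * pi * cot \<alpha> * (F a)\<^sup>2 \<le> dirichlet m a t0"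
      unfolding \<alpha>_def
      by (rule Poincare_right[OF H1_sub[OF F order_refl t0(2)]]) (use t0 s' F0 in auto)
    moreover have "(2 * pi)\<^sup>2 * mass F t1 b + 2 * pi * cot (pi - \<alpha>) * (F b)\<^sup>2 \<le> dirichlet m t1 b"
      unfolding \<beta>[symmetric]
      by (rule Poincare_left[OF H1_sub[OF F t1(1) order_refl]]) (use t1 s' F0 len in auto)
    moreover have "cot (pi - \<alpha>) = - cot \<alpha>" by (simp add: cot_def)
    moreover have "(2 * pi)\<^sup>2 * mass F t0 t1 \<le> dirichlet m t0 t1"
      by (rule Dirichlet_half[OF H1_sub[OF F t0(1) t1(2)]]) (use t0 t1 F0 \<open>t0 \<le> t1\<close> in auto)
    moreover have "dirichlet m a b = dirichlet m a t0 + dirichlet m t0 t1 + dirichlet m t1 b"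
      using dirichlet_split[OF F t1(1,2)] dirichlet_split[OF H1_sub[OF F order_refl t1(2)] t0(1) \<open>t0 \<le> t1\<close>] by simp
    moreover have "mass F a b = mass F a t0 + mass F t0 t1 + mass F t1 b"
      using mass_split[OF Fc t1(1,2)] mass_split[OF H1_cont[OF H1_sub[OF F order_refl t1(2)]] t0(1) \<open>t0 \<le> t1\<close>] by simp
    ultimately show ?thesis using F0(3) by (simp add: algebra_simps)
  qed
  moreover have "mass f a b \<le> mass F a b" unfolding F_def
    by (rule mass_le_shift[OF fc mean \<open>a \<le> b\<close>])
  then have "(2 * pi)\<^sup>2 * mass f a b \<le> (2 * pi)\<^sup>2 * mass F a b" by (intro mult_left_mono) auto
  ultimately show ?thesis by linarith
qed

lemma H1_bound_from_zero:
  assumes f: "H1 f m a b" and z: "z \<in> {a..b}" "f z = 0" and t: "t \<in> {a..b}"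
  shows "(f t)\<^sup>2 \<le> dirichlet m a b * (\<sigma> b - \<sigma> a)"
proof -
  define p q where "p = min t z" and "q = max t z"
  have pq: "a \<le> p" "p \<le> q" "q \<le> b" using z t by (auto simp: p_def q_def)
  have "(f t)\<^sup>2 = (f q - f p)\<^sup>2" using z by (auto simp: p_def q_def min_def max_def)
  also have "\<dots> \<le> dirichlet m p q * (\<sigma> q - \<sigma> p)"
    by (rule H1_increment[OF H1_sub[OF f pq(1,3)] pq(2)])
  also have "\<dots> \<le> dirichlet m a b * (\<sigma> b - \<sigma> a)"
  proof (rule mult_mono)
    show "dirichlet m p q \<le> dirichlet m a b"
      using dirichlet_split[OF f, of q] dirichlet_split[OF H1_sub[OF f order_refl pq(3)], of p] pq
        dirichlet_nonneg[OF H1_sub[OF f, of q b]] dirichlet_nonneg[OF H1_sub[OF f, of a p]] by simp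
    show "\<sigma> q - \<sigma> p \<le> \<sigma> b - \<sigma> a" "0 \<le> \<sigma> q - \<sigma> p"
      using \<sigma>_le[OF pq(1)] \<sigma>_le[OF pq(2)] \<sigma>_le[OF pq(3)] by auto
  qed (rule dirichlet_nonneg[OF f])
  finally show ?thesis .
qed

text \<open>Subtracting the value at the midpoint leaves two arcs of length 1/8 with a zero at the
  cut; at frequency 4 pi each has phase pi/2. The constant is four times (2 pi)^2, and this gap
  later bounds the tangent component off the plane of the circle.\<close>

lemma Poincare_mean_zero_quarter:
  assumes f: "H1 f m a b" and "a \<le> b" and len: "\<sigma> b - \<sigma> a = 1/4"
    and mean: "((\<lambda>t. f t * l t) has_integral 0) {a..b}"
  shows "(4 * pi)\<^sup>2 * mass f a b \<le> dirichlet m a b"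
proof -
  obtain c where c: "a \<le> c" "c \<le> b" "\<sigma> c = \<sigma> a + 1/8"
    using phase_point[OF \<open>a \<le> b\<close>, of "\<sigma> a + 1/8"] len by auto
  define F where "F t = f t - f c" for t
  have F: "H1 F m a b" unfolding F_def by (rule H1_shift[OF f])
  have F0: "F c = 0" by (simp add: F_def)
  have ct: "4 * pi * (\<sigma> c - \<sigma> a) = pi/2" "4 * pi * (\<sigma> b - \<sigma> c) = pi/2"
    using c len by auto
  have "(4 * pi)\<^sup>2 * mass F a c \<le> dirichlet m a c"
    using Poincare_right[OF H1_sub[OF F order_refl c(2)], of "4 * pi"] F0 c unfolding ct by (simp add: cot_def)
  moreover have "(4 * pi)\<^sup>2 * mass F c b \<le> dirichlet m c b"
    using Poincare_left[OF H1_sub[OF F c(1) order_refl], of "4 * pi"] F0 c unfolding ct by (simp add: cot_def)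
  ultimately have "(4 * pi)\<^sup>2 * mass F a b \<le> dirichlet m a b"
    using dirichlet_split[OF F c(1,2)] mass_split[OF H1_cont[OF F] c(1,2)] by (simp add: algebra_simps)
  moreover have "mass f a b \<le> mass F a b" unfolding F_def
    by (rule mass_le_shift[OF H1_cont[OF f] mean \<open>a \<le> b\<close>])
  then have "(4 * pi)\<^sup>2 * mass f a b \<le> (4 * pi)\<^sup>2 * mass F a b" by (intro mult_left_mono) auto
  ultimately show ?thesis by linarith
qed

end

section \<open>The bending energy of a closed curve\<close>

lemma vec3_eq_iff: "(x :: real^3) = y \<longleftrightarrow> x$1 = y$1 \<and> x$2 = y$2 \<and> x$3 = y$3"
  by (simp add: vec_eq_iff forall_3)

lemma norm3_squared: "(norm (x :: real^3))\<^sup>2 = (x$1)\<^sup>2 + (x$2)\<^sup>2 + (x$3)\<^sup>2"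
  unfolding power2_norm_eq_inner by (simp add: inner_vec_def sum_3 power2_eq_square)

lemma inner3: "(x :: real^3) \<bullet> y = x$1 * y$1 + x$2 * y$2 + x$3 * y$3"
  by (simp add: inner_vec_def sum_3)

lemma W22_d2:
  assumes "W22 \<gamma>"
  shows "is_d2 \<gamma> (d2 \<gamma>)" "(\<lambda>t. norm (d2 \<gamma> t) ^ 2) integrable_on {0..1}"
proof -
  have "\<exists>g. is_d2 \<gamma> g \<and> (\<lambda>t. norm (g t) ^ 2) integrable_on {0..1}" using assms by (simp add: W22_def)
  from someI_ex[OF this] show "is_d2 \<gamma> (d2 \<gamma>)" "(\<lambda>t. norm (d2 \<gamma> t) ^ 2) integrable_on {0..1}"
    unfolding d2_def by auto
qed

lemma W22_deriv: "W22 \<gamma> \<Longrightarrow> (\<gamma> has_vector_derivative d1 \<gamma> t) (at t)"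
  by (simp add: W22_def)

lemma W22_periodic: "W22 \<gamma> \<Longrightarrow> \<gamma> (t + 1) = \<gamma> t"
  by (simp add: W22_def periodic1_def)

lemma W22_deriv_component:
  assumes "W22 \<gamma>" shows "((\<lambda>t. \<gamma> t $ i) has_real_derivative d1 \<gamma> t $ i) (at t)"
  using bounded_linear.has_vector_derivative[OF bounded_linear_vec_nth W22_deriv[OF assms]]
  by (simp add: has_real_derivative_iff_has_vector_derivative)

lemma is_d2_density:
  assumes "is_d2 \<gamma> g"
  shows "has_density (\<lambda>t. d1 \<gamma> t $ i) (\<lambda>t. g t $ i) a b"
  unfolding has_density_def
proof (intro conjI allI impI)
  have "g absolutely_integrable_on {a..b}" using assms by (simp add: is_d2_def)
  from absolutely_integrable_linear[OF this bounded_linear_vec_nth[of i]]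
  show "(\<lambda>t. g t $ i) absolutely_integrable_on {a..b}" by (simp add: o_def)
  fix c d :: real assume "c \<le> d"
  then have "(g has_integral (d1 \<gamma> d - d1 \<gamma> c)) {c..d}" using assms by (simp add: is_d2_def)
  from has_integral_linear[OF this bounded_linear_vec_nth[of i]]
  show "((\<lambda>t. g t $ i) has_integral d1 \<gamma> d $ i - d1 \<gamma> c $ i) {c..d}" by (simp add: o_def)
qed

lemma W22_d1_cont:
  assumes "W22 \<gamma>" shows "continuous_on A (d1 \<gamma>)"
proof -
  have comp: "isCont (\<lambda>t. d1 \<gamma> t $ i) t" for i t
  proof -
    have "continuous_on {t - 1..t + 1} (\<lambda>t. d1 \<gamma> t $ i)"
      by (rule has_density_cont[OF is_d2_density[OF W22_d2(1)[OF assms]]])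
    then show ?thesis by (rule continuous_on_interior) simp
  qed
  have "continuous_on A (\<lambda>t. \<chi> i. d1 \<gamma> t $ i)"
    by (intro continuous_on_vec_lambda continuous_at_imp_continuous_on ballI comp)
  then show ?thesis by simp
qed

lemma W22_cont:
  assumes "W22 \<gamma>" shows "continuous_on A \<gamma>"
  by (meson W22_deriv[OF assms] continuous_at_imp_continuous_on has_vector_derivative_continuous)

lemma has_vector_derivative_d1:
  "(\<gamma> has_vector_derivative v) (at t) \<Longrightarrow> d1 \<gamma> t = v"
  by (simp add: d1_def vector_derivative_at)

text \<open>Differentiates a symmetry of the curve. Periodicity is the instance with the identity
  map and \<open>c = 1\<close>, \<open>e = 1\<close>.\<close>

lemma W22_d1_transform:
  assumes "W22 \<gamma>" and R: "bounded_linear R" and eq: "\<And>t. R (\<gamma> (c * t + e)) = \<gamma> t"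
  shows "d1 \<gamma> t = c *\<^sub>R R (d1 \<gamma> (c * t + e))"
proof -
  have "((\<lambda>t. c * t + e) has_real_derivative c) (at t)" by (auto intro!: derivative_eq_intros)
  then have "((\<lambda>t. \<gamma> (c * t + e)) has_vector_derivative c *\<^sub>R d1 \<gamma> (c * t + e)) (at t)"
    using vector_diff_chain_at[of "\<lambda>t. c * t + e" c t \<gamma>] W22_deriv[OF assms(1)]
    by (simp add: o_def has_real_derivative_iff_has_vector_derivative)
  from bounded_linear.has_vector_derivative[OF R this]
  have "((\<lambda>t. R (\<gamma> (c * t + e))) has_vector_derivative c *\<^sub>R R (d1 \<gamma> (c * t + e))) (at t)"
    using linear_cmul[OF bounded_linear.linear[OF R]] by simp
  then show ?thesis unfolding eq by (rule has_vector_derivative_d1)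
qed

lemma W22_d1_periodic: "W22 \<gamma> \<Longrightarrow> d1 \<gamma> (t + 1) = d1 \<gamma> t"
  using W22_d1_transform[of \<gamma> "\<lambda>x. x" 1 1 t] W22_periodic[of \<gamma>] by (simp add: bounded_linear_ident)

text \<open>Signed, because an integral over \<open>{0..t}\<close> is zero for negative
  \<open>t\<close>, whereas the symmetry t -> -t and the locale \<open>weight\<close> need a
  primitive of the speed on the whole line.\<close>

definition arclen :: "(real \<Rightarrow> real^3) \<Rightarrow> real \<Rightarrow> real" where
  "arclen \<gamma> t = (if 0 \<le> t then integral {0..t} (\<lambda>t. norm (d1 \<gamma> t)) else - integral {t..0} (\<lambda>t. norm (d1 \<gamma> t)))"

lemma arclen_0 [simp]: "arclen \<gamma> 0 = 0" by (simp add: arclen_def)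

lemma arclen_1: "arclen \<gamma> 1 = curve_length \<gamma>" by (simp add: arclen_def curve_length_def)

lemma arclen_deriv:
  assumes "W22 \<gamma>"
  shows "(arclen \<gamma> has_real_derivative norm (d1 \<gamma> t)) (at t)"
proof -
  define l where "l t = norm (d1 \<gamma> t)" for t
  \<comment> \<open>A window containing 0 and \<open>t\<close>, on which both branches are one
    integral from \<open>-N\<close> up to a constant.\<close>
  define N where "N = \<bar>t\<bar> + 1"
  have lc: "continuous_on A l" for A unfolding l_def by (intro continuous_intros W22_d1_cont assms)
  have li: "l integrable_on {u..v}" for u v by (rule integrable_continuous_real[OF lc])
  have N: "- N < t" "t < N" "N > 0" by (auto simp: N_def)
  have eq: "integral {-N..s} l - integral {-N..0} l = arclen \<gamma> s" if "s \<in> {-N<..<N}" for s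
  proof (cases "0 \<le> s")
    case True
    then show ?thesis
      using Henstock_Kurzweil_Integration.integral_combine[of "-N" 0 s l] li N
      by (simp add: arclen_def l_def[abs_def])
  next
    case False
    then show ?thesis using that
      Henstock_Kurzweil_Integration.integral_combine[of "-N" s 0 l] li N
      by (simp add: arclen_def l_def[abs_def])
  qed
  have "((\<lambda>s. integral {-N..s} l) has_real_derivative l t) (at t within {-N..N})"
    by (rule integral_has_real_derivative[OF lc]) (use N in auto)
  then have "((\<lambda>s. integral {-N..s} l) has_real_derivative l t) (at t)"
    using N by (simp add: at_within_Icc_at)
  then have "((\<lambda>s. integral {-N..s} l - integral {-N..0} l) has_real_derivative l t - 0) (at t)"
    by (intro derivative_intros)
  then show ?thesis unfolding l_def[symmetric] using N
    by (intro has_field_derivative_transform_within_open[where S="{-N<..<N}", OF _ _ _ eq]) auto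
qed

lemma arclen_weight:
  assumes "W22 \<gamma>" "regular \<gamma>"
  shows "weight (\<lambda>t. norm (d1 \<gamma> t)) (arclen \<gamma>)"
proof
  show "continuous_on UNIV (\<lambda>t. norm (d1 \<gamma> t))" by (intro continuous_intros W22_d1_cont assms)
  show "norm (d1 \<gamma> t) > 0" for t using assms by (simp add: regular_def)
qed (rule arclen_deriv[OF assms(1)])

section \<open>The unit tangent and its derivative\<close>

definition tangent :: "(real \<Rightarrow> real^3) \<Rightarrow> 3 \<Rightarrow> real \<Rightarrow> real" where
  "tangent \<gamma> i t = d1 \<gamma> t $ i / norm (d1 \<gamma> t)"

definition tangent' :: "(real \<Rightarrow> real^3) \<Rightarrow> 3 \<Rightarrow> real \<Rightarrow> real" where
  "tangent' \<gamma> i t = d2 \<gamma> t $ i / norm (d1 \<gamma> t)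
     - d1 \<gamma> t $ i * (d1 \<gamma> t \<bullet> d2 \<gamma> t) / norm (d1 \<gamma> t) ^ 3"

lemma tangent_density:
  assumes "W22 \<gamma>" "regular \<gamma>"
  shows "has_density (tangent \<gamma> i) (tangent' \<gamma> i) a b"
proof -
  have D: "has_density (\<lambda>t. d1 \<gamma> t $ i) (\<lambda>t. d2 \<gamma> t $ i) a b" for i
    by (rule is_d2_density[OF W22_d2(1)[OF assms(1)]])
  have np: "norm (d1 \<gamma> t) > 0" for t using assms by (simp add: regular_def)
  have "has_density (\<lambda>t. (d1 \<gamma> t $ 1)\<^sup>2 + (d1 \<gamma> t $ 2)\<^sup>2 + (d1 \<gamma> t $ 3)\<^sup>2)
     (\<lambda>t. 2 * d1 \<gamma> t $ 1 * d2 \<gamma> t $ 1 + 2 * d1 \<gamma> t $ 2 * d2 \<gamma> t $ 2 + 2 * d1 \<gamma> t $ 3 * d2 \<gamma> t $ 3) a b"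
    by (intro has_density_add has_density_square D)
  then have N: "has_density (\<lambda>t. (norm (d1 \<gamma> t))\<^sup>2) (\<lambda>t. 2 * (d1 \<gamma> t \<bullet> d2 \<gamma> t)) a b"
    by (simp add: norm3_squared inner3 algebra_simps)
  \<comment> \<open>The reciprocal speed is reached from the squared speed, a polynomial in the
    components, through the smooth function x^(-1/2) on the positive numbers.\<close>
  have "has_density (\<lambda>t. inverse (sqrt ((norm (d1 \<gamma> t))\<^sup>2)))
     (\<lambda>t. (- (inverse (sqrt ((norm (d1 \<gamma> t))\<^sup>2)) ^ 3) / 2) * (2 * (d1 \<gamma> t \<bullet> d2 \<gamma> t))) a b"
  proof (rule has_density_chain[OF N, where S="{0<..}" and \<phi>="\<lambda>x. inverse (sqrt x)" and \<phi>'="\<lambda>x. - (inverse (sqrt x) ^ 3) / 2"])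
    fix x :: real assume "x \<in> {0<..}"
    then have "x > 0" by simp
    then have "((\<lambda>x. inverse (sqrt x)) has_real_derivative
        - (inverse (sqrt x) * (inverse (sqrt x) / 2) * inverse (sqrt x))) (at x)"
      by (intro DERIV_inverse' DERIV_real_sqrt) auto
    then show "((\<lambda>x. inverse (sqrt x)) has_real_derivative - (inverse (sqrt x) ^ 3) / 2) (at x)"
      by (simp add: power3_eq_cube)
  next
    show "continuous_on {0<..} (\<lambda>x. - (inverse (sqrt x) ^ 3) / 2)" by (intro continuous_intros) auto
  qed (use np assms in \<open>auto simp: regular_def\<close>)
  then have I: "has_density (\<lambda>t. inverse (norm (d1 \<gamma> t)))
     (\<lambda>t. - (inverse (norm (d1 \<gamma> t)) ^ 3) * (d1 \<gamma> t \<bullet> d2 \<gamma> t)) a b"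
    by (simp add: mult.commute)
  show ?thesis
    by (rule has_density_cong[OF has_density_mult[OF D[of i] I]])
      (auto simp: tangent_def tangent'_def divide_inverse power_inverse algebra_simps)
qed

text \<open>The vector of the \<open>tangent'\<close> is the part of \<open>d2\<close> orthogonal to
  \<open>d1\<close>, divided by the speed, so Lagrange's identity turns its square into a cross
  product. The common value is curvature squared times speed, which makes the bending energy the sum
  of three Dirichlet integrals in arclength.\<close>

lemma tangent_energy:
  assumes "norm (d1 \<gamma> t) > 0"
  shows "((tangent' \<gamma> 1 t)\<^sup>2 + (tangent' \<gamma> 2 t)\<^sup>2 + (tangent' \<gamma> 3 t)\<^sup>2) / norm (d1 \<gamma> t)
     = norm (cross3 (d1 \<gamma> t) (d2 \<gamma> t)) ^ 2 / norm (d1 \<gamma> t) ^ 5"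
proof -
  define n p where "n = norm (d1 \<gamma> t)" and "p = d1 \<gamma> t \<bullet> d2 \<gamma> t"
  have n: "n > 0" using assms by (simp add: n_def)
  have n2: "(d1 \<gamma> t$1)\<^sup>2 + (d1 \<gamma> t$2)\<^sup>2 + (d1 \<gamma> t$3)\<^sup>2 = n\<^sup>2" by (simp add: n_def norm3_squared)
  have sq: "(tangent' \<gamma> i t)\<^sup>2 = (d2 \<gamma> t $ i)\<^sup>2 / n\<^sup>2 - 2 * (d1 \<gamma> t $ i * d2 \<gamma> t $ i) * p / n^4
      + (d1 \<gamma> t $ i)\<^sup>2 * p\<^sup>2 / n^6" for i
    unfolding tangent'_def n_def[symmetric] p_def[symmetric] using n
    by (simp add: field_simps power2_eq_square eval_nat_numeral)
  have "(tangent' \<gamma> 1 t)\<^sup>2 + (tangent' \<gamma> 2 t)\<^sup>2 + (tangent' \<gamma> 3 t)\<^sup>2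
     = (norm (d2 \<gamma> t))\<^sup>2 / n\<^sup>2 - 2 * p * p / n^4 + n\<^sup>2 * p\<^sup>2 / n^6"
    unfolding sq n2[symmetric] norm3_squared[of "d2 \<gamma> t"]
    by (simp add: p_def inner3 add_divide_distrib algebra_simps)
  also have "\<dots> = ((norm (d2 \<gamma> t))\<^sup>2 * n\<^sup>2 - p\<^sup>2) / n^4"
    using n by (simp add: field_simps power2_eq_square eval_nat_numeral)
  also have "\<dots> = norm (cross3 (d1 \<gamma> t) (d2 \<gamma> t)) ^ 2 / n^4"
    by (simp add: norm_cross n_def p_def mult.commute)
  finally show ?thesis using n by (simp add: n_def[symmetric] field_simps eval_nat_numeral)
qed

lemma tangent_sum: "norm (d1 \<gamma> t) > 0 \<Longrightarrow> (tangent \<gamma> 1 t)\<^sup>2 + (tangent \<gamma> 2 t)\<^sup>2 + (tangent \<gamma> 3 t)\<^sup>2 = 1"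
  by (simp add: tangent_def power_divide add_divide_distrib[symmetric] norm3_squared[symmetric])

lemma d1_eq_tangent: "norm (d1 \<gamma> t) > 0 \<Longrightarrow> d1 \<gamma> t $ i = tangent \<gamma> i t * norm (d1 \<gamma> t)"
  by (simp add: tangent_def)

text \<open>The Dirichlet integrand is at most |gamma''|^2 / |gamma'|^3, and the speed is bounded
  below on the compact period; \<open>B\<close> bounds its reciprocal.\<close>

lemma tangent_H1:
  assumes "W22 \<gamma>" "regular \<gamma>"
  shows "weight.H1 (\<lambda>t. norm (d1 \<gamma> t)) (tangent \<gamma> i) (tangent' \<gamma> i) 0 1"
proof -
  interpret weight "\<lambda>t. norm (d1 \<gamma> t)" "arclen \<gamma>" by (rule arclen_weight[OF assms])
  have lpos: "norm (d1 \<gamma> t) > 0" for t using assms by (simp add: regular_def)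
  have ic: "continuous_on {0..1} (\<lambda>t. inverse (norm (d1 \<gamma> t)))"
    using lpos by (intro continuous_intros W22_d1_cont assms) (auto simp: less_le)
  have "bounded ((\<lambda>t. inverse (norm (d1 \<gamma> t))) ` {0..1})"
    by (intro compact_imp_bounded compact_continuous_image ic) auto
  then obtain B where B: "\<And>t. t \<in> {0..1} \<Longrightarrow> inverse (norm (d1 \<gamma> t)) \<le> B"
    unfolding bounded_iff by fastforce
  have meas: "tangent' \<gamma> i \<in> borel_measurable (lebesgue_on {0..1})"
    by (rule absolutely_integrable_imp_borel_measurable[OF has_density_abs[OF tangent_density[OF assms]]]) auto
  have imeas: "(\<lambda>t. inverse (norm (d1 \<gamma> t))) \<in> borel_measurable (lebesgue_on {0..1})"
    by (rule continuous_imp_measurable_on_sets_lebesgue[OF ic]) auto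
  have "(\<lambda>t. (tangent' \<gamma> i t)\<^sup>2 * inverse (norm (d1 \<gamma> t))) integrable_on {0..1}"
  proof (rule measurable_bounded_by_integrable_imp_integrable)
    show "(\<lambda>t. (tangent' \<gamma> i t)\<^sup>2 * inverse (norm (d1 \<gamma> t))) \<in> borel_measurable (lebesgue_on {0..1})"
      using meas imeas by measurable
    show "(\<lambda>t. B^3 * norm (d2 \<gamma> t) ^ 2) integrable_on {0..1}"
      using W22_d2(2)[OF assms(1)] by (rule integrable_on_mult_right)
    fix t :: real assume t: "t \<in> {0..1}"
    define n where "n = norm (d1 \<gamma> t)"
    have n: "n > 0" using lpos by (simp add: n_def)
    have "(tangent' \<gamma> i t)\<^sup>2 \<le> (tangent' \<gamma> 1 t)\<^sup>2 + (tangent' \<gamma> 2 t)\<^sup>2 + (tangent' \<gamma> 3 t)\<^sup>2"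
      using exhaust_3[of i] by auto
    also have "\<dots> / n = norm (cross3 (d1 \<gamma> t) (d2 \<gamma> t)) ^ 2 / n ^ 5"
      unfolding n_def by (rule tangent_energy[OF lpos])
    finally have 1: "(tangent' \<gamma> i t)\<^sup>2 / n \<le> norm (cross3 (d1 \<gamma> t) (d2 \<gamma> t)) ^ 2 / n ^ 5"
      using n by (simp add: divide_right_mono)
    have 2: "norm (cross3 (d1 \<gamma> t) (d2 \<gamma> t)) ^ 2 \<le> n\<^sup>2 * (norm (d2 \<gamma> t))\<^sup>2"
      by (simp add: norm_cross n_def)
    have "(tangent' \<gamma> i t)\<^sup>2 / n \<le> n\<^sup>2 * (norm (d2 \<gamma> t))\<^sup>2 / n ^ 5"
      using 1 divide_right_mono[OF 2, of "n ^ 5"] n by simp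
    also have "\<dots> = inverse n ^ 3 * (norm (d2 \<gamma> t))\<^sup>2"
      using n by (simp add: field_simps eval_nat_numeral)
    also have "\<dots> \<le> B ^ 3 * (norm (d2 \<gamma> t))\<^sup>2"
      using B[OF t] n by (intro mult_right_mono power_mono) (auto simp: n_def)
    finally show "norm ((tangent' \<gamma> i t)\<^sup>2 * inverse (norm (d1 \<gamma> t))) \<le> B ^ 3 * norm (d2 \<gamma> t) ^ 2"
      using n by (simp add: n_def divide_inverse abs_mult)
  qed auto
  then show ?thesis using tangent_density[OF assms] by (simp add: H1_def divide_inverse)
qed

abbreviation tdir :: "(real \<Rightarrow> real^3) \<Rightarrow> 3 \<Rightarrow> real \<Rightarrow> real \<Rightarrow> real" where
  "tdir \<gamma> i \<equiv> weight.dirichlet (\<lambda>t. norm (d1 \<gamma> t)) (tangent' \<gamma> i)"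

abbreviation tmass :: "(real \<Rightarrow> real^3) \<Rightarrow> 3 \<Rightarrow> real \<Rightarrow> real \<Rightarrow> real" where
  "tmass \<gamma> i \<equiv> weight.mass (\<lambda>t. norm (d1 \<gamma> t)) (tangent \<gamma> i)"

lemma bending_eq:
  assumes "W22 \<gamma>" "regular \<gamma>"
  shows "bending \<gamma> = ennreal (tdir \<gamma> 1 0 1 + tdir \<gamma> 2 0 1 + tdir \<gamma> 3 0 1)"
proof -
  interpret weight "\<lambda>t. norm (d1 \<gamma> t)" "arclen \<gamma>" by (rule arclen_weight[OF assms])
  have lpos: "norm (d1 \<gamma> t) > 0" for t using assms by (simp add: regular_def)
  have "((\<lambda>t. (tangent' \<gamma> 1 t)\<^sup>2 / norm (d1 \<gamma> t) + (tangent' \<gamma> 2 t)\<^sup>2 / norm (d1 \<gamma> t)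
      + (tangent' \<gamma> 3 t)\<^sup>2 / norm (d1 \<gamma> t)) has_integral (tdir \<gamma> 1 0 1 + tdir \<gamma> 2 0 1 + tdir \<gamma> 3 0 1)) {0..1}"
    by (intro has_integral_add dirichlet_has_integral[OF tangent_H1[OF assms]])
  then have "((\<lambda>t. norm (cross3 (d1 \<gamma> t) (d2 \<gamma> t)) ^ 2 / norm (d1 \<gamma> t) ^ 5) has_integral
      (tdir \<gamma> 1 0 1 + tdir \<gamma> 2 0 1 + tdir \<gamma> 3 0 1)) {0..1}"
    unfolding tangent_energy[OF lpos, symmetric] by (simp add: add_divide_distrib)
  from nn_integral_has_integral_lebesgue'[OF _ this] show ?thesis
    unfolding bending_def by simp
qed

text \<open>The unit length of the tangent turns total mass into arclength, so the componentwise
  Poincare inequalities add up to a lower bound of the energy by a multiple of the length.\<close>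

lemma tmass_sum:
  assumes "W22 \<gamma>" "regular \<gamma>" "a \<le> b"
  shows "tmass \<gamma> 1 a b + tmass \<gamma> 2 a b + tmass \<gamma> 3 a b = arclen \<gamma> b - arclen \<gamma> a"
proof -
  interpret weight "\<lambda>t. norm (d1 \<gamma> t)" "arclen \<gamma>" by (rule arclen_weight[OF assms(1,2)])
  have lpos: "norm (d1 \<gamma> t) > 0" for t using assms by (simp add: regular_def)
  have c: "continuous_on {a..b} (tangent \<gamma> i)" for i
    by (rule has_density_cont[OF tangent_density[OF assms(1,2)]])
  have "((\<lambda>t. (tangent \<gamma> 1 t)\<^sup>2 * norm (d1 \<gamma> t) + (tangent \<gamma> 2 t)\<^sup>2 * norm (d1 \<gamma> t)
      + (tangent \<gamma> 3 t)\<^sup>2 * norm (d1 \<gamma> t)) has_integral (tmass \<gamma> 1 a b + tmass \<gamma> 2 a b + tmass \<gamma> 3 a b)) {a..b}"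
    by (intro has_integral_add mass_has_integral c)
  then have "((\<lambda>t. norm (d1 \<gamma> t)) has_integral (tmass \<gamma> 1 a b + tmass \<gamma> 2 a b + tmass \<gamma> 3 a b)) {a..b}"
    unfolding distrib_right[symmetric] tangent_sum[OF lpos] by simp
  then show ?thesis using l_integral[OF assms(3)] has_integral_unique by blast
qed

lemma tangent_integral:
  assumes "W22 \<gamma>" "regular \<gamma>" "a \<le> b"
  shows "((\<lambda>t. tangent \<gamma> i t * norm (d1 \<gamma> t)) has_integral \<gamma> b $ i - \<gamma> a $ i) {a..b}"
proof -
  have lpos: "norm (d1 \<gamma> t) > 0" for t using assms by (simp add: regular_def)
  have "has_density (\<lambda>t. \<gamma> t $ i) (\<lambda>t. d1 \<gamma> t $ i) a b"
    by (rule has_density_C1[OF W22_deriv_component[OF assms(1)]])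
      (intro continuous_intros W22_d1_cont assms)
  from has_densityD[OF this order_refl assms(3) order_refl] show ?thesis
    by (simp add: d1_eq_tangent[OF lpos, symmetric])
qed

lemma bending_ge:
  assumes "W22 \<gamma>" "regular \<gamma>" "curve_length \<gamma> = 1"
  shows "bending \<gamma> \<ge> ennreal ((2 * pi)^2)"
proof -
  interpret weight "\<lambda>t. norm (d1 \<gamma> t)" "arclen \<gamma>" by (rule arclen_weight[OF assms(1,2)])
  have len: "arclen \<gamma> 1 - arclen \<gamma> 0 = 1" using assms by (simp add: arclen_1)
  have "(2 * pi)\<^sup>2 * tmass \<gamma> i 0 1 \<le> tdir \<gamma> i 0 1" for i
  proof (rule Wirtinger[OF tangent_H1[OF assms(1,2)] _ _ len])
    show "tangent \<gamma> i 0 = tangent \<gamma> i 1"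
      using W22_d1_periodic[OF assms(1), of 0] by (simp add: tangent_def)
    show "((\<lambda>t. tangent \<gamma> i t * norm (d1 \<gamma> t)) has_integral 0) {0..1}"
      using tangent_integral[OF assms(1,2), of 0 1 i] W22_periodic[OF assms(1), of 0] by simp
  qed simp
  from this[of 1] this[of 2] this[of 3]
  have "(2 * pi)\<^sup>2 * (tmass \<gamma> 1 0 1 + tmass \<gamma> 2 0 1 + tmass \<gamma> 3 0 1) \<le> tdir \<gamma> 1 0 1 + tdir \<gamma> 2 0 1 + tdir \<gamma> 3 0 1"
    by (simp add: algebra_simps)
  then show ?thesis unfolding bending_eq[OF assms(1,2)] tmass_sum[OF assms(1,2) zero_le_one] len
    by (intro ennreal_leI) simp
qed

section \<open>A lower bound for the tangent-point energy\<close>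

text \<open>The form with two cross products prepares Cauchy-Schwarz: for a unit vector
  \<open>T\<close> the derivative is at most |r x r'| / |r|^2, the angular speed of
  \<open>r\<close>, times the sine of the angle to \<open>T\<close>.\<close>

lemma cos_angle_derivative:
  fixes r :: "real \<Rightarrow> real^3"
  assumes r: "(r has_vector_derivative r') (at s)" and nz: "r s \<noteq> 0"
  shows "((\<lambda>s. (r s \<bullet> T) / norm (r s)) has_real_derivative
     (cross3 (r s) r' \<bullet> cross3 (r s) T) / norm (r s) ^ 3) (at s)"
proof -
  have 1: "((\<lambda>s. r s \<bullet> T) has_real_derivative r' \<bullet> T) (at s)"
    using bounded_linear.has_vector_derivative[OF bounded_linear_inner_left r]
    by (simp add: has_real_derivative_iff_has_vector_derivative)
  have 2: "((\<lambda>s. r s \<bullet> r s) has_real_derivative 2 * (r s \<bullet> r')) (at s)"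
    using bounded_bilinear.has_vector_derivative[OF bounded_bilinear_inner r r]
    by (simp add: has_real_derivative_iff_has_vector_derivative inner_commute)
  have pos: "r s \<bullet> r s > 0" using nz by simp
  have 3: "((\<lambda>s. norm (r s)) has_real_derivative (inverse (sqrt (r s \<bullet> r s)) / 2) * (2 * (r s \<bullet> r'))) (at s)"
    unfolding norm_eq_sqrt_inner by (rule DERIV_chain2[OF DERIV_real_sqrt[OF pos] 2])
  have n: "norm (r s) > 0" using nz by simp
  have "((\<lambda>s. (r s \<bullet> T) / norm (r s)) has_real_derivative
     (r' \<bullet> T * norm (r s) - (r s \<bullet> T) * ((inverse (sqrt (r s \<bullet> r s)) / 2) * (2 * (r s \<bullet> r')))) / (norm (r s) * norm (r s))) (at s)"
    by (rule DERIV_divide[OF 1 3]) (use n in simp)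
  also have "(r' \<bullet> T * norm (r s) - (r s \<bullet> T) * ((inverse (sqrt (r s \<bullet> r s)) / 2) * (2 * (r s \<bullet> r')))) / (norm (r s) * norm (r s))
     = ((norm (r s))\<^sup>2 * (r' \<bullet> T) - (r s \<bullet> T) * (r' \<bullet> r s)) / norm (r s) ^ 3"
    unfolding norm_eq_sqrt_inner[symmetric] using n
    by (simp add: field_simps power2_eq_square power3_eq_cube inner_commute)
  also have "(norm (r s))\<^sup>2 * (r' \<bullet> T) - (r s \<bullet> T) * (r' \<bullet> r s) = cross3 (r s) r' \<bullet> cross3 (r s) T"
    by (simp add: dot_cross power2_norm_eq_inner algebra_simps inner_commute)
  finally show ?thesis .
qed

text \<open>The factor \<open>\<mu> < 1\<close> keeps the argument of \<open>arccos\<close> away from \<open>\<plusminus>1\<close>, where it is not differentiable.\<close>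
lemma spherical_length_ge:
  fixes r :: "real \<Rightarrow> real^3"
  assumes "a \<le> b" and T: "norm T = 1" and \<mu>: "0 < \<mu>" "\<mu> < 1"
    and r: "\<And>s. s \<in> {a..b} \<Longrightarrow> (r has_vector_derivative r' s) (at s)"
    and nz: "\<And>s. s \<in> {a..b} \<Longrightarrow> r s \<noteq> 0"
    and \<kappa>: "((\<lambda>s. norm (cross3 (r s) (r' s)) / (norm (r s))\<^sup>2) has_integral K) {a..b}"
  shows "arccos (\<mu> * ((r b \<bullet> T) / norm (r b))) - arccos (\<mu> * ((r a \<bullet> T) / norm (r a))) \<le> K"
proof -
  define w where "w s = (r s \<bullet> T) / norm (r s)" for s
  define w' where "w' s = (cross3 (r s) (r' s) \<bullet> cross3 (r s) T) / norm (r s) ^ 3" for s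
  define F' where "F' s = inverse (- sqrt (1 - (\<mu> * w s)\<^sup>2)) * (\<mu> * w' s)" for s
  have w1: "\<bar>w s\<bar> \<le> 1" if "s \<in> {a..b}" for s
    using Cauchy_Schwarz_ineq2[of "r s" T] T nz[OF that] by (simp add: w_def)
  have lw: "\<bar>\<mu> * w s\<bar> < 1" if "s \<in> {a..b}" for s
  proof -
    have "\<bar>\<mu> * w s\<bar> \<le> \<mu> * 1" unfolding abs_mult using w1[OF that] \<mu> by (intro mult_mono) auto
    then show ?thesis using \<mu> by simp
  qed
  have dF: "((\<lambda>s. arccos (\<mu> * w s)) has_real_derivative F' s) (at s)" if s: "s \<in> {a..b}" for s
  proof -
    have "((\<lambda>s. \<mu> * w s) has_real_derivative \<mu> * w' s) (at s)"
      unfolding w_def w'_def by (intro DERIV_cmult cos_angle_derivative r nz s)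
    moreover have "-1 < \<mu> * w s" "\<mu> * w s < 1" using lw[OF s] by (auto simp: abs_less_iff)
    ultimately show ?thesis unfolding F'_def by (intro DERIV_chain2[OF DERIV_arccos])
  qed
  have FI: "(F' has_integral arccos (\<mu> * w b) - arccos (\<mu> * w a)) {a..b}"
    by (rule fundamental_theorem_of_calculus[OF \<open>a \<le> b\<close>])
      (use dF in \<open>auto simp flip: has_real_derivative_iff_has_vector_derivative intro: has_field_derivative_at_within\<close>)
  have "F' s \<le> norm (cross3 (r s) (r' s)) / (norm (r s))\<^sup>2" if s: "s \<in> {a..b}" for s
  proof -
    define n where "n = norm (r s)"
    have n: "n > 0" using nz[OF s] by (simp add: n_def)
    define q where "q = sqrt (1 - (\<mu> * w s)\<^sup>2)"
    have "(\<mu> * w s)\<^sup>2 < 1" using lw[OF s] by (simp add: abs_square_less_1)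
    then have q: "q > 0" by (simp add: q_def)
    \<comment> \<open>\<open>norm (cross3 (r s) T) / n\<close> is the sine of the angle. Multiplied
      by \<open>\<mu>\<close> it is at most \<open>q\<close>, because \<mu>^2 (1 - w^2) <= 1 -
      \<mu>^2 w^2.\<close>
    have "(norm (cross3 (r s) T))\<^sup>2 = n\<^sup>2 - (n * w s)\<^sup>2"
      using n by (simp add: norm_cross T n_def[symmetric] w_def)
    then have ct: "(norm (cross3 (r s) T) / n)\<^sup>2 = 1 - (w s)\<^sup>2"
      using n by (simp add: power_divide field_simps power_mult_distrib)
    have "(\<mu> * (norm (cross3 (r s) T) / n))\<^sup>2 = \<mu>\<^sup>2 * (1 - (w s)\<^sup>2)" unfolding power_mult_distrib ct ..
    also have "\<dots> \<le> 1 - (\<mu> * w s)\<^sup>2"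
      using \<mu> power_le_one[of \<mu> 2] by (simp add: power_mult_distrib algebra_simps)
    also have "\<dots> = q\<^sup>2" using \<open>(\<mu> * w s)\<^sup>2 < 1\<close> by (simp add: q_def)
    finally have lc: "\<mu> * (norm (cross3 (r s) T) / n) \<le> q" by (rule power2_le_imp_le) (use q in simp)
    have "\<bar>w' s\<bar> \<le> norm (cross3 (r s) (r' s)) * norm (cross3 (r s) T) / n^3"
      unfolding w'_def n_def[symmetric] abs_divide
      using n Cauchy_Schwarz_ineq2[of "cross3 (r s) (r' s)" "cross3 (r s) T"] by (simp add: divide_right_mono)
    also have "\<dots> = norm (cross3 (r s) (r' s)) / n\<^sup>2 * (norm (cross3 (r s) T) / n)"
      by (simp add: power2_eq_square power3_eq_cube)
    finally have "\<mu> * \<bar>w' s\<bar> \<le> \<mu> * (norm (cross3 (r s) (r' s)) / n\<^sup>2 * (norm (cross3 (r s) T) / n))"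
      using \<mu> by (intro mult_left_mono) auto
    also have "\<dots> = norm (cross3 (r s) (r' s)) / n\<^sup>2 * (\<mu> * (norm (cross3 (r s) T) / n))" by simp
    also have "\<dots> \<le> norm (cross3 (r s) (r' s)) / n\<^sup>2 * q" using lc by (intro mult_left_mono) auto
    finally have le: "\<mu> * \<bar>w' s\<bar> / q \<le> norm (cross3 (r s) (r' s)) / n\<^sup>2" using q by (simp add: field_simps)
    have "F' s \<le> \<mu> * \<bar>w' s\<bar> / q"
    proof -
      have "F' s = - (\<mu> * w' s) / q" by (simp add: F'_def q_def divide_inverse)
      also have "\<dots> \<le> \<bar>\<mu> * w' s\<bar> / q" using q by (intro divide_right_mono abs_ge_minus_self) simp
      also have "\<dots> = \<mu> * \<bar>w' s\<bar> / q" using \<mu> by (simp add: abs_mult)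
      finally show ?thesis .
    qed
    then show ?thesis using le by (simp add: n_def)
  qed
  from has_integral_le[OF FI \<kappa> this] show ?thesis by (simp add: w_def)
qed

text \<open>The chord is the difference quotient \<open>Q\<close> times the increment; a negative
  increment reverses its direction, hence the limit -1 from the left.\<close>

lemma tangent_direction_limit:
  fixes \<gamma> :: "real \<Rightarrow> real^3"
  assumes d: "(\<gamma> has_vector_derivative v) (at t)" and v: "norm v > 0"
  defines "w \<equiv> \<lambda>s. ((\<gamma> s - \<gamma> t) \<bullet> (v /\<^sub>R norm v)) / norm (\<gamma> s - \<gamma> t)"
  shows "((\<lambda>d. w (t + d)) \<longlongrightarrow> 1) (at_right 0)" "((\<lambda>d. w (t - d)) \<longlongrightarrow> -1) (at_right 0)"
proof -
  define Q where "Q d = (\<gamma> (t + d) - \<gamma> t) /\<^sub>R d" for d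
  have Q: "(Q \<longlongrightarrow> v) (at 0)"
  proof -
    have "((\<lambda>h. norm (\<gamma> (t + h) - \<gamma> t - h *\<^sub>R v) / norm h) \<longlongrightarrow> 0) (at 0)"
      using d unfolding has_vector_derivative_def has_derivative_at by simp
    then have "((\<lambda>h. norm (Q h - v)) \<longlongrightarrow> 0) (at 0)"
    proof (rule Lim_transform_eventually)
      show "\<forall>\<^sub>F h in at 0. norm (\<gamma> (t + h) - \<gamma> t - h *\<^sub>R v) / norm h = norm (Q h - v)"
        unfolding eventually_at_topological
      proof (intro exI[of _ UNIV] conjI ballI impI)
        fix h :: real assume "h \<noteq> 0"
        then have "Q h - v = (\<gamma> (t + h) - \<gamma> t - h *\<^sub>R v) /\<^sub>R h" by (simp add: Q_def scaleR_diff_right)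
        then show "norm (\<gamma> (t + h) - \<gamma> t - h *\<^sub>R v) / norm h = norm (Q h - v)"
          by (simp add: divide_inverse mult.commute)
      qed auto
    qed
    then show ?thesis by (rule Lim_null[THEN iffD2, OF tendsto_norm_zero_cancel])
  qed
  have lim: "((\<lambda>d. (Q d \<bullet> (v /\<^sub>R norm v)) / norm (Q d)) \<longlongrightarrow> (v \<bullet> (v /\<^sub>R norm v)) / norm v) (at 0)"
    by (intro tendsto_intros Q) (use v in auto)
  have val: "(v \<bullet> (v /\<^sub>R norm v)) / norm v = 1"
    using v by (simp add: dot_square_norm power2_eq_square)
  have R: "((\<lambda>d. (Q d \<bullet> (v /\<^sub>R norm v)) / norm (Q d)) \<longlongrightarrow> 1) (at_right 0)"
    using lim unfolding val by (rule tendsto_mono[rotated]) (simp add: at_le)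
  show "((\<lambda>d. w (t + d)) \<longlongrightarrow> 1) (at_right 0)"
  proof (rule Lim_transform_eventually[OF R])
    show "\<forall>\<^sub>F d in at_right 0. (Q d \<bullet> (v /\<^sub>R norm v)) / norm (Q d) = w (t + d)"
      unfolding eventually_at_right_field
      by (intro exI[of _ 1]) (auto simp: Q_def w_def)
  qed
  have L: "((\<lambda>d. (Q (-d) \<bullet> (v /\<^sub>R norm v)) / norm (Q (-d))) \<longlongrightarrow> 1) (at_right 0)"
    using lim unfolding val
  proof (rule filterlim_compose)
    show "filterlim uminus (at 0) (at_right (0::real))"
      unfolding filterlim_at
      by (auto intro!: tendsto_eq_intros eventually_mono[OF eventually_at_right_less])
  qed
  show "((\<lambda>d. w (t - d)) \<longlongrightarrow> -1) (at_right 0)"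
  proof (rule Lim_transform_eventually[OF tendsto_minus[OF L]])
    show "\<forall>\<^sub>F d in at_right 0. - ((Q (-d) \<bullet> (v /\<^sub>R norm v)) / norm (Q (-d))) = w (t - d)"
      unfolding eventually_at_right_field
      by (intro exI[of _ 1]) (auto simp: Q_def w_def)
  qed
qed

lemma embedded_neq:
  assumes "periodic1 \<gamma>" "inj_on \<gamma> {0..<1}" "s \<in> {0..1}" "t \<in> {0<..<1}" "s \<noteq> t"
  shows "\<gamma> s \<noteq> \<gamma> t"
proof (cases "s = 1")
  case True
  then have "\<gamma> s = \<gamma> 0" using assms(1) unfolding periodic1_def by (metis add_0)
  then show ?thesis using assms inj_onD[OF assms(2), of 0 t] by auto
next
  case False
  then show ?thesis using assms inj_onD[OF assms(2), of s t] by auto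
qed

text \<open>The chord vanishes at \<open>s = t\<close>, so an interval of radius \<open>d\<close>
  around \<open>t\<close> is removed. First \<open>d\<close> tends to 0 with \<open>\<mu>\<close>
  fixed, giving \<open>pi - 2 * arccos \<mu>\<close>, and then \<open>\<mu>\<close> tends to
  1.\<close>

lemma chord_direction_length:
  assumes W: "W22 \<gamma>" "regular \<gamma>" and inj: "inj_on \<gamma> {0..<1}" and t: "t \<in> {0<..<1}"
  shows "(\<integral>\<^sup>+ s. ennreal (norm (cross3 (\<gamma> s - \<gamma> t) (d1 \<gamma> s)) / (norm (\<gamma> s - \<gamma> t))\<^sup>2) * indicator {0..1} s \<partial>lborel)
     \<ge> ennreal pi" (is "?I \<ge> _")
proof -
  define T where "T = d1 \<gamma> t /\<^sub>R norm (d1 \<gamma> t)"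
  have lpos: "norm (d1 \<gamma> t) > 0" for t using W by (simp add: regular_def)
  have T: "norm T = 1" using lpos[of t] by (simp add: T_def)
  define w where "w s = ((\<gamma> s - \<gamma> t) \<bullet> T) / norm (\<gamma> s - \<gamma> t)" for s
  define \<kappa> where "\<kappa> s = norm (cross3 (\<gamma> s - \<gamma> t) (d1 \<gamma> s)) / (norm (\<gamma> s - \<gamma> t))\<^sup>2" for s
  have nz: "\<gamma> s - \<gamma> t \<noteq> 0" if "s \<in> {0..1}" "s \<noteq> t" for s
    using embedded_neq[OF _ inj that(1) t that(2)] W by (simp add: W22_def)
  have \<kappa>c: "continuous_on {a..b} \<kappa>" if "{a..b} \<subseteq> {0..1}" "t \<notin> {a..b}" for a b
  proof -
    have c: "continuous_on {a..b} \<gamma>" "continuous_on {a..b} (d1 \<gamma>)"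
      using W22_cont[OF W(1)] W22_d1_cont[OF W(1)] by auto
    have "(norm (\<gamma> s - \<gamma> t))\<^sup>2 \<noteq> 0" if "s \<in> {a..b}" for s
      using nz[of s] that \<open>{a..b} \<subseteq> {0..1}\<close> \<open>t \<notin> {a..b}\<close> by auto
    then show ?thesis unfolding \<kappa>_def
      by (intro continuous_on_divide continuous_on_norm continuous_on_power continuous_on_cross
          continuous_on_diff continuous_on_const c) auto
  qed
  have "ennreal (arccos (\<mu> * w (t - d)) - arccos (\<mu> * w (t + d))) \<le> ?I"
    if \<mu>: "0 < \<mu>" "\<mu> < 1" and d: "0 < d" "d < min t (1 - t)" for \<mu> d
  proof -
    have piece: "arccos (\<mu> * w b) - arccos (\<mu> * w a) \<le> integral {a..b} \<kappa>"
      if "a \<le> b" "{a..b} \<subseteq> {0..1}" "t \<notin> {a..b}" for a b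
      unfolding w_def
    proof (rule spherical_length_ge[OF that(1) T \<mu>])
      show "((\<lambda>s. norm (cross3 (\<gamma> s - \<gamma> t) (d1 \<gamma> s)) / (norm (\<gamma> s - \<gamma> t))\<^sup>2) has_integral integral {a..b} \<kappa>) {a..b}"
        unfolding \<kappa>_def[symmetric] by (intro integrable_integral integrable_continuous_real \<kappa>c that)
      show "((\<lambda>s. \<gamma> s - \<gamma> t) has_vector_derivative d1 \<gamma> s) (at s)" for s
        using has_vector_derivative_diff[OF W22_deriv[OF W(1)] has_vector_derivative_const] by simp
    qed (use nz that in auto)
    define J where "J = {0..t - d} \<union> {t + d..1}"
    have k1: "(\<kappa> has_integral integral {0..t-d} \<kappa>) {0..t-d}" "(\<kappa> has_integral integral {t+d..1} \<kappa>) {t+d..1}"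
      by (intro integrable_integral integrable_continuous_real \<kappa>c; use t d in force)+
    have kJ: "(\<kappa> has_integral (integral {0..t-d} \<kappa> + integral {t+d..1} \<kappa>)) J"
      unfolding J_def by (rule has_integral_Un[OF k1]) (use d in auto)
    \<comment> \<open>The two remaining arcs meet at the base point, so their arccos differences
      telescope.\<close>
    have "w 1 = w 0" using W22_periodic[OF W(1), of 0] by (simp add: w_def)
    then have "arccos (\<mu> * w (t - d)) - arccos (\<mu> * w (t + d)) \<le> integral {0..t-d} \<kappa> + integral {t+d..1} \<kappa>"
      using piece[of 0 "t - d"] piece[of "t + d" 1] d t by auto
    then have "ennreal (arccos (\<mu> * w (t - d)) - arccos (\<mu> * w (t + d))) \<le> ennreal (integral {0..t-d} \<kappa> + integral {t+d..1} \<kappa>)"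
      by (rule ennreal_leI)
    also have "\<dots> = (\<integral>\<^sup>+ s. ennreal (\<kappa> s) * indicator J s \<partial>lborel)"
      using nn_integral_has_integral_lebesgue'[OF _ kJ] by (simp add: \<kappa>_def)
    also have "\<dots> \<le> (\<integral>\<^sup>+ s. ennreal (\<kappa> s) * indicator {0..1} s \<partial>lborel)"
      using t d by (intro nn_integral_mono mult_left_mono) (auto simp: J_def indicator_def)
    finally show ?thesis by (simp add: \<kappa>_def)
  qed
  then have ev: "\<forall>\<^sub>F d in at_right 0. ennreal (arccos (\<mu> * w (t - d)) - arccos (\<mu> * w (t + d))) \<le> ?I"
    if "0 < \<mu>" "\<mu> < 1" for \<mu>
    unfolding eventually_at_right_field using that t by (intro exI[of _ "min t (1 - t)"]) auto
  have wlim: "((\<lambda>d. w (t + d)) \<longlongrightarrow> 1) (at_right 0)" "((\<lambda>d. w (t - d)) \<longlongrightarrow> -1) (at_right 0)"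
    using tangent_direction_limit[OF W22_deriv[OF W(1)] lpos, of t] unfolding w_def T_def by auto
  have lam: "ennreal (pi - 2 * arccos \<mu>) \<le> ?I" if \<mu>: "0 < \<mu>" "\<mu> < 1" for \<mu>
  proof -
    have "isCont arccos (\<mu> * -1)" "isCont arccos (\<mu> * 1)"
      using \<mu> by (auto intro!: isCont_arccos)
    then have "((\<lambda>d. arccos (\<mu> * w (t - d)) - arccos (\<mu> * w (t + d))) \<longlongrightarrow> arccos (\<mu> * -1) - arccos (\<mu> * 1)) (at_right 0)"
      by (intro tendsto_diff isCont_tendsto_compose[of _ arccos] tendsto_mult tendsto_const wlim)
    moreover have "arccos (\<mu> * -1) - arccos (\<mu> * 1) = pi - 2 * arccos \<mu>"
      using \<mu> arccos_minus[of \<mu>] by simp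
    ultimately have "((\<lambda>d. ennreal (arccos (\<mu> * w (t - d)) - arccos (\<mu> * w (t + d)))) \<longlongrightarrow> ennreal (pi - 2 * arccos \<mu>)) (at_right 0)"
      by (intro tendsto_ennrealI) (simp only:)
    then show ?thesis by (rule tendsto_upperbound[OF _ ev[OF \<mu>]]) simp
  qed
  have "\<forall>x\<in>{-1..1}. (arccos \<longlongrightarrow> arccos x) (at x within {-1..1})"
    using continuous_on_arccos' unfolding continuous_on_def .
  then have "(arccos \<longlongrightarrow> arccos 1) (at 1 within {-1..1})" by (rule bspec) simp
  then have "((\<lambda>\<mu>. arccos \<mu>) \<longlongrightarrow> 0) (at_left 1)"
    by (simp add: at_within_Icc_at_left)
  then have "((\<lambda>\<mu>. ennreal (pi - 2 * arccos \<mu>)) \<longlongrightarrow> ennreal (pi - 2 * 0)) (at_left 1)"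
    by (intro tendsto_ennrealI tendsto_diff tendsto_mult tendsto_const)
  then have "ennreal (pi - 2 * 0) \<le> ?I"
  proof (rule tendsto_upperbound)
    show "\<forall>\<^sub>F \<mu> in at_left 1. ennreal (pi - 2 * arccos \<mu>) \<le> ?I"
      unfolding eventually_at_left_field using lam by (intro exI[of _ 0]) auto
  qed simp
  then show ?thesis by simp
qed

text \<open>By convexity the graph of the power lies above its tangent at \<open>c\<close>.
  Integrated against a measure of mass one this is Jensen's inequality, in a form that tolerates an
  infinite integral.\<close>

lemma powr_tangent_line:
  fixes a c q :: real
  assumes "a \<ge> 0" "c > 0" "q \<ge> 1"
  shows "q * c powr (q - 1) * a \<le> a powr q + (q - 1) * c powr q"
proof (cases "a = 0")
  case True
  then show ?thesis using assms by simp
next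
  case False
  then have a: "a > 0" using assms by simp
  define x where "x = a / c"
  have x: "x > 0" using a assms by (simp add: x_def)
  have "q * x \<le> x powr q + (q - 1)"
  proof -
    have "((\<lambda>x. x powr q) has_real_derivative q * 1 powr (q - 1)) (at 1)"
      by (rule has_real_derivative_powr) simp
    then have "((\<lambda>x. x powr q) has_real_derivative q) (at 1 within {0<..})"
      by (simp add: has_field_derivative_at_within)
    from convex_on_imp_above_tangent[OF powr_convex[OF assms(3)] _ _ _ this, of x]
    have "1 + q * (x - 1) \<le> x powr q" using x by (simp add: interior_open)
    then show ?thesis by (simp add: algebra_simps)
  qed
  then have "c powr q * (q * x) \<le> c powr q * (x powr q + (q - 1))" by (intro mult_left_mono) auto
  moreover have "c powr q * x powr q = a powr q" using assms a by (simp add: x_def powr_divide)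
  moreover have "c powr q * x = c powr (q - 1) * a" using assms by (simp add: x_def powr_diff)
  ultimately show ?thesis by (simp add: algebra_simps)
qed

lemma borel_measurable_cross3 [measurable (raw)]:
  fixes f g :: "'a \<Rightarrow> real^3"
  assumes "f \<in> borel_measurable M" "g \<in> borel_measurable M"
  shows "(\<lambda>p. cross3 (f p) (g p)) \<in> borel_measurable M"
proof -
  have "(\<lambda>p. cross3 (fst p) (snd p)) \<in> borel_measurable (borel :: ((real^3) \<times> (real^3)) measure)"
    by (intro borel_measurable_continuous_onI continuous_on_cross continuous_intros)
  then have "(\<lambda>p. cross3 (fst p) (snd p)) \<in> borel_measurable (borel \<Otimes>\<^sub>M borel)" by (simp add: borel_prod)
  from measurable_compose[OF measurable_Pair[OF assms] this] show ?thesis by simp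
qed

text \<open>With the tangent taken at \<open>s\<close>, half of \<open>inv_rtp \<gamma> s t\<close>
  times the speed at \<open>s\<close> is the angular speed of the chord seen from
  \<open>\<gamma> t\<close>. Hence \<open>s\<close> is integrated first, and every interior
  \<open>t\<close> contributes at least 2 pi times its speed.\<close>

lemma TP_ge:
  assumes W: "W22 \<gamma>" "regular \<gamma>" and inj: "inj_on \<gamma> {0..<1}" and len: "curve_length \<gamma> = 1" and q: "q \<ge> 1"
  shows "TP q \<gamma> \<ge> ennreal ((2 * pi) powr q)"
proof -
  interpret weight "\<lambda>t. norm (d1 \<gamma> t)" "arclen \<gamma>" by (rule arclen_weight[OF W])
  define l where "l t = norm (d1 \<gamma> t)" for t
  define Q where "Q = {0..1::real} \<times> {0..1::real}"
  have d1m [measurable]: "d1 \<gamma> \<in> borel_measurable borel"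
    by (rule borel_measurable_continuous_onI[OF W22_d1_cont[OF W(1)]])
  have gm [measurable]: "\<gamma> \<in> borel_measurable borel"
    by (rule borel_measurable_continuous_onI[OF W22_cont[OF W(1)]])
  have lm [measurable]: "l \<in> borel_measurable borel" unfolding l_def by measurable
  define rt where "rt p = inv_rtp \<gamma> (fst p) (snd p)" for p
  have rtm [measurable]: "rt \<in> borel_measurable (borel \<Otimes>\<^sub>M borel)"
    unfolding rt_def inv_rtp_def
    by measurable
  define m where "m p = l (fst p) * l (snd p)" for p
  have mm [measurable]: "m \<in> borel_measurable (borel \<Otimes>\<^sub>M borel)" unfolding m_def by measurable
  have Qm [measurable]: "Q \<in> sets (borel \<Otimes>\<^sub>M borel)" unfolding Q_def by measurable
  have l0: "l t \<ge> 0" for t by (simp add: l_def)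
  have rt0: "rt p \<ge> 0" for p by (simp add: rt_def inv_rtp_def)
  have lI: "(l has_integral 1) {0..1}"
    using l_integral[of 0 1] len arclen_1[of \<gamma>] by (simp add: l_def[abs_def])
  define J where "J = (\<integral>\<^sup>+ p. ennreal (rt p * m p) * indicator Q p \<partial>(lborel \<Otimes>\<^sub>M lborel))"
  define P where "P = (\<integral>\<^sup>+ p. ennreal (rt p powr q * m p) * indicator Q p \<partial>(lborel \<Otimes>\<^sub>M lborel))"
  define M where "M = (\<integral>\<^sup>+ p. ennreal (m p) * indicator Q p \<partial>(lborel \<Otimes>\<^sub>M lborel))"
  have TP: "TP q \<gamma> = P"
    unfolding TP_def P_def lborel_prod by (simp add: rt_def m_def l_def Q_def mult.assoc)
  have lnn: "(\<integral>\<^sup>+ t. ennreal (l t) * indicator {0..1} t \<partial>lborel) = 1"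
    using nn_integral_has_integral_lebesgue'[OF l0 lI] by simp
  have M1: "M = 1"
  proof -
    have "M = (\<integral>\<^sup>+ t. \<integral>\<^sup>+ s. ennreal (m (s, t)) * indicator Q (s, t) \<partial>lborel \<partial>lborel)"
      unfolding M_def by (rule lborel_pair.nn_integral_snd[symmetric]) measurable
    also have "\<dots> = (\<integral>\<^sup>+ t. \<integral>\<^sup>+ s. (ennreal (l t) * indicator {0..1} t) * (ennreal (l s) * indicator {0..1} s) \<partial>lborel \<partial>lborel)"
      by (intro nn_integral_cong) (auto simp: m_def Q_def indicator_def ennreal_mult'' l0 mult.commute)
    also have "\<dots> = 1" by (simp add: nn_integral_cmult lnn)
    finally show ?thesis .
  qed
  have J: "J \<ge> ennreal (2 * pi)"
  proof -
    \<comment> \<open>The chord bound is stated for interior \<open>t\<close>; the two endpoints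
      have measure zero.\<close>
    have lI': "(l has_integral 1) {0<..<1}" using lI has_integral_Icc_iff_Ioo by blast
    have "ennreal (2 * pi) = ennreal (2 * pi) * (\<integral>\<^sup>+ t. ennreal (l t) * indicator {0<..<1} t \<partial>lborel)"
      using nn_integral_has_integral_lebesgue'[OF l0 lI'] by simp
    also have "\<dots> = (\<integral>\<^sup>+ t. ennreal (2 * pi) * (ennreal (l t) * indicator {0<..<1} t) \<partial>lborel)"
      by (rule nn_integral_cmult[symmetric]) measurable
    also have "\<dots> \<le> (\<integral>\<^sup>+ t. \<integral>\<^sup>+ s. ennreal (rt (s, t) * m (s, t)) * indicator Q (s, t) \<partial>lborel \<partial>lborel)"
    proof (rule nn_integral_mono)
      fix t :: real
      show "ennreal (2 * pi) * (ennreal (l t) * indicator {0<..<1} t)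
        \<le> (\<integral>\<^sup>+ s. ennreal (rt (s, t) * m (s, t)) * indicator Q (s, t) \<partial>lborel)"
      proof (cases "t \<in> {0<..<1}")
        case True
        have eq: "ennreal (rt (s, t) * m (s, t)) * indicator Q (s, t)
          = ennreal (2 * l t) * (ennreal (norm (cross3 (\<gamma> s - \<gamma> t) (d1 \<gamma> s)) / (norm (\<gamma> s - \<gamma> t))\<^sup>2) * indicator {0..1} s)" for s
        proof -
          have "norm (cross3 (\<gamma> t - \<gamma> s) (d1 \<gamma> s)) = norm (cross3 (\<gamma> s - \<gamma> t) (d1 \<gamma> s))"
            by (metis cross_minus_left minus_diff_eq norm_minus_cancel)
          then have "rt (s, t) * m (s, t) = 2 * l t * (norm (cross3 (\<gamma> s - \<gamma> t) (d1 \<gamma> s)) / (norm (\<gamma> s - \<gamma> t))\<^sup>2)"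
            using l_pos[of s] by (simp add: rt_def m_def inv_rtp_def l_def norm_minus_commute[of "\<gamma> t"])
          then have "ennreal (rt (s, t) * m (s, t))
             = ennreal (2 * l t) * ennreal (norm (cross3 (\<gamma> s - \<gamma> t) (d1 \<gamma> s)) / (norm (\<gamma> s - \<gamma> t))\<^sup>2)"
            using l0[of t] by (simp only: ennreal_mult'[symmetric] mult_nonneg_nonneg zero_le_numeral)
          then show ?thesis using True by (simp add: Q_def indicator_def)
        qed
        have "ennreal (2 * pi) * ennreal (l t) = ennreal (2 * l t) * ennreal pi"
          using l0[of t] by (simp add: ennreal_mult''[symmetric] mult_ac)
        also have "\<dots> \<le> ennreal (2 * l t) * (\<integral>\<^sup>+ s. ennreal (norm (cross3 (\<gamma> s - \<gamma> t) (d1 \<gamma> s)) / (norm (\<gamma> s - \<gamma> t))\<^sup>2) * indicator {0..1} s \<partial>lborel)"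
          by (intro mult_left_mono chord_direction_length[OF W inj True]) simp
        also have "\<dots> = (\<integral>\<^sup>+ s. ennreal (rt (s, t) * m (s, t)) * indicator Q (s, t) \<partial>lborel)"
          unfolding eq
          by (rule nn_integral_cmult[symmetric]) measurable
        finally show ?thesis using True by simp
      qed simp
    qed
    also have "\<dots> = J" unfolding J_def by (rule lborel_pair.nn_integral_snd) measurable
    finally show ?thesis .
  qed
  \<comment> \<open>Slope and negated intercept of the tangent to the q-th power at 2 pi, the
    inverse radius of the circle off the diagonal, so that Jensen's inequality loses nothing
    there.\<close>
  define c where "c = q * (2 * pi) powr (q - 1)"
  define e where "e = (q - 1) * (2 * pi) powr q"
  have ce: "c \<ge> 0" "e \<ge> 0" using q by (auto simp: c_def e_def)
  have "ennreal c * J \<le> P + ennreal e * M"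
  proof -
    have "ennreal c * J = (\<integral>\<^sup>+ p. ennreal c * (ennreal (rt p * m p) * indicator Q p) \<partial>(lborel \<Otimes>\<^sub>M lborel))"
      unfolding J_def by (rule nn_integral_cmult[symmetric]) measurable
    also have "\<dots> \<le> (\<integral>\<^sup>+ p. ennreal (rt p powr q * m p) * indicator Q p + ennreal e * (ennreal (m p) * indicator Q p) \<partial>(lborel \<Otimes>\<^sub>M lborel))"
    proof (rule nn_integral_mono)
      fix p
      have m0: "m p \<ge> 0" using l0 by (simp add: m_def)
      have "c * rt p \<le> rt p powr q + e"
        unfolding c_def e_def by (rule powr_tangent_line) (use rt0 q in auto)
      then have "c * rt p * m p \<le> (rt p powr q + e) * m p" using m0 by (rule mult_right_mono)
      then have "ennreal (c * (rt p * m p)) \<le> ennreal (rt p powr q * m p + e * m p)"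
        by (intro ennreal_leI) (simp add: algebra_simps)
      then have "ennreal c * ennreal (rt p * m p) \<le> ennreal (rt p powr q * m p) + ennreal e * ennreal (m p)"
        using ce m0 rt0[of p] by (simp add: ennreal_mult ennreal_plus)
      then show "ennreal c * (ennreal (rt p * m p) * indicator Q p)
        \<le> ennreal (rt p powr q * m p) * indicator Q p + ennreal e * (ennreal (m p) * indicator Q p)"
        by (auto simp: indicator_def)
    qed
    also have "\<dots> = P + ennreal e * M"
      unfolding P_def M_def by (subst nn_integral_add) (simp_all add: nn_integral_cmult)
    finally show ?thesis .
  qed
  moreover have "ennreal c * ennreal (2 * pi) \<le> ennreal c * J" by (intro mult_left_mono J) simp
  moreover have "ennreal c * ennreal (2 * pi) = ennreal ((2 * pi) powr q) + ennreal e"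
  proof -
    have "c * (2 * pi) = (2 * pi) powr q + e"
      by (simp add: c_def e_def powr_diff algebra_simps)
    then show ?thesis using ce by (simp add: ennreal_mult[symmetric] ennreal_plus[symmetric] del: ennreal_plus)
  qed
  ultimately have "ennreal ((2 * pi) powr q) + ennreal e \<le> P + ennreal e"
    using M1 by (simp only: mult_1_right)
  then show ?thesis unfolding TP by (simp add: ennreal_add_left_cancel_le add.commute[of _ "ennreal e"])
qed

section \<open>The round circle\<close>

text \<open>\<open>d2\<close> is an arbitrary choice among densities, so explicit second derivatives
  must be compared with it almost everywhere. The difference \<open>h\<close> integrates to zero on
  every subinterval; hence its positive and negative parts define measures that agree on all
  half-lines and therefore coincide.\<close>

lemma has_density_unique:
  assumes "has_density f g a b" "has_density f g' a b"
  shows "AE t in lborel. t \<in> {a..b} \<longrightarrow> g t = g' t"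
proof -
  define h where "h t = g t - g' t" for t
  have h: "has_density (\<lambda>t. 0) h a b"
    using has_density_diff[OF assms] by (simp add: h_def[abs_def])
  \<comment> \<open>Integrability gives Lebesgue measurability only; \<open>p\<close> is a Borel
    representative of the positive part, fit for \<open>density lborel\<close>.\<close>
  have key: "\<exists>p\<in>borel_measurable lborel. (AE t in lborel. p t = max (k t) 0 * indicator {a..b} t) \<and>
      (\<forall>x. emeasure (density lborel (\<lambda>t. ennreal (p t))) {x<..} = ennreal (integral {max a x..b} (\<lambda>t. max (k t) 0)))"
    if k: "k absolutely_integrable_on {a..b}" for k :: "real \<Rightarrow> real"
  proof -
    have "(\<lambda>t. max (k t) 0) absolutely_integrable_on {a..b}"
      using k by (intro absolutely_integrable_max_1) (auto simp: absolutely_integrable_on_def)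
    then have pi: "(\<lambda>t. max (k t) 0) integrable_on {c..b}" if "a \<le> c" for c
      using that unfolding absolutely_integrable_on_def
      by (metis atLeastatMost_subset_iff integrable_on_subinterval order_refl)
    have "(\<lambda>t. indicator {a..b} t *\<^sub>R max (k t) 0) \<in> borel_measurable lebesgue"
      using has_integral_implies_lebesgue_measurable[OF integrable_integral[OF pi[OF order_refl]]] .
    then obtain p where p [measurable]: "p \<in> borel_measurable lborel"
      and ae: "AE t in lborel. max (k t) 0 * indicator {a..b} t = p t"
      using completion_ex_borel_measurable_real[of "\<lambda>t. max (k t) 0 * indicator {a..b} t" lborel]
      by (auto simp: mult.commute)
    have "emeasure (density lborel (\<lambda>t. ennreal (p t))) {x<..} = ennreal (integral {max a x..b} (\<lambda>t. max (k t) 0))" for x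
    proof -
      have "emeasure (density lborel (\<lambda>t. ennreal (p t))) {x<..} = (\<integral>\<^sup>+ t. ennreal (p t) * indicator {x<..} t \<partial>lborel)"
        by (rule emeasure_density) auto
      also have "\<dots> = (\<integral>\<^sup>+ t. ennreal (max (k t) 0) * indicator {max a x..b} t \<partial>lborel)"
      proof (rule nn_integral_cong_AE)
        show "AE t in lborel. ennreal (p t) * indicator {x<..} t = ennreal (max (k t) 0) * indicator {max a x..b} t"
          using ae AE_lborel_singleton[of x]
          by eventually_elim (auto simp: indicator_def split: if_splits)
      qed
      also have "\<dots> = ennreal (integral {max a x..b} (\<lambda>t. max (k t) 0))"
        by (rule nn_integral_has_integral_lebesgue'[OF _ integrable_integral[OF pi]]) auto
      finally show ?thesis .
    qed
    moreover have "AE t in lborel. p t = max (k t) 0 * indicator {a..b} t" using ae by eventually_elim simp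
    ultimately show ?thesis using p by blast
  qed
  have hi: "h absolutely_integrable_on {a..b}" by (rule has_density_abs[OF h])
  then have mi: "(\<lambda>t. - h t) absolutely_integrable_on {a..b}"
    unfolding absolutely_integrable_on_def by (simp add: integrable_neg_iff)
  obtain p where p: "p \<in> borel_measurable lborel" "AE t in lborel. p t = max (h t) 0 * indicator {a..b} t"
    and pe: "\<And>x. emeasure (density lborel (\<lambda>t. ennreal (p t))) {x<..} = ennreal (integral {max a x..b} (\<lambda>t. max (h t) 0))"
    using key[OF hi] by blast
  obtain n where n: "n \<in> borel_measurable lborel" "AE t in lborel. n t = max (- h t) 0 * indicator {a..b} t"
    and ne: "\<And>x. emeasure (density lborel (\<lambda>t. ennreal (n t))) {x<..} = ennreal (integral {max a x..b} (\<lambda>t. max (- h t) 0))"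
    using key[OF mi] by blast
  have eq: "integral {c..b} (\<lambda>t. max (h t) 0) = integral {c..b} (\<lambda>t. max (- h t) 0)" if c: "a \<le> c" for c
  proof (cases "c \<le> b")
    case True
    have 1: "(h has_integral 0) {c..b}" using has_densityD[OF h c True order_refl] by simp
    have "(\<lambda>t. max (- h t) 0) absolutely_integrable_on {a..b}"
      using mi by (intro absolutely_integrable_max_1) (auto simp: absolutely_integrable_on_def)
    then have "(\<lambda>t. max (- h t) 0) integrable_on {c..b}"
      using c unfolding absolutely_integrable_on_def
      by (metis atLeastatMost_subset_iff integrable_on_subinterval order_refl)
    from has_integral_add[OF 1 integrable_integral[OF this]]
    have "((\<lambda>t. h t + max (- h t) 0) has_integral integral {c..b} (\<lambda>t. max (- h t) 0)) {c..b}" by simp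
    moreover have "h t + max (- h t) 0 = max (h t) 0" for t by auto
    ultimately show ?thesis by (simp add: integral_unique)
  qed simp
  have "density lborel (\<lambda>t. ennreal (p t)) = density lborel (\<lambda>t. ennreal (n t))"
    by (rule measure_eqI_lessThan) (auto simp: pe ne eq)
  then have "AE t in lborel. ennreal (p t) = ennreal (n t)"
    using p(1) n(1) by (intro sigma_finite_measure.density_unique[OF sigma_finite_lborel]) auto
  then show ?thesis using p(2) n(2)
  proof eventually_elim
    case (elim t)
    then show ?case by (auto simp: h_def max_def indicator_def split: if_splits)
  qed
qed

section \<open>The symmetric circle and its two energies\<close>

lemmas vector3_component [simp] = vector_3

lemma vector3_expand: "(vector [a, b, c] :: real^3) = a *\<^sub>R axis 1 1 + b *\<^sub>R axis 2 1 + c *\<^sub>R axis 3 1"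
  by (simp add: vec3_eq_iff axis_def)

lemma has_vector_derivative_vector3:
  assumes "(f has_real_derivative f') (at t)" "(g has_real_derivative g') (at t)" "(h has_real_derivative h') (at t)"
  shows "((\<lambda>t. vector [f t, g t, h t] :: real^3) has_vector_derivative vector [f', g', h']) (at t)"
proof -
  have s: "((\<lambda>t. f t *\<^sub>R v) has_vector_derivative f' *\<^sub>R v) (at t)"
    if "(f has_real_derivative f') (at t)" for f f' and v :: "real^3"
    using has_vector_derivative_scaleR[OF that has_vector_derivative_const[of v]] by simp
  show ?thesis unfolding vector3_expand by (intro has_vector_derivative_add s assms)
qed

text \<open>The position prescribed by the symmetry: \<open>R3\<close> fixes the point at parameter
  0, which puts it on the third axis, and \<open>R1\<close> fixes the point at parameter 1/4, which
  puts it on the first axis.\<close>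

definition circ_xz :: "real \<Rightarrow> real^3" where
  "circ_xz t = vector [sin (2 * pi * t) / (2 * pi), 0, cos (2 * pi * t) / (2 * pi)]"

lemma circ_xz_deriv:
  "(circ_xz has_vector_derivative vector [cos (2 * pi * t), 0, - sin (2 * pi * t)]) (at t)"
  unfolding circ_xz_def
  by (rule has_vector_derivative_vector3) (auto intro!: derivative_eq_intros)

lemma d1_circ_xz: "d1 circ_xz t = vector [cos (2 * pi * t), 0, - sin (2 * pi * t)]"
  by (rule has_vector_derivative_d1[OF circ_xz_deriv])

definition circ_xz'' :: "real \<Rightarrow> real^3" where
  "circ_xz'' t = vector [- 2 * pi * sin (2 * pi * t), 0, - 2 * pi * cos (2 * pi * t)]"

lemma is_d2_circ_xz: "is_d2 circ_xz circ_xz''"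
  unfolding is_d2_def
proof (intro conjI allI impI)
  have "continuous_on UNIV circ_xz''"
  proof -
    have "(circ_xz'' has_vector_derivative vector [- (2 * pi)\<^sup>2 * cos (2 * pi * t), 0, (2 * pi)\<^sup>2 * sin (2 * pi * t)]) (at t)" for t
      unfolding circ_xz''_def
      by (rule has_vector_derivative_vector3) (auto intro!: derivative_eq_intros simp: power2_eq_square)
    then show ?thesis
      by (meson continuous_at_imp_continuous_on has_vector_derivative_continuous)
  qed
  then show "circ_xz'' absolutely_integrable_on {a..b}" for a b
    by (intro absolutely_integrable_continuous_real) (rule continuous_on_subset, auto)
  have d: "(d1 circ_xz has_vector_derivative circ_xz'' t) (at t)" for t
    unfolding d1_circ_xz[abs_def] circ_xz''_def
    by (rule has_vector_derivative_vector3) (auto intro!: derivative_eq_intros)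
  show "(circ_xz'' has_integral d1 circ_xz b - d1 circ_xz a) {a..b}" if "a \<le> b" for a b
    by (rule fundamental_theorem_of_calculus[OF that has_vector_derivative_at_within[OF d]])
qed

lemma norm3_eq: "norm (x :: real^3) = sqrt ((x$1)\<^sup>2 + (x$2)\<^sup>2 + (x$3)\<^sup>2)"
  by (metis norm3_squared norm_ge_zero real_sqrt_unique)

lemma norm_d1_circ_xz [simp]: "norm (d1 circ_xz t) = 1"
  by (simp add: norm3_eq d1_circ_xz)

lemma W22_circ_xz: "W22 circ_xz"
  unfolding W22_def
proof (intro conjI allI exI[of _ circ_xz''] is_d2_circ_xz)
  show "periodic1 circ_xz"
    by (simp add: periodic1_def circ_xz_def distrib_left)
  show "(circ_xz has_vector_derivative d1 circ_xz t) (at t)" for t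
    unfolding d1_circ_xz by (rule circ_xz_deriv)
  have "norm (circ_xz'' t) ^ 2 = (2 * pi)\<^sup>2" for t
  proof -
    define s c where "s = sin (2 * pi * t)" and "c = cos (2 * pi * t)"
    have sc: "s\<^sup>2 + c\<^sup>2 = 1" by (simp add: s_def c_def)
    have "norm (circ_xz'' t) ^ 2 = (2 * pi)\<^sup>2 * (s\<^sup>2 + c\<^sup>2)"
      unfolding circ_xz''_def s_def[symmetric] c_def[symmetric]
      by (simp add: norm3_squared power_mult_distrib algebra_simps)
    then show ?thesis by (simp add: sc)
  qed
  then show "(\<lambda>t. norm (circ_xz'' t) ^ 2) integrable_on {0..1}" by (simp only: integrable_const_ivl)
qed

lemma arclength_circ_xz: "arclength circ_xz" by (simp add: arclength_def)

lemma regular_circ_xz: "regular circ_xz" by (simp add: regular_def)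

lemma curve_length_circ_xz: "curve_length circ_xz = 1" by (simp add: curve_length_def)

lemma sin_cos_2pi_inj:
  assumes "sin (2 * pi * s) = sin (2 * pi * t)" "cos (2 * pi * s) = cos (2 * pi * t)" "\<bar>s - t\<bar> < 1"
  shows "s = t"
proof -
  obtain n :: int where n: "2 * pi * s = 2 * pi * t + 2 * pi * of_int n"
    using assms sin_cos_eq_iff by blast
  then have "2 * pi * (s - t - of_int n) = 0" by (simp add: algebra_simps)
  then have "s - t = of_int n" by simp
  moreover then have "\<bar>real_of_int n\<bar> < 1" using assms(3) by simp
  then have "n = 0" by linarith
  ultimately show ?thesis by simp
qed

lemma inj_circ_xz: "inj_on circ_xz {0..<1}"
proof (rule inj_onI)
  fix s t :: real assume "s \<in> {0..<1}" "t \<in> {0..<1}" "circ_xz s = circ_xz t"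
  then show "s = t" by (rule_tac sin_cos_2pi_inj) (auto simp: circ_xz_def vec3_eq_iff)
qed

lemma R_component [simp]:
  "R1 x $ 1 = x$1" "R1 x $ 2 = - (x$2)" "R1 x $ 3 = - (x$3)"
  "R2 x $ 1 = - (x$1)" "R2 x $ 2 = x$2" "R2 x $ 3 = - (x$3)"
  "R3 x $ 1 = - (x$1)" "R3 x $ 2 = - (x$2)" "R3 x $ 3 = x$3"
  by (simp_all add: R1_def R2_def R3_def)

lemma D2_symmetric_circ_xz: "D2_symmetric circ_xz"
  unfolding D2_symmetric_def
proof (intro allI conjI)
  fix t
  have a: "2 * pi * (- t + 1/2) = pi - 2 * pi * t" "2 * pi * (t - 1/2) = 2 * pi * t - pi" by (auto simp: algebra_simps)
  show "R1 (circ_xz (- t + 1/2)) = circ_xz t" "R2 (circ_xz (t - 1/2)) = circ_xz t" "R3 (circ_xz (- t)) = circ_xz t"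
    unfolding vec3_eq_iff circ_xz_def by (simp_all only: R_component vector3_component a) simp_all
qed

lemma bending_circ_xz: "bending circ_xz = ennreal ((2 * pi)^2)"
proof -
  have "AE t in lborel. t \<in> {0..1} \<longrightarrow> d2 circ_xz t $ i = circ_xz'' t $ i" for i
    by (rule has_density_unique[OF is_d2_density is_d2_density]) (use W22_d2 W22_circ_xz is_d2_circ_xz in auto)
  from this[of 1] this[of 2] this[of 3]
  have ae: "AE t in lborel. t \<in> {0..1} \<longrightarrow> d2 circ_xz t = circ_xz'' t"
    by eventually_elim (simp add: vec3_eq_iff)
  have val: "norm (cross3 (d1 circ_xz t) (circ_xz'' t)) ^ 2 / norm (d1 circ_xz t) ^ 5 = (2 * pi)^2" for t
  proof -
    define s c where "s = sin (2 * pi * t)" and "c = cos (2 * pi * t)"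
    have sc: "s\<^sup>2 + c\<^sup>2 = 1" by (simp add: s_def c_def)
    have "cross3 (d1 circ_xz t) (circ_xz'' t) = vector [0, 2 * pi * (s\<^sup>2 + c\<^sup>2), 0]"
      unfolding d1_circ_xz circ_xz''_def s_def[symmetric] c_def[symmetric]
      by (simp add: cross3_def vec3_eq_iff power2_eq_square algebra_simps)
    then show ?thesis by (simp add: sc norm3_squared)
  qed
  from ae have "AE t in lborel. ennreal (norm (cross3 (d1 circ_xz t) (d2 circ_xz t)) ^ 2 / norm (d1 circ_xz t) ^ 5)
      * indicator {0..1} t = ennreal ((2 * pi)^2) * indicator {0..1} t"
  proof eventually_elim
    case (elim t)
    then show ?case using val[of t] by (cases "t \<in> {0..1}") simp_all
  qed
  then have "bending circ_xz = (\<integral>\<^sup>+ t. ennreal ((2 * pi)^2) * indicator {0..1::real} t \<partial>lborel)"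
    unfolding bending_def by (rule nn_integral_cong_AE)
  also have "\<dots> = ennreal ((2 * pi)^2)" by (simp add: nn_integral_cmult_indicator)
  finally show ?thesis .
qed

lemma TP_circ_xz_le:
  assumes "q > 0"
  shows "TP q circ_xz \<le> ennreal ((2 * pi) powr q)"
proof -
  have le: "inv_rtp circ_xz s t \<le> 2 * pi" for s t
  proof -
    define S C S' C' where "S = sin (2 * pi * s)" "C = cos (2 * pi * s)" "S' = sin (2 * pi * t)" "C' = cos (2 * pi * t)"
    note d = S_C_S'_C'_def
    \<comment> \<open>One minus the cosine of the angle between the two points. The cross product
      and the squared chord are both multiples of it, so it cancels in the inverse radius.\<close>
    define D where "D = 1 - (S * S' + C * C')"
    have sc: "S\<^sup>2 + C\<^sup>2 = 1" "S'\<^sup>2 + C'\<^sup>2 = 1" by (simp_all add: d)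
    have "0 \<le> (S - S')\<^sup>2 + (C - C')\<^sup>2" by simp
    also have n: "(S - S')\<^sup>2 + (C - C')\<^sup>2 = 2 * D" using sc by (simp add: D_def power2_eq_square algebra_simps)
    finally have D0: "D \<ge> 0" by simp
    have "(norm (cross3 (circ_xz t - circ_xz s) (d1 circ_xz s)))\<^sup>2 = (D / (2 * pi))\<^sup>2"
    proof -
      have "cross3 (circ_xz t - circ_xz s) (d1 circ_xz s) = vector [0, (C' / (2*pi) - C / (2*pi)) * C + (S' / (2*pi) - S / (2*pi)) * S, 0]"
        by (simp add: cross3_def circ_xz_def d1_circ_xz d vec3_eq_iff)
      also have "(C' / (2*pi) - C / (2*pi)) * C + (S' / (2*pi) - S / (2*pi)) * S = ((S * S' + C * C') - (S\<^sup>2 + C\<^sup>2)) / (2*pi)"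
        by (simp add: field_simps power2_eq_square)
      also have "\<dots> = - (D / (2 * pi))" unfolding sc D_def by (simp add: field_simps)
      finally show ?thesis by (simp add: norm3_squared)
    qed
    then have c: "norm (cross3 (circ_xz t - circ_xz s) (d1 circ_xz s)) = D / (2 * pi)"
      using D0 by (subst (asm) power2_eq_iff_nonneg) auto
    have r: "(norm (circ_xz t - circ_xz s))\<^sup>2 = 2 * D / (2 * pi)\<^sup>2"
    proof -
      have "(norm (circ_xz t - circ_xz s))\<^sup>2 = (S' / (2*pi) - S / (2*pi))\<^sup>2 + (C' / (2*pi) - C / (2*pi))\<^sup>2"
        by (simp add: norm3_squared circ_xz_def d)
      also have "\<dots> = ((S - S')\<^sup>2 + (C - C')\<^sup>2) / (2 * pi)\<^sup>2"
        by (simp add: field_simps power2_eq_square)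
      finally show ?thesis unfolding n .
    qed
    \<comment> \<open>For \<open>D = 0\<close> the chord vanishes and division by zero returns 0,
      which respects the bound.\<close>
    show ?thesis unfolding inv_rtp_def c r
      by (cases "D = 0") (simp_all add: field_simps power2_eq_square)
  qed
  have nn: "inv_rtp circ_xz s t \<ge> 0" for s t by (simp add: inv_rtp_def)
  have Q: "{0..1} \<times> {0..1} \<in> sets (borel :: (real \<times> real) measure)"
    by (intro borel_closed closed_Times) auto
  have "TP q circ_xz \<le> (\<integral>\<^sup>+ p. ennreal ((2 * pi) powr q) * indicator ({0..1} \<times> {0..1}) p \<partial>(lborel :: (real \<times> real) measure))"
    unfolding TP_def
    using assms by (intro nn_integral_mono mult_right_mono ennreal_leI) (auto intro!: powr_mono2 le nn)
  also have "\<dots> = ennreal ((2 * pi) powr q) * emeasure (lborel :: (real \<times> real) measure) ({0..1} \<times> {0..1})"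
    by (intro nn_integral_cmult_indicator) (metis Q sets_lborel)
  also have "emeasure (lborel :: (real \<times> real) measure) ({0..1} \<times> {0..1}) = 1"
    unfolding lborel_prod[symmetric] by (subst lborel.emeasure_pair_measure_Times) auto
  finally show ?thesis by simp
qed

section \<open>Star-shaped curves are unknotted\<close>

text \<open>The isotopy run backwards, preceded by the inverse of its final map so that it starts at
  the identity.\<close>

lemma ambient_isotopic_sym:
  assumes "ambient_isotopic A B" shows "ambient_isotopic B A"
proof -
  obtain H G :: "real \<times> (real^3) \<Rightarrow> real^3" where
    H: "continuous_on ({0..1} \<times> UNIV) H" and G: "continuous_on ({0..1} \<times> UNIV) G"
    and inv: "\<And>t x. t \<in> {0..1} \<Longrightarrow> G (t, H (t, x)) = x \<and> H (t, G (t, x)) = x"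
    and H0: "\<And>x. H (0, x) = x" and AB: "(\<lambda>x. H (1, x)) ` A = B"
    using assms unfolding ambient_isotopic_def by blast
  define H' where "H' = (\<lambda>p. H (1 - fst p, G (1, snd p)))"
  define G' where "G' = (\<lambda>p. H (1, G (1 - fst p, snd p)))"
  have "continuous_on ({0..1} \<times> UNIV) H'" "continuous_on ({0..1} \<times> UNIV) G'"
    unfolding H'_def G'_def
    by (intro continuous_on_compose2[OF H] continuous_on_compose2[OF G] continuous_intros; auto)+
  moreover have "G' (t, H' (t, x)) = x \<and> H' (t, G' (t, x)) = x" if "t \<in> {0..1}" for t x
    using inv[of "1 - t"] inv[of 1] that by (simp add: H'_def G'_def)
  moreover have "H' (0, x) = x" for x using inv[of 1] by (simp add: H'_def)
  moreover have "(\<lambda>x. H' (1, x)) ` B = A"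
  proof -
    have "(\<lambda>x. H' (1, x)) ` B = (\<lambda>x. H' (1, H (1, x))) ` A" unfolding AB[symmetric] by (simp add: image_image)
    also have "\<dots> = A" using inv[of 1] H0 by (simp add: H'_def)
    finally show ?thesis .
  qed
  ultimately show ?thesis unfolding ambient_isotopic_def by blast
qed

text \<open>Composing the two isotopies at equal times avoids concatenating them.\<close>

lemma ambient_isotopic_trans:
  assumes "ambient_isotopic A B" "ambient_isotopic B C" shows "ambient_isotopic A C"
proof -
  obtain H G :: "real \<times> (real^3) \<Rightarrow> real^3" where
    H: "continuous_on ({0..1} \<times> UNIV) H" and G: "continuous_on ({0..1} \<times> UNIV) G"
    and inv: "\<And>t x. t \<in> {0..1} \<Longrightarrow> G (t, H (t, x)) = x \<and> H (t, G (t, x)) = x"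
    and H0: "\<And>x. H (0, x) = x" and AB: "(\<lambda>x. H (1, x)) ` A = B"
    using assms(1) unfolding ambient_isotopic_def by blast
  obtain H' G' :: "real \<times> (real^3) \<Rightarrow> real^3" where
    H': "continuous_on ({0..1} \<times> UNIV) H'" and G': "continuous_on ({0..1} \<times> UNIV) G'"
    and inv': "\<And>t x. t \<in> {0..1} \<Longrightarrow> G' (t, H' (t, x)) = x \<and> H' (t, G' (t, x)) = x"
    and H0': "\<And>x. H' (0, x) = x" and BC: "(\<lambda>x. H' (1, x)) ` B = C"
    using assms(2) unfolding ambient_isotopic_def by blast
  define H2 where "H2 = (\<lambda>p. H' (fst p, H (fst p, snd p)))"
  define G2 where "G2 = (\<lambda>p. G (fst p, G' (fst p, snd p)))"
  have "continuous_on ({0..1} \<times> UNIV) H2" "continuous_on ({0..1} \<times> UNIV) G2"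
    unfolding H2_def G2_def
    by (intro continuous_on_compose2[OF H] continuous_on_compose2[OF G] continuous_on_compose2[OF H']
        continuous_on_compose2[OF G'] continuous_intros; auto)+
  moreover have "G2 (t, H2 (t, x)) = x \<and> H2 (t, G2 (t, x)) = x" if "t \<in> {0..1}" for t x
    using inv[of t] inv'[of t] that by (simp add: H2_def G2_def)
  moreover have "H2 (0, x) = x" for x by (simp add: H2_def H0 H0')
  moreover have "(\<lambda>x. H2 (1, x)) ` A = C"
    unfolding AB[symmetric] BC[symmetric] by (simp add: H2_def image_image)
  ultimately show ?thesis unfolding ambient_isotopic_def by blast
qed

lemma knot_class_of_eq:
  assumes "ambient_isotopic A B" shows "knot_class_of A = knot_class_of B"
  using assms ambient_isotopic_sym ambient_isotopic_trans unfolding knot_class_of_def by blast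

section \<open>The circles in two coordinate planes and a rotation between them\<close>

lemma continuous_on_vector3:
  assumes "continuous_on S f" "continuous_on S g" "continuous_on S h"
  shows "continuous_on S (\<lambda>x. vector [f x, g x, h x] :: real^3)"
  unfolding vector3_expand by (intro continuous_intros assms)

lemma circle_param:
  assumes "x\<^sup>2 + y\<^sup>2 = (1::real)"
  obtains t where "0 \<le> t" "t < 1" "x = sin (2 * pi * t)" "y = cos (2 * pi * t)"
proof -
  obtain s where s: "0 \<le> s" "s < 2 * pi" "y = cos s" "x = sin s"
    using sincos_total_2pi[of y x] assms by (auto simp: add.commute)
  show ?thesis by (rule that[of "s / (2 * pi)"]) (use s in \<open>auto simp: field_simps\<close>)
qed

lemma circ_xz_image: "circ_xz ` {0..1} = {vector [x / (2 * pi), 0, y / (2 * pi)] | x y. x\<^sup>2 + y\<^sup>2 = 1}"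
proof (intro equalityI subsetI)
  fix v assume "v \<in> circ_xz ` {0..1}"
  then show "v \<in> {vector [x / (2 * pi), 0, y / (2 * pi)] | x y. x\<^sup>2 + y\<^sup>2 = 1}"
    by (fastforce simp: circ_xz_def)
next
  fix v :: "real^3" assume "v \<in> {vector [x / (2 * pi), 0, y / (2 * pi)] | x y. x\<^sup>2 + y\<^sup>2 = 1}"
  then obtain x y where v: "v = vector [x / (2 * pi), 0, y / (2 * pi)]" "x\<^sup>2 + y\<^sup>2 = 1" by blast
  obtain t where "0 \<le> t" "t < 1" "x = sin (2 * pi * t)" "y = cos (2 * pi * t)" using circle_param[OF v(2)] .
  then show "v \<in> circ_xz ` {0..1}" using v(1) by (auto simp: circ_xz_def image_iff intro!: bexI[of _ t])
qed

lemma circ_image: "circ ` {0..1} = {vector [x / (2 * pi), y / (2 * pi), 0] | x y. x\<^sup>2 + y\<^sup>2 = 1}"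
proof (intro equalityI subsetI)
  fix v assume "v \<in> circ ` {0..1}"
  then show "v \<in> {vector [x / (2 * pi), y / (2 * pi), 0] | x y. x\<^sup>2 + y\<^sup>2 = 1}"
    by (fastforce simp: circ_def)
next
  fix v :: "real^3" assume "v \<in> {vector [x / (2 * pi), y / (2 * pi), 0] | x y. x\<^sup>2 + y\<^sup>2 = 1}"
  then obtain x y where v: "v = vector [x / (2 * pi), y / (2 * pi), 0]" "x\<^sup>2 + y\<^sup>2 = 1" by blast
  have "y\<^sup>2 + x\<^sup>2 = 1" using v by simp
  then obtain t where "0 \<le> t" "t < 1" "y = sin (2 * pi * t)" "x = cos (2 * pi * t)" using circle_param by metis
  then show "v \<in> circ ` {0..1}" using v(1) by (auto simp: circ_def image_iff intro!: bexI[of _ t])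
qed

lemma circ_xz_isotopic_circ: "ambient_isotopic (circ_xz ` {0..1}) (circ ` {0..1})"
proof -
  \<comment> \<open>Rotation about the first axis; a quarter turn carries the xz-plane onto the
    xy-plane.\<close>
  define rot :: "real \<Rightarrow> real^3 \<Rightarrow> real^3" where
    "rot a v = vector [v$1, cos a * v$2 + sin a * v$3, cos a * v$3 - sin a * v$2]" for a v
  have rc: "continuous_on S (\<lambda>p :: real \<times> (real^3). rot (k * fst p) (snd p))" for k S
    unfolding rot_def by (intro continuous_on_vector3 continuous_intros)
  have inv: "rot (- a) (rot a v) = v" for a v
  proof -
    define s c where "s = sin a" and "c = cos a"
    have sc: "s * s + c * c = 1"
      using sin_cos_squared_add[of a] by (simp add: s_def c_def power2_eq_square)
    have "c * (c * v$2 + s * v$3) - s * (c * v$3 - s * v$2) = (s * s + c * c) * v$2"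
      "c * (c * v$3 - s * v$2) + s * (c * v$2 + s * v$3) = (s * s + c * c) * v$3"
      by (simp_all add: algebra_simps)
    then show ?thesis unfolding sc by (simp add: rot_def vec3_eq_iff s_def c_def)
  qed
  define H where "H = (\<lambda>p. rot (pi/2 * fst p) (snd p))"
  define G where "G = (\<lambda>p. rot (- (pi/2) * fst p) (snd p))"
  have "continuous_on ({0..1} \<times> UNIV) H" "continuous_on ({0..1} \<times> UNIV) G"
    unfolding H_def G_def by (rule rc)+
  moreover have "G (t, H (t, x)) = x \<and> H (t, G (t, x)) = x" for t x
    using inv[of "pi/2 * t" x] inv[of "- (pi/2 * t)" x] by (simp add: H_def G_def)
  moreover have "H (0, x) = x" for x by (simp add: H_def rot_def vec3_eq_iff)
  moreover have "(\<lambda>x. H (1, x)) ` (circ_xz ` {0..1}) = circ ` {0..1}"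
  proof -
    have H1: "H (1, vector [x, 0, y]) = vector [x, y, 0]" for x y
      by (simp add: H_def rot_def vec3_eq_iff)
    show ?thesis unfolding circ_xz_image circ_image
    proof (intro equalityI subsetI)
      fix v assume "v \<in> (\<lambda>x. H (1, x)) ` {vector [x / (2 * pi), 0, y / (2 * pi)] | x y. x\<^sup>2 + y\<^sup>2 = 1}"
      then show "v \<in> {vector [x / (2 * pi), y / (2 * pi), 0] | x y. x\<^sup>2 + y\<^sup>2 = 1}"
        using H1 by auto
    next
      fix v :: "real^3" assume "v \<in> {vector [x / (2 * pi), y / (2 * pi), 0] | x y. x\<^sup>2 + y\<^sup>2 = 1}"
      then obtain x y where v: "v = vector [x / (2 * pi), y / (2 * pi), 0]" "x\<^sup>2 + y\<^sup>2 = 1" by blast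
      then have "v = H (1, vector [x / (2 * pi), 0, y / (2 * pi)])" by (simp add: H1)
      then show "v \<in> (\<lambda>x. H (1, x)) ` {vector [x / (2 * pi), 0, y / (2 * pi)] | x y. x\<^sup>2 + y\<^sup>2 = 1}"
        using v(2) by blast
    qed
  qed
  ultimately show ?thesis unfolding ambient_isotopic_def by blast
qed

lemma unknot_eq: "unknot = knot_class_of (circ_xz ` {0..1})"
  unfolding unknot_def using knot_class_of_eq[OF circ_xz_isotopic_circ] by simp

text \<open>\<open>A\<close> is bounded on the compact set, so the extension is at most a constant
  times \<open>norm z\<close> and tends to 0 with \<open>z\<close>, although
  \<open>sgn 0 = 0\<close> lies off the sphere and \<open>A\<close> is arbitrary there. Elsewhere it
  is a composition of continuous maps.\<close>

lemma continuous_on_homogeneous: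
  fixes A :: "real \<times> complex \<Rightarrow> 'a::real_normed_vector"
  assumes A: "continuous_on ({0..1} \<times> sphere 0 1) A"
  shows "continuous_on ({0..1} \<times> UNIV) (\<lambda>(t, z). norm z *\<^sub>R A (t, sgn z))"
proof -
  define F where "F = (\<lambda>(t, z). norm z *\<^sub>R A (t, sgn z))"
  have bd: "bounded (A ` ({0..1} \<times> sphere 0 1))"
    by (intro compact_imp_bounded compact_continuous_image A compact_Times) auto
  then obtain B where B: "\<And>t u. t \<in> {0..1} \<Longrightarrow> u \<in> sphere 0 1 \<Longrightarrow> norm (A (t, u)) \<le> B"
    unfolding bounded_iff by force
  have "continuous (at p within {0..1} \<times> UNIV) F" if p: "p \<in> {0..1} \<times> UNIV" for p
  proof (cases "snd p = 0")
    case True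
    have "F p = 0" using True by (simp add: F_def case_prod_beta)
    have le: "norm (F q) \<le> norm (snd q) * \<bar>B\<bar>" if "q \<in> {0..1} \<times> UNIV" for q
    proof (cases "snd q = 0")
      case False
      have "norm (A (fst q, sgn (snd q))) \<le> \<bar>B\<bar>"
        using B[of "fst q" "sgn (snd q)"] that False by (force simp: norm_sgn)
      then show ?thesis by (simp add: F_def case_prod_beta mult_left_mono)
    qed (simp add: F_def case_prod_beta)
    have "((\<lambda>q. norm (snd q) * \<bar>B\<bar>) \<longlongrightarrow> norm (snd p) * \<bar>B\<bar>) (at p within {0..1} \<times> UNIV)"
      by (intro tendsto_intros)
    then have "((\<lambda>q. norm (snd q) * \<bar>B\<bar>) \<longlongrightarrow> 0) (at p within {0..1} \<times> UNIV)" using True by simp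
    then have "(F \<longlongrightarrow> 0) (at p within {0..1} \<times> UNIV)"
    proof (rule Lim_null_comparison[rotated])
      show "\<forall>\<^sub>F q in at p within {0..1} \<times> UNIV. norm (F q) \<le> norm (snd q) * \<bar>B\<bar>"
        unfolding eventually_at_filter by (intro always_eventually) (use le in auto)
    qed
    then show ?thesis unfolding continuous_within \<open>F p = 0\<close> .
  next
    case False
    define S where "S = {0..1::real} \<times> (- {0::complex})"
    have "continuous_on S (\<lambda>x. A (fst x, sgn (snd x)))"
    proof (rule continuous_on_compose2[OF A])
      show "continuous_on S (\<lambda>x. (fst x, sgn (snd x)))"
        by (intro continuous_intros) (auto simp: S_def)
      show "(\<lambda>x. (fst x, sgn (snd x))) ` S \<subseteq> {0..1} \<times> sphere 0 1"
        by (auto simp: S_def norm_sgn)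
    qed
    then have "continuous_on S F" unfolding F_def case_prod_beta by (intro continuous_intros)
    moreover have "p \<in> S" using False p by (simp add: S_def mem_Times_iff)
    ultimately have c: "continuous (at p within S) F"
      by (simp only: continuous_on_eq_continuous_within)
    have "at p within S = at p within {0..1} \<times> UNIV"
    proof (rule at_within_nhd[of _ "UNIV \<times> - {0}"])
      show "open (UNIV \<times> - {0} :: (real \<times> complex) set)" by (intro open_Times) auto
    qed (use False in \<open>auto simp: S_def mem_Times_iff\<close>)
    then show ?thesis using c by (simp add: continuous_within)
  qed
  then have "continuous_on ({0..1} \<times> UNIV) F"
    unfolding continuous_on_eq_continuous_within by blast
  then show ?thesis unfolding F_def .
qed

text \<open>Together with \<open>spatial\<close> this splits space into the xz-plane, read as the
  complex plane, and a height over it; \<open>sgn\<close> then becomes the radial projection onto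
  the unit circle.\<close>

definition planar :: "real^3 \<Rightarrow> complex" where "planar v = Complex (v$1) (v$3)"

definition spatial :: "complex \<Rightarrow> real \<Rightarrow> real^3" where "spatial z y = vector [Re z, y, Im z]"

lemma planar_spatial [simp]: "planar (spatial z y) = z" "spatial z y $ 2 = y"
  by (simp_all add: planar_def spatial_def)

lemma spatial_planar [simp]: "spatial (planar v) (v$2) = v"
  by (simp add: planar_def spatial_def vec3_eq_iff)

lemma continuous_on_planar [continuous_intros]:
  "continuous_on S f \<Longrightarrow> continuous_on S (\<lambda>x. planar (f x))"
  unfolding planar_def Complex_eq by (intro continuous_intros)

lemma continuous_on_spatial [continuous_intros]:
  "continuous_on S f \<Longrightarrow> continuous_on S g \<Longrightarrow> continuous_on S (\<lambda>x. spatial (f x) (g x))"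
  unfolding spatial_def by (intro continuous_on_vector3 continuous_intros)

lemma continuous_on_planar_homogeneous:
  fixes A :: "real \<times> complex \<Rightarrow> 'a::real_normed_vector"
  assumes "continuous_on ({0..1} \<times> sphere 0 1) A"
  shows "continuous_on ({0..1} \<times> UNIV) (\<lambda>(t, v). norm (planar v) *\<^sub>R A (t, sgn (planar v)))"
proof -
  have "continuous_on ({0..1} \<times> UNIV) (\<lambda>p. (case (fst p, planar (snd p)) of (t, z) \<Rightarrow> norm z *\<^sub>R A (t, sgn z)))"
    by (rule continuous_on_compose2[OF continuous_on_homogeneous[OF assms]]) (auto intro!: continuous_intros)
  then show ?thesis by (simp add: case_prod_beta)
qed

text \<open>A set over a star-shaped planar curve is deformed onto the circle by maps that are homogeneous
  of degree one in the planar coordinates, hence continuous across the axis.\<close>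
lemma star_shaped_unknot:
  assumes K: "compact K" and nz: "\<And>v. v \<in> K \<Longrightarrow> planar v \<noteq> 0"
    and inj: "inj_on (\<lambda>v. sgn (planar v)) K" and surj: "(\<lambda>v. sgn (planar v)) ` K = sphere 0 1"
  shows "knot_set K" "knot_class_of K = unknot"
proof -
  \<comment> \<open>\<open>K\<close> is a graph over the unit circle: \<open>g\<close> sends a
    direction to the point of \<open>K\<close> over it, and compactness of \<open>K\<close> makes
    this inverse continuous.\<close>
  define g where "g = inv_into K (\<lambda>v. sgn (planar v))"
  have gK: "g (sgn (planar v)) = v" if "v \<in> K" for v using inv_into_f_f[OF inj that] by (simp add: g_def)
  have g: "g u \<in> K" "sgn (planar (g u)) = u" if "u \<in> sphere 0 1" for u
    using that surj unfolding g_def by (metis inv_into_into, metis f_inv_into_f)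
  have Nc: "continuous_on K (\<lambda>v. sgn (planar v))" using nz by (intro continuous_intros) auto
  have gc: "continuous_on (sphere 0 1) g"
    unfolding surj[symmetric] by (rule continuous_on_inv[OF Nc K]) (use gK in auto)
  define \<gamma> where "\<gamma> t = g (Complex (sin (2 * pi * t)) (cos (2 * pi * t)))" for t
  have sph: "Complex (sin (2 * pi * t)) (cos (2 * pi * t)) \<in> sphere 0 1" for t
    by (simp add: cmod_def)
  show "knot_set K" unfolding knot_set_def
  proof (intro exI[of _ \<gamma>] conjI)
    show "continuous_on UNIV \<gamma>" unfolding \<gamma>_def
    proof (rule continuous_on_compose2[OF gc])
      show "continuous_on UNIV (\<lambda>t. Complex (sin (2 * pi * t)) (cos (2 * pi * t)))"
        unfolding Complex_eq by (intro continuous_intros)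
    qed (use sph in auto)
    show "periodic1 \<gamma>" by (simp add: periodic1_def \<gamma>_def distrib_left)
    show "inj_on \<gamma> {0..<1}"
    proof (rule inj_onI)
      fix s t :: real assume st: "s \<in> {0..<1}" "t \<in> {0..<1}" and eq: "\<gamma> s = \<gamma> t"
      have "Complex (sin (2 * pi * s)) (cos (2 * pi * s)) = sgn (planar (\<gamma> s))"
        unfolding \<gamma>_def by (rule g(2)[OF sph, symmetric])
      also have "\<dots> = Complex (sin (2 * pi * t)) (cos (2 * pi * t))"
        unfolding eq unfolding \<gamma>_def by (rule g(2)[OF sph])
      finally show "s = t" using st by (rule_tac sin_cos_2pi_inj) auto
    qed
    show "K = \<gamma> ` {0..1}"
    proof (intro equalityI subsetI)
      fix v assume v: "v \<in> K"
      define u where "u = sgn (planar v)"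
      have "norm u = 1" using nz[OF v] by (simp add: u_def norm_sgn)
      then have "(Re u)\<^sup>2 + (Im u)\<^sup>2 = 1" using cmod_power2[of u] by simp
      then obtain t where "0 \<le> t" "t < 1" "Re u = sin (2 * pi * t)" "Im u = cos (2 * pi * t)"
        by (rule circle_param)
      then have "u = Complex (sin (2 * pi * t)) (cos (2 * pi * t))" by (simp add: complex_eq_iff)
      then have "v = \<gamma> t" using gK[OF v] by (simp add: \<gamma>_def u_def[symmetric])
      then show "v \<in> \<gamma> ` {0..1}" using \<open>0 \<le> t\<close> \<open>t < 1\<close> by auto
    qed (use g(1)[OF sph] in \<open>auto simp: \<gamma>_def\<close>)
  qed
  define \<rho> where "\<rho> u = norm (planar (g u))" for u
  have \<rho>: "\<rho> u > 0" if "u \<in> sphere 0 1" for u using nz g(1)[OF that] by (simp add: \<rho>_def)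
  have \<rho>c: "continuous_on (sphere 0 1) \<rho>" unfolding \<rho>_def by (intro continuous_intros gc)
  \<comment> \<open>Radial factor, moving linearly from 1 to the one that brings radius
    \<open>\<rho> u\<close> to 1/(2 pi).\<close>
  define a where "a t u = (1 - t) + t * (1 / (2 * pi * \<rho> u))" for t u
  have apos: "a t u > 0" if t: "t \<in> {0..1}" and u: "u \<in> sphere 0 1" for t u
  proof (cases "t = 1")
    case True then show ?thesis using \<rho>[OF u] by (simp add: a_def)
  next
    case False
    then have "1 - t > 0" using t by simp
    moreover have "t * (1 / (2 * pi * \<rho> u)) \<ge> 0" using t \<rho>[OF u] by simp
    ultimately show ?thesis by (simp add: a_def)
  qed
  \<comment> \<open>Height per unit radius. A height correction proportional to the radius is
    homogeneous and flattens \<open>K\<close> at time 1.\<close>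
  define b where "b u = g u $ 2 / \<rho> u" for u
  have fst_snd: "continuous_on ({0..1} \<times> sphere 0 1) (\<lambda>p. f (snd p))" if "continuous_on (sphere 0 1) f"
    for f :: "complex \<Rightarrow> real"
    by (rule continuous_on_compose2[OF that continuous_on_snd[OF continuous_on_id]]) auto
  have ac: "continuous_on ({0..1} \<times> sphere 0 1) (\<lambda>p. a (fst p) (snd p))"
    unfolding a_def
    by (intro continuous_intros fst_snd \<rho>c) (use \<rho> in force)
  have bc: "continuous_on ({0..1} \<times> sphere 0 1) (\<lambda>p. b (snd p))"
    unfolding b_def
    by (intro continuous_on_divide fst_snd \<rho>c continuous_intros gc) (use \<rho> in force)+
  define H where "H = (\<lambda>(t, v). spatial (a t (sgn (planar v)) *\<^sub>R planar v)
      (v$2 - t * norm (planar v) * b (sgn (planar v))))"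
  \<comment> \<open>The direction is unchanged by \<open>H\<close>, so \<open>G\<close> inverts the
    radial factor and restores the height using the original radius.\<close>
  define G where "G = (\<lambda>(t, v). spatial (inverse (a t (sgn (planar v))) *\<^sub>R planar v)
      (v$2 + t * norm (planar v) * b (sgn (planar v)) * inverse (a t (sgn (planar v)))))"
  have polar: "norm z *\<^sub>R (c *\<^sub>R sgn z) = c *\<^sub>R z" for z :: complex and c
    by (cases "z = 0") (simp_all add: sgn_div_norm)
  have anz: "\<And>p. p \<in> {0..1} \<times> sphere 0 1 \<Longrightarrow> a (fst p) (snd p) \<noteq> 0" using apos by force
  have Hc: "continuous_on ({0..1} \<times> UNIV) H"
  proof -
    have "continuous_on ({0..1} \<times> sphere 0 1) (\<lambda>p. a (fst p) (snd p) *\<^sub>R snd p)"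
      by (intro continuous_intros ac bc)
    from continuous_on_planar_homogeneous[OF this]
    have 1: "continuous_on ({0..1} \<times> UNIV) (\<lambda>p. a (fst p) (sgn (planar (snd p))) *\<^sub>R planar (snd p))"
      unfolding case_prod_beta fst_conv snd_conv polar .
    have "continuous_on ({0..1} \<times> sphere 0 1) (\<lambda>p. fst p * b (snd p))"
      by (intro continuous_intros ac bc)
    from continuous_on_planar_homogeneous[OF this]
    have "continuous_on ({0..1} \<times> UNIV) (\<lambda>(t, v). norm (planar v) *\<^sub>R (t * b (sgn (planar v))))"
      by (simp add: case_prod_beta)
    then have 2: "continuous_on ({0..1} \<times> UNIV) (\<lambda>p. fst p * norm (planar (snd p)) * b (sgn (planar (snd p))))"
      by (simp add: case_prod_beta mult_ac)
    show ?thesis unfolding H_def case_prod_beta by (intro continuous_intros 1 2)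
  qed
  have Gc: "continuous_on ({0..1} \<times> UNIV) G"
  proof -
    have "continuous_on ({0..1} \<times> sphere 0 1) (\<lambda>p. inverse (a (fst p) (snd p)) *\<^sub>R snd p)"
      by (intro continuous_intros ac bc) (use anz in auto)
    from continuous_on_planar_homogeneous[OF this]
    have 1: "continuous_on ({0..1} \<times> UNIV) (\<lambda>p. inverse (a (fst p) (sgn (planar (snd p)))) *\<^sub>R planar (snd p))"
      unfolding case_prod_beta fst_conv snd_conv polar .
    have "continuous_on ({0..1} \<times> sphere 0 1) (\<lambda>p. fst p * b (snd p) * inverse (a (fst p) (snd p)))"
      by (intro continuous_intros ac bc) (use anz in auto)
    from continuous_on_planar_homogeneous[OF this]
    have "continuous_on ({0..1} \<times> UNIV) (\<lambda>(t, v). norm (planar v) *\<^sub>R (t * b (sgn (planar v)) * inverse (a t (sgn (planar v)))))"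
      by (simp add: case_prod_beta)
    then have 2: "continuous_on ({0..1} \<times> UNIV) (\<lambda>p. fst p * norm (planar (snd p)) * b (sgn (planar (snd p))) * inverse (a (fst p) (sgn (planar (snd p)))))"
      by (simp add: case_prod_beta mult_ac)
    show ?thesis unfolding G_def case_prod_beta by (intro continuous_intros 1 2)
  qed
  have inv: "G (t, H (t, v)) = v \<and> H (t, G (t, v)) = v" if t: "t \<in> {0..1}" for t v
  proof (cases "planar v = 0")
    case True
    then have "spatial 0 (v$2) = v" by (metis spatial_planar)
    then show ?thesis using True by (simp add: G_def H_def)
  next
    case False
    define u where "u = sgn (planar v)"
    have "u \<in> sphere 0 1" using False by (simp add: u_def norm_sgn)
    then have ap: "a t u > 0" using apos t by blast
    have s1: "sgn (a t u *\<^sub>R planar v) = u" "sgn (inverse (a t u) *\<^sub>R planar v) = u"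
      using ap by (simp_all add: u_def sgn_scaleR)
    have c: "a t u * (x * (y * inverse (a t u))) = x * y" for x y using ap by (simp add: field_simps)
    show ?thesis using ap
      by (simp add: G_def H_def u_def[symmetric] s1 mult.assoc c)
  qed
  have H0: "H (0, v) = v" for v by (simp add: H_def a_def)
  have img: "(\<lambda>v. H (1, v)) ` K = circ_xz ` {0..1}"
  proof -
    have H1: "H (1, v) = spatial ((1 / (2 * pi)) *\<^sub>R sgn (planar v)) 0" if v: "v \<in> K" for v
    proof -
      define u where "u = sgn (planar v)"
      have gu: "g u = v" using gK[OF v] by (simp add: u_def)
      have r: "\<rho> u = norm (planar v)" by (simp add: \<rho>_def gu)
      have "norm (planar v) > 0" using nz[OF v] by simp
      then have "H (1, v) = spatial ((1 / (2 * pi * norm (planar v))) *\<^sub>R planar v) 0"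
        by (simp add: H_def u_def[symmetric] a_def b_def gu r)
      moreover have "1 / (2 * pi * norm (planar v)) = 1 / (2 * pi) * inverse (norm (planar v))"
        by (simp add: field_simps)
      ultimately show ?thesis by (simp only: sgn_div_norm scaleR_scaleR)
    qed
    have "(\<lambda>v. H (1, v)) ` K = (\<lambda>u. spatial ((1 / (2 * pi)) *\<^sub>R u) 0) ` sphere 0 1"
      unfolding surj[symmetric] image_image by (rule image_cong) (auto simp: H1)
    also have "\<dots> = circ_xz ` {0..1}"
      unfolding circ_xz_image
    proof (intro equalityI subsetI)
      fix v assume "v \<in> (\<lambda>u. spatial ((1 / (2 * pi)) *\<^sub>R u) 0) ` sphere 0 1"
      then obtain u where u: "norm u = 1" "v = spatial ((1 / (2 * pi)) *\<^sub>R u) 0" by auto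
      have "(Re u)\<^sup>2 + (Im u)\<^sup>2 = 1" using u(1) cmod_power2[of u] by simp
      then show "v \<in> {vector [x / (2 * pi), 0, y / (2 * pi)] | x y. x\<^sup>2 + y\<^sup>2 = 1}"
        using u(2) by (auto simp: spatial_def)
    next
      fix v :: "real^3" assume "v \<in> {vector [x / (2 * pi), 0, y / (2 * pi)] | x y. x\<^sup>2 + y\<^sup>2 = 1}"
      then obtain x y where v: "v = vector [x / (2 * pi), 0, y / (2 * pi)]" "x\<^sup>2 + y\<^sup>2 = 1" by blast
      have "Complex x y \<in> sphere 0 1" using v(2) by (simp add: cmod_def)
      moreover have "v = spatial ((1 / (2 * pi)) *\<^sub>R Complex x y) 0" using v(1) by (simp add: spatial_def)
      ultimately show "v \<in> (\<lambda>u. spatial ((1 / (2 * pi)) *\<^sub>R u) 0) ` sphere 0 1" by blast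
    qed
    finally show ?thesis .
  qed
  have "ambient_isotopic K (circ_xz ` {0..1})"
    unfolding ambient_isotopic_def using Hc Gc inv H0 img by blast
  then show "knot_class_of K = unknot" unfolding unknot_eq by (rule knot_class_of_eq)
qed

text \<open>Tameness of the unknot asks for a polygonal member of its class. The unit circle of the
  l1 norm in the xz-plane has four edges and is star-shaped, so \<open>star_shaped_unknot\<close>
  applies to it.\<close>

definition diamond :: "(real^3) set" where
  "diamond = {v. v$2 = 0 \<and> \<bar>v$1\<bar> + \<bar>v$3\<bar> = 1}"

lemma diamond_segment:
  assumes s: "s = 1 \<or> s = -1" and t: "t = 1 \<or> t = (-1::real)"
  shows "closed_segment (vector [s, 0, 0]) (vector [0, 0, t] :: real^3)
    = {v. v$2 = 0 \<and> s * v$1 \<ge> 0 \<and> t * v$3 \<ge> 0 \<and> s * v$1 + t * v$3 = 1}" (is "?L = ?R")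
proof (intro equalityI subsetI)
  fix v assume "v \<in> ?L"
  then obtain u where "0 \<le> u" "u \<le> 1" "v = (1 - u) *\<^sub>R vector [s, 0, 0] + u *\<^sub>R vector [0, 0, t]"
    unfolding closed_segment_def by blast
  then show "v \<in> ?R" using s t by auto
next
  fix v :: "real^3" assume v: "v \<in> ?R"
  have ss: "s * s = 1" "t * t = 1" using s t by auto
  have "1 - t * v$3 = s * v$1" using v by simp
  then have "(1 - t * v$3) * s = v$1" using ss by (metis mult.assoc mult.commute mult.right_neutral)
  moreover have "t * v$3 * t = v$3" using ss by (metis mult.assoc mult.commute mult.right_neutral)
  ultimately have "v = (1 - t * v$3) *\<^sub>R vector [s, 0, 0] + (t * v$3) *\<^sub>R vector [0, 0, t]"
    using v by (simp add: vec3_eq_iff)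
  moreover have "0 \<le> t * v$3" "t * v$3 \<le> 1" using v by auto
  ultimately show "v \<in> ?L" unfolding closed_segment_def by blast
qed

definition diamond_edges :: "((real^3) \<times> (real^3)) set" where
  "diamond_edges = (\<lambda>(s, t). (vector [s, 0, 0], vector [0, 0, t])) ` ({1, -1} \<times> {1, -1})"

lemma diamond_eq_edges: "diamond = (\<Union>(a, b)\<in>diamond_edges. closed_segment a b)"
proof -
  have "(\<Union>(a, b)\<in>diamond_edges. closed_segment a b)
      = (\<Union>s\<in>{1, -1}. \<Union>t\<in>{1, -1}. {v. v$2 = 0 \<and> s * v$1 \<ge> 0 \<and> t * v$3 \<ge> 0 \<and> s * v$1 + t * v$3 = 1})"
    using diamond_segment by (auto simp: diamond_edges_def)
  also have "\<dots> = diamond" by (auto simp: diamond_def)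
  finally show ?thesis by simp
qed

lemma polygonal_diamond: "polygonal diamond"
  unfolding polygonal_def
  by (intro exI[of _ diamond_edges] conjI diamond_eq_edges) (simp add: diamond_edges_def)

lemma compact_diamond: "compact diamond"
  unfolding diamond_eq_edges by (intro compact_UN) (auto simp: diamond_edges_def)

lemma star_shaped_diamond:
  shows "\<And>v. v \<in> diamond \<Longrightarrow> planar v \<noteq> 0"
    and "inj_on (\<lambda>v. sgn (planar v)) diamond" and "(\<lambda>v. sgn (planar v)) ` diamond = sphere 0 1"
proof -
  show nz: "planar v \<noteq> 0" if "v \<in> diamond" for v
    using that by (auto simp: diamond_def planar_def complex_eq_iff)
  \<comment> \<open>The l1 norm of the planar part; by homogeneity each ray meets its unit circle
    exactly once.\<close>
  define N where "N z = \<bar>Re z\<bar> + \<bar>Im z\<bar>" for z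
  have Nsc: "N (c *\<^sub>R z) = \<bar>c\<bar> * N z" for c z by (simp add: N_def abs_mult algebra_simps)
  have N1: "N (planar v) = 1" if "v \<in> diamond" for v using that by (simp add: diamond_def planar_def N_def)
  have polar: "planar v = norm (planar v) *\<^sub>R sgn (planar v)" if "v \<in> diamond" for v
    using nz[OF that] by (simp add: sgn_div_norm)
  show "inj_on (\<lambda>v. sgn (planar v)) diamond"
  proof (rule inj_onI)
    fix v w assume v: "v \<in> diamond" and w: "w \<in> diamond" and eq: "sgn (planar v) = sgn (planar w)"
    define u where "u = sgn (planar v)"
    have "norm (planar v) * N u = 1" "norm (planar w) * N u = 1"
      using N1[OF v] N1[OF w] Nsc[of "norm (planar v)" u] Nsc[of "norm (planar w)" u] polar[OF v] polar[OF w] eq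
      by (auto simp: u_def)
    then have "norm (planar v) = norm (planar w)" by (metis mult_cancel_right mult_zero_right zero_neq_one)
    then have "planar v = planar w" using polar[OF v] polar[OF w] eq by simp
    then show "v = w" using v w by (simp add: planar_def diamond_def vec3_eq_iff)
  qed
  show "(\<lambda>v. sgn (planar v)) ` diamond = sphere 0 1"
  proof (intro equalityI subsetI)
    fix u assume "u \<in> (\<lambda>v. sgn (planar v)) ` diamond"
    then show "u \<in> sphere 0 1" using nz by (auto simp: norm_sgn)
  next
    fix u :: complex assume u: "u \<in> sphere 0 1"
    then have "u \<noteq> 0" by auto
    then have N0: "N u > 0" by (auto simp: N_def complex_eq_iff)
    define v where "v = spatial (inverse (N u) *\<^sub>R u) 0"
    have pv: "planar v = inverse (N u) *\<^sub>R u" by (simp add: v_def)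
    have "N (planar v) = 1" unfolding pv Nsc using N0 by simp
    then have "v \<in> diamond" by (simp add: diamond_def N_def planar_def v_def)
    moreover have "sgn (planar v) = u" unfolding pv sgn_scaleR using N0 u by (simp add: sgn_div_norm)
    ultimately show "u \<in> (\<lambda>v. sgn (planar v)) ` diamond" by force
  qed
qed

section \<open>The unknot class is tame\<close>

lemma knot_set_circ_xz: "knot_set (circ_xz ` {0..1})"
  unfolding knot_set_def using W22_cont[OF W22_circ_xz] W22_circ_xz inj_circ_xz
  by (auto simp: W22_def)

lemma ambient_isotopic_refl: "ambient_isotopic A A"
  unfolding ambient_isotopic_def
  by (intro exI[of _ snd]) (auto intro!: continuous_intros)

lemma circ_xz_in_unknot: "circ_xz ` {0..1} \<in> unknot"
  unfolding unknot_eq knot_class_of_def using knot_set_circ_xz ambient_isotopic_refl by simp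

lemma tame_unknot: "tame_knot_class unknot"
proof -
  have k: "knot_set diamond" "knot_class_of diamond = unknot"
    using star_shaped_unknot[OF compact_diamond star_shaped_diamond] by auto
  have "tame diamond"
    unfolding tame_def using k(1) polygonal_diamond ambient_isotopic_refl by blast
  then show ?thesis unfolding tame_knot_class_def using k(2) by metis
qed

lemma knot_class_eq_unknot:
  assumes "tame_knot_class \<K>" "K \<in> \<K>" "knot_class_of K = unknot"
  shows "\<K> = unknot"
proof -
  obtain K0 where "\<K> = knot_class_of K0" using assms(1) by (auto simp: tame_knot_class_def)
  moreover then have "ambient_isotopic K0 K" using assms(2) by (simp add: knot_class_of_def)
  ultimately show ?thesis using knot_class_of_eq assms(3) by metis
qed

text \<open>\<open>\<phi>\<close> is an approximate polar angle, in turns, that advances by one over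
  a period; \<open>a\<close> and \<open>b\<close> absorb reflections of the axes. By the first
  inequality the planar position makes an acute angle with the direction of phase
  \<open>\<phi> t\<close>, which yields a continuous angle \<open>\<Theta>\<close> without choosing
  branches. The second, positive angular momentum, makes \<open>\<Theta>\<close> strictly
  increasing. One monotone turn meets each ray exactly once.\<close>

lemma star_shaped_curve_unknot:
  fixes \<gamma> :: "real \<Rightarrow> real^3" and \<phi> :: "real \<Rightarrow> real"
  assumes W: "W22 \<gamma>" and a: "a = 1 \<or> a = (-1::real)" and b: "b = 1 \<or> b = (-1::real)"
    and \<phi>d: "\<And>t. (\<phi> has_real_derivative \<phi>' t) (at t)" and \<phi>1: "\<phi> 1 = \<phi> 0 + 1"
    and pos: "\<And>t. a * \<gamma> t $ 1 * sin (2 * pi * \<phi> t) + b * \<gamma> t $ 3 * cos (2 * pi * \<phi> t) > 0"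
    and J: "\<And>t. a * b * (d1 \<gamma> t $ 1 * \<gamma> t $ 3 - \<gamma> t $ 1 * d1 \<gamma> t $ 3) > 0"
  shows "knot_class_of (\<gamma> ` {0..1}) = unknot"
proof -
  define X Z X' Z' where "X t = a * \<gamma> t $ 1" and "Z t = b * \<gamma> t $ 3"
    and "X' t = a * d1 \<gamma> t $ 1" and "Z' t = b * d1 \<gamma> t $ 3" for t
  define S C where "S t = sin (2 * pi * \<phi> t)" and "C t = cos (2 * pi * \<phi> t)" for t
  \<comment> \<open>Radial and transverse coordinates of the planar position in the frame rotating
    with \<open>\<phi>\<close>. Positivity of \<open>p\<close> confines the deviation to less than a
    quarter turn, where \<open>arctan\<close> measures it.\<close>
  define p q where "p t = X t * S t + Z t * C t" and "q t = X t * C t - Z t * S t" for t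
  define \<Theta> where "\<Theta> t = \<phi> t + arctan (q t / p t) / (2 * pi)" for t
  have Xd: "(X has_real_derivative X' t) (at t)" and Zd: "(Z has_real_derivative Z' t) (at t)" for t
    unfolding X_def X'_def Z_def Z'_def by (intro DERIV_cmult W22_deriv_component W)+
  have angd: "((\<lambda>t. 2 * pi * \<phi> t) has_real_derivative 2 * pi * \<phi>' t) (at t)" for t
    by (intro DERIV_cmult \<phi>d)
  have Sd: "(S has_real_derivative C t * (2 * pi * \<phi>' t)) (at t)" for t
    unfolding S_def C_def by (rule DERIV_chain2[OF DERIV_sin angd])
  have Cd: "(C has_real_derivative - S t * (2 * pi * \<phi>' t)) (at t)" for t
    unfolding S_def C_def by (rule DERIV_chain2[OF DERIV_cos angd])
  have sc: "S t * S t + C t * C t = 1" for t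
    using sin_cos_squared_add[of "2 * pi * \<phi> t"] by (simp add: S_def C_def power2_eq_square)
  have pp: "p t > 0" for t using pos[of t] by (simp add: p_def X_def Z_def S_def C_def)
  have JJ: "X' t * Z t - X t * Z' t > 0" for t using J[of t] by (simp add: X_def X'_def Z_def Z'_def algebra_simps)
  define p' q' where "p' t = X' t * S t + Z' t * C t + 2 * pi * \<phi>' t * q t"
    and "q' t = X' t * C t - Z' t * S t - 2 * pi * \<phi>' t * p t" for t
  have pd: "(p has_real_derivative p' t) (at t)" for t
    unfolding p_def p'_def q_def
    by (rule derivative_eq_intros Xd Zd Sd Cd refl)+ (simp add: algebra_simps)
  have qd: "(q has_real_derivative q' t) (at t)" for t
    unfolding q_def p_def q'_def
    by (rule derivative_eq_intros Xd Zd Sd Cd refl)+ (simp add: algebra_simps)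
  define R where "R t = p t * p t + q t * q t" for t
  have Rpos: "R t > 0" for t using pp[of t] by (simp add: R_def add_pos_nonneg)
  \<comment> \<open>The rotation of the frame contributes only the last term, which cancels the
    summand \<open>\<phi>'\<close> in the derivative of \<open>\<Theta>\<close>.\<close>
  have key: "q' t * p t - q t * p' t = (X' t * Z t - X t * Z' t) - 2 * pi * \<phi>' t * R t" for t
  proof -
    have "q' t * p t - q t * p' t = (X' t * Z t - X t * Z' t) * (S t * S t + C t * C t) - 2 * pi * \<phi>' t * R t"
      by (simp add: p'_def q'_def R_def) (simp add: p_def q_def algebra_simps)
    then show ?thesis by (simp add: sc)
  qed
  have \<Theta>d: "(\<Theta> has_real_derivative (X' t * Z t - X t * Z' t) / R t / (2 * pi)) (at t)" for t
  proof -
    have "((\<lambda>t. q t / p t) has_real_derivative (q' t * p t - q t * p' t) / (p t * p t)) (at t)"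
      by (rule DERIV_divide[OF qd pd]) (use pp[of t] in simp)
    then have "((\<lambda>t. arctan (q t / p t)) has_real_derivative
        inverse (1 + (q t / p t)\<^sup>2) * ((q' t * p t - q t * p' t) / (p t * p t))) (at t)"
      by (rule DERIV_chain2[OF DERIV_arctan])
    then have "(\<Theta> has_real_derivative \<phi>' t +
        inverse (1 + (q t / p t)\<^sup>2) * ((q' t * p t - q t * p' t) / (p t * p t)) / (2 * pi)) (at t)"
      unfolding \<Theta>_def by (intro DERIV_add \<phi>d DERIV_cdivide)
    also have "inverse (1 + (q t / p t)\<^sup>2) * ((q' t * p t - q t * p' t) / (p t * p t)) = (q' t * p t - q t * p' t) / R t"
    proof -
      have "1 + (q t / p t)\<^sup>2 = R t / (p t * p t)"
        using pp[of t] by (simp add: R_def field_simps power2_eq_square)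
      then show ?thesis using pp[of t] Rpos[of t] by (simp add: field_simps)
    qed
    also have "\<phi>' t + (q' t * p t - q t * p' t) / R t / (2 * pi) = (X' t * Z t - X t * Z' t) / R t / (2 * pi)"
      unfolding key using Rpos[of t] by (simp add: field_simps)
    finally show ?thesis .
  qed
  have mono: "\<Theta> s < \<Theta> t" if "s < t" for s t
  proof (rule DERIV_pos_imp_increasing[OF that])
    fix x show "\<exists>y. DERIV \<Theta> x :> y \<and> 0 < y"
      using JJ[of x] Rpos[of x] by (intro exI[of _ "(X' x * Z x - X x * Z' x) / R x / (2 * pi)"] conjI \<Theta>d) simp
  qed
  have \<Theta>c: "continuous_on A \<Theta>" for A
    using \<Theta>d by (meson DERIV_isCont continuous_at_imp_continuous_on)
  have per: "\<gamma> 1 = \<gamma> 0" using W22_periodic[OF W, of 0] by simp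
  have \<Theta>1: "\<Theta> 1 = \<Theta> 0 + 1"
  proof -
    have "2 * pi * (\<phi> 0 + 1) = 2 * pi * \<phi> 0 + 2 * pi" by (simp add: algebra_simps)
    then have "S 1 = S 0" "C 1 = C 0" by (simp_all add: S_def C_def \<phi>1)
    then show ?thesis by (simp add: \<Theta>_def p_def q_def X_def Z_def per \<phi>1)
  qed
  have dir: "sin (2 * pi * \<Theta> t) = X t / sqrt (R t)" "cos (2 * pi * \<Theta> t) = Z t / sqrt (R t)" for t
  proof -
    define \<alpha> where "\<alpha> = arctan (q t / p t)"
    have s: "sqrt (1 + (q t / p t)\<^sup>2) = sqrt (R t) / p t"
    proof -
      have "1 + (q t / p t)\<^sup>2 = R t / (p t)\<^sup>2"
        using pp[of t] by (simp add: R_def field_simps power2_eq_square)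
      then show ?thesis using pp[of t] by (simp add: real_sqrt_divide)
    qed
    have ca: "cos \<alpha> = p t / sqrt (R t)" "sin \<alpha> = q t / sqrt (R t)"
      unfolding \<alpha>_def cos_arctan sin_arctan s using pp[of t] by simp_all
    have ang: "2 * pi * \<Theta> t = 2 * pi * \<phi> t + \<alpha>" by (simp add: \<Theta>_def \<alpha>_def field_simps)
    have "sin (2 * pi * \<Theta> t) = (S t * p t + C t * q t) / sqrt (R t)"
      unfolding ang sin_add ca by (simp add: S_def C_def add_divide_distrib)
    also have "S t * p t + C t * q t = X t * (S t * S t + C t * C t)"
      by (simp add: p_def q_def algebra_simps)
    finally show "sin (2 * pi * \<Theta> t) = X t / sqrt (R t)" by (simp add: sc)
    have "cos (2 * pi * \<Theta> t) = (C t * p t - S t * q t) / sqrt (R t)"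
      unfolding ang cos_add ca by (simp add: S_def C_def diff_divide_distrib)
    also have "C t * p t - S t * q t = Z t * (S t * S t + C t * C t)"
      by (simp add: p_def q_def algebra_simps)
    finally show "cos (2 * pi * \<Theta> t) = Z t / sqrt (R t)" by (simp add: sc)
  qed
  have RXZ: "R t = X t * X t + Z t * Z t" for t
  proof -
    have "R t = (X t * X t + Z t * Z t) * (S t * S t + C t * C t)" by (simp add: R_def p_def q_def algebra_simps)
    then show ?thesis by (simp add: sc)
  qed
  have XX: "X t * X t = (\<gamma> t $ 1)\<^sup>2" "Z t * Z t = (\<gamma> t $ 3)\<^sup>2" for t
    using a b by (auto simp: X_def Z_def power2_eq_square)
  have normp: "norm (planar (\<gamma> t)) = sqrt (R t)" for t
    by (simp add: RXZ XX planar_def cmod_def)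
  have sg: "sgn (planar (\<gamma> t)) = Complex (a * sin (2 * pi * \<Theta> t)) (b * cos (2 * pi * \<Theta> t))" for t
  proof -
    have "sgn (planar (\<gamma> t)) = Complex (\<gamma> t $ 1 / sqrt (R t)) (\<gamma> t $ 3 / sqrt (R t))"
      unfolding sgn_div_norm normp by (simp add: complex_eq_iff planar_def divide_inverse mult.commute)
    moreover have "a * X t = \<gamma> t $ 1" "b * Z t = \<gamma> t $ 3"
      using a b by (auto simp: X_def Z_def)
    ultimately show ?thesis unfolding dir by (simp only: times_divide_eq_right)
  qed
  have img: "\<gamma> ` {0..1} = \<gamma> ` {0..<1}"
  proof (intro equalityI subsetI)
    fix v assume "v \<in> \<gamma> ` {0..1}"
    then obtain t where "t \<in> {0..1}" "v = \<gamma> t" by blast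
    then show "v \<in> \<gamma> ` {0..<1}" using per by (cases "t = 1") force+
  qed auto
  show ?thesis
  proof (rule star_shaped_unknot(2))
    show "compact (\<gamma> ` {0..1})" by (intro compact_continuous_image W22_cont[OF W]) auto
    show "planar v \<noteq> 0" if v: "v \<in> \<gamma> ` {0..1}" for v
    proof -
      from v obtain t where "v = \<gamma> t" by blast
      then have "norm (planar v) > 0" using Rpos[of t] by (simp add: normp)
      then show ?thesis by auto
    qed
    show "inj_on (\<lambda>v. sgn (planar v)) (\<gamma> ` {0..1})"
    proof (rule inj_onI)
      fix v w assume "v \<in> \<gamma> ` {0..1}" "w \<in> \<gamma> ` {0..1}" and eq: "sgn (planar v) = sgn (planar w)"
      then obtain s t where st: "s \<in> {0..<1}" "t \<in> {0..<1}" "v = \<gamma> s" "w = \<gamma> t" unfolding img by blast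
      have "sin (2 * pi * \<Theta> s) = sin (2 * pi * \<Theta> t)" "cos (2 * pi * \<Theta> s) = cos (2 * pi * \<Theta> t)"
        using eq a b unfolding st sg by auto
      moreover have "\<bar>\<Theta> s - \<Theta> t\<bar> < 1"
      proof -
        have "\<Theta> 0 \<le> \<Theta> x" "\<Theta> x < \<Theta> 0 + 1" if "x \<in> {0..<1}" for x
          using mono[of 0 x] mono[of x 1] that \<Theta>1 by (cases "x = 0"; force)+
        from this[of s] this[of t] show ?thesis using st by auto
      qed
      ultimately have "\<Theta> s = \<Theta> t" by (rule sin_cos_2pi_inj)
      then have "s = t" using mono by (metis less_irrefl linorder_neqE_linordered_idom)
      then show "v = w" using st by simp
    qed
    show "(\<lambda>v. sgn (planar v)) ` \<gamma> ` {0..1} = sphere 0 1"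
    proof (intro equalityI subsetI)
      fix u assume "u \<in> (\<lambda>v. sgn (planar v)) ` \<gamma> ` {0..1}"
      then obtain t where "u = sgn (planar (\<gamma> t))" by blast
      moreover have "norm (planar (\<gamma> t)) > 0" using Rpos[of t] by (simp add: normp)
      ultimately show "u \<in> sphere 0 1" by (auto simp: norm_sgn)
    next
      fix u :: complex assume "u \<in> sphere 0 1"
      then have "(Re u)\<^sup>2 + (Im u)\<^sup>2 = 1" using cmod_power2[of u] by simp
      then have "(a * Re u)\<^sup>2 + (b * Im u)\<^sup>2 = 1" using a b by auto
      then obtain \<psi> where \<psi>: "a * Re u = sin (2 * pi * \<psi>)" "b * Im u = cos (2 * pi * \<psi>)"
        by (rule circle_param)
      \<comment> \<open>Shifts the angle of \<open>u\<close> by whole turns into the range that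
        \<open>\<Theta>\<close> covers on one period.\<close>
      define n where "n = \<lceil>\<Theta> 0 - \<psi>\<rceil>"
      have "\<Theta> 0 \<le> \<psi> + of_int n" "\<psi> + of_int n \<le> \<Theta> 1"
        unfolding n_def \<Theta>1 by linarith+
      then obtain t where t: "0 \<le> t" "t \<le> 1" "\<Theta> t = \<psi> + of_int n"
        using IVT'[of \<Theta> 0 "\<psi> + of_int n" 1] \<Theta>c by auto
      have ang: "2 * pi * \<Theta> t = 2 * pi * \<psi> + of_int n * (2 * pi)" using t(3) by (simp add: algebra_simps)
      have "sin (2 * pi * \<Theta> t) = a * Re u" "cos (2 * pi * \<Theta> t) = b * Im u"
        unfolding \<psi> ang using sin_cos_eq_iff[of "2 * pi * \<psi> + of_int n * (2 * pi)" "2 * pi * \<psi>"]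
        by (metis mult.commute)+
      then have "sgn (planar (\<gamma> t)) = u" using a b unfolding sg by (auto simp: complex_eq_iff)
      then show "u \<in> (\<lambda>v. sgn (planar v)) ` \<gamma> ` {0..1}" using t by force
    qed
  qed
qed

section \<open>Stability under the dihedral symmetry\<close>

lemma D2_components:
  assumes "D2_symmetric \<gamma>"
  shows "\<gamma> (- t) $ 1 = - (\<gamma> t $ 1)" "\<gamma> (- t) $ 2 = - (\<gamma> t $ 2)" "\<gamma> (- t) $ 3 = \<gamma> t $ 3"
    and "\<gamma> (1/2 - t) $ 1 = \<gamma> t $ 1" "\<gamma> (1/2 - t) $ 2 = - (\<gamma> t $ 2)" "\<gamma> (1/2 - t) $ 3 = - (\<gamma> t $ 3)"
proof -
  have 3: "R3 (\<gamma> (- t)) = \<gamma> t" and 1: "R1 (\<gamma> (- t + 1/2)) = \<gamma> t"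
    using assms by (auto simp: D2_symmetric_def)
  show "\<gamma> (- t) $ 1 = - (\<gamma> t $ 1)" "\<gamma> (- t) $ 2 = - (\<gamma> t $ 2)" "\<gamma> (- t) $ 3 = \<gamma> t $ 3"
    unfolding 3[symmetric] by simp_all
  have e: "- t + 1/2 = 1/2 - t" by simp
  show "\<gamma> (1/2 - t) $ 1 = \<gamma> t $ 1" "\<gamma> (1/2 - t) $ 2 = - (\<gamma> t $ 2)" "\<gamma> (1/2 - t) $ 3 = - (\<gamma> t $ 3)"
    unfolding 1[symmetric] e by simp_all
qed

lemma bounded_linear_R: "bounded_linear R1" "bounded_linear R2" "bounded_linear R3"
  unfolding linear_conv_bounded_linear[symmetric]
  by (auto intro!: linearI simp: vec3_eq_iff)

lemma D2_d1_components:
  assumes "W22 \<gamma>" "D2_symmetric \<gamma>"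
  shows "d1 \<gamma> (- t) $ 1 = d1 \<gamma> t $ 1" "d1 \<gamma> (- t) $ 2 = d1 \<gamma> t $ 2" "d1 \<gamma> (- t) $ 3 = - (d1 \<gamma> t $ 3)"
    and "d1 \<gamma> (1/2 - t) $ 1 = - (d1 \<gamma> t $ 1)" "d1 \<gamma> (1/2 - t) $ 2 = d1 \<gamma> t $ 2" "d1 \<gamma> (1/2 - t) $ 3 = d1 \<gamma> t $ 3"
proof -
  have 3: "d1 \<gamma> t = (-1) *\<^sub>R R3 (d1 \<gamma> (-1 * t + 0))"
    by (rule W22_d1_transform[OF assms(1) bounded_linear_R(3)]) (use assms(2) in \<open>auto simp: D2_symmetric_def\<close>)
  have 1: "d1 \<gamma> t = (-1) *\<^sub>R R1 (d1 \<gamma> (-1 * t + 1/2))"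
    by (rule W22_d1_transform[OF assms(1) bounded_linear_R(1)]) (use assms(2) in \<open>auto simp: D2_symmetric_def\<close>)
  show "d1 \<gamma> (- t) $ 1 = d1 \<gamma> t $ 1" "d1 \<gamma> (- t) $ 2 = d1 \<gamma> t $ 2" "d1 \<gamma> (- t) $ 3 = - (d1 \<gamma> t $ 3)"
    unfolding 3 by simp_all
  have e: "-1 * t + 1/2 = 1/2 - t" by simp
  show "d1 \<gamma> (1/2 - t) $ 1 = - (d1 \<gamma> t $ 1)" "d1 \<gamma> (1/2 - t) $ 2 = d1 \<gamma> t $ 2" "d1 \<gamma> (1/2 - t) $ 3 = d1 \<gamma> t $ 3"
    unfolding 1 e by simp_all
qed

lemma D2_speed:
  assumes "W22 \<gamma>" "D2_symmetric \<gamma>"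
  shows "norm (d1 \<gamma> (- t)) = norm (d1 \<gamma> t)" "norm (d1 \<gamma> (1/2 - t)) = norm (d1 \<gamma> t)"
  unfolding norm3_eq D2_d1_components[OF assms] by simp_all

text \<open>The symmetries preserve speed, so arclength inherits them, and quarter points of the
  parameter are quarter points of the length in any parametrization.\<close>

lemma D2_arclen:
  assumes W: "W22 \<gamma>" and D: "D2_symmetric \<gamma>" and len: "curve_length \<gamma> = 1"
  shows "arclen \<gamma> (- t) = - arclen \<gamma> t" "arclen \<gamma> (1/2 - t) = 1/2 - arclen \<gamma> t"
    and "arclen \<gamma> (1/4) = 1/4" "arclen \<gamma> (1/2) = 1/2" "arclen \<gamma> (3/4) = 3/4" "arclen \<gamma> 1 = 1"
proof -
  have neg: "arclen \<gamma> (- t) = - arclen \<gamma> t" for t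
  proof -
    have "((\<lambda>t. arclen \<gamma> (- t) + arclen \<gamma> t) has_real_derivative norm (d1 \<gamma> (- x)) * (-1) + norm (d1 \<gamma> x)) (at x)" for x
      by (intro DERIV_add DERIV_chain2[OF arclen_deriv[OF W]] arclen_deriv[OF W] DERIV_minus DERIV_ident)
    then have "\<forall>x. DERIV (\<lambda>t. arclen \<gamma> (- t) + arclen \<gamma> t) x :> 0"
      using D2_speed[OF W D] by simp
    from DERIV_isconst_all[OF this, of t 0] show ?thesis by simp
  qed
  have half: "arclen \<gamma> (1/2 - t) + arclen \<gamma> t = arclen \<gamma> (1/2)" for t
  proof -
    have "((\<lambda>t. arclen \<gamma> (1/2 - t) + arclen \<gamma> t) has_real_derivative norm (d1 \<gamma> (1/2 - x)) * (0 - 1) + norm (d1 \<gamma> x)) (at x)" for x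
      by (intro DERIV_add DERIV_chain2[OF arclen_deriv[OF W]] arclen_deriv[OF W] DERIV_diff DERIV_const DERIV_ident)
    then have "\<forall>x. DERIV (\<lambda>t. arclen \<gamma> (1/2 - t) + arclen \<gamma> t) x :> 0"
      using D2_speed[OF W D] by simp
    from DERIV_isconst_all[OF this, of t 0] show ?thesis by simp
  qed
  show one: "arclen \<gamma> 1 = 1" by (simp add: arclen_1 len)
  show h: "arclen \<gamma> (1/2) = 1/2" using half[of "-1/2"] neg[of "1/2"] one by simp
  show "arclen \<gamma> (- t) = - arclen \<gamma> t" by (rule neg)
  show "arclen \<gamma> (1/2 - t) = 1/2 - arclen \<gamma> t" using half[of t] h by simp
  show q: "arclen \<gamma> (1/4) = 1/4" using half[of "1/4"] h by simp
  show "arclen \<gamma> (3/4) = 3/4" using half[of "-1/4"] neg[of "1/4"] h q by simp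
qed

text \<open>The maps t -> -t and t -> 1/2 - t generate a dihedral group on the line that contains
  the translation by 1/2 and has fundamental domain \<open>{0..1/4}\<close>.\<close>

lemma D2_extend:
  fixes P :: "real \<Rightarrow> bool"
  assumes quarter: "\<And>t. 0 \<le> t \<Longrightarrow> t \<le> 1/4 \<Longrightarrow> P t"
    and neg: "\<And>t. P t \<Longrightarrow> P (- t)" and half: "\<And>t. P t \<Longrightarrow> P (1/2 - t)"
  shows "P t"
proof -
  have 1: "P s" if "0 \<le> s" "s \<le> 1/2" for s
    using that quarter[of s] half[OF quarter, of "1/2 - s"] by (cases "s \<le> 1/4") auto
  have up: "P (s + real n / 2)" if "P s" for s n
  proof (induction n)
    case (Suc n)
    from half[OF neg[OF this]] show ?case by (simp add: field_simps)
  qed (use that in simp)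
  have down: "P (s - real n / 2)" if "P s" for s n
  proof (induction n)
    case (Suc n)
    have "- (1/2 - (s - real n / 2)) = s - real (Suc n) / 2" by (simp add: field_simps)
    with neg[OF half[OF Suc]] show ?case by (simp only:)
  qed (use that in simp)
  define n where "n = \<lfloor>2 * t\<rfloor>"
  define s where "s = t - of_int n / 2"
  have "of_int n \<le> 2 * t" "2 * t < of_int n + 1" unfolding n_def by linarith+
  then have s: "P s" by (intro 1) (auto simp: s_def)
  show ?thesis
  proof (cases "n \<ge> 0")
    case True
    then show ?thesis using up[OF s, of "nat n"] by (simp add: s_def)
  next
    case False
    then show ?thesis using down[OF s, of "nat (- n)"] by (simp add: s_def)
  qed
qed

text \<open>Components 1 and 3 vanish at an end of the quarter, which gives (2 pi)^2. Component 2
  has mean zero, because \<open>\<gamma> t $ 2\<close> takes equal values at the ends, which gives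
  (4 pi)^2. The masses add up to the length 1/4, so a quarter costs at least pi^2, a fourth of the
  global minimum.\<close>

lemma quarter_energy:
  assumes W: "W22 \<gamma>" "regular \<gamma>" and ab: "0 \<le> a" "a \<le> b" "b \<le> 1" and len: "arclen \<gamma> b - arclen \<gamma> a = 1/4"
    and z1: "d1 \<gamma> a $ 1 = 0 \<or> d1 \<gamma> b $ 1 = 0" and z3: "d1 \<gamma> a $ 3 = 0 \<or> d1 \<gamma> b $ 3 = 0"
    and y: "\<gamma> a $ 2 = \<gamma> b $ 2"
  shows "(2 * pi)\<^sup>2 * tmass \<gamma> 1 a b \<le> tdir \<gamma> 1 a b" "(2 * pi)\<^sup>2 * tmass \<gamma> 3 a b \<le> tdir \<gamma> 3 a b"
    and "(4 * pi)\<^sup>2 * tmass \<gamma> 2 a b \<le> tdir \<gamma> 2 a b" "tmass \<gamma> 2 a b \<ge> 0"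
    and "pi\<^sup>2 \<le> tdir \<gamma> 1 a b + tdir \<gamma> 2 a b + tdir \<gamma> 3 a b"
proof -
  interpret weight "\<lambda>t. norm (d1 \<gamma> t)" "arclen \<gamma>" by (rule arclen_weight[OF W])
  have H: "H1 (tangent \<gamma> i) (tangent' \<gamma> i) a b" for i
    by (rule H1_sub[OF tangent_H1[OF W] ab(1,3)])
  have ang: "2 * pi * (arclen \<gamma> b - arclen \<gamma> a) = pi/2" unfolding len by simp
  have one: "(2 * pi)\<^sup>2 * tmass \<gamma> i a b \<le> tdir \<gamma> i a b" if z: "d1 \<gamma> a $ i = 0 \<or> d1 \<gamma> b $ i = 0" for i
    using z
  proof
    assume "d1 \<gamma> a $ i = 0"
    then have "tangent \<gamma> i a = 0" by (simp add: tangent_def)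
    from Poincare_left[OF H this ab(2), of "2 * pi"] show ?thesis unfolding ang by (simp add: cot_def)
  next
    assume "d1 \<gamma> b $ i = 0"
    then have "tangent \<gamma> i b = 0" by (simp add: tangent_def)
    from Poincare_right[OF H this ab(2), of "2 * pi"] show ?thesis unfolding ang by (simp add: cot_def)
  qed
  show 1: "(2 * pi)\<^sup>2 * tmass \<gamma> 1 a b \<le> tdir \<gamma> 1 a b" by (rule one[OF z1])
  show 3: "(2 * pi)\<^sup>2 * tmass \<gamma> 3 a b \<le> tdir \<gamma> 3 a b" by (rule one[OF z3])
  show 2: "(4 * pi)\<^sup>2 * tmass \<gamma> 2 a b \<le> tdir \<gamma> 2 a b"
    using tangent_integral[OF W ab(2), of 2] y by (intro Poincare_mean_zero_quarter[OF H ab(2) len]) simp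
  show m2: "tmass \<gamma> 2 a b \<ge> 0" by (rule mass_nonneg[OF H1_cont[OF H]])
  have "(2 * pi)\<^sup>2 * tmass \<gamma> 2 a b \<le> (4 * pi)\<^sup>2 * tmass \<gamma> 2 a b"
    using m2 by (intro mult_right_mono power_mono) auto
  then have "(2 * pi)\<^sup>2 * (tmass \<gamma> 1 a b + tmass \<gamma> 2 a b + tmass \<gamma> 3 a b)
      \<le> tdir \<gamma> 1 a b + tdir \<gamma> 2 a b + tdir \<gamma> 3 a b"
    unfolding distrib_left using 1 2 3 by linarith
  then show "pi\<^sup>2 \<le> tdir \<gamma> 1 a b + tdir \<gamma> 2 a b + tdir \<gamma> 3 a b"
    unfolding tmass_sum[OF W ab(2)] len by (simp add: power_mult_distrib)
qed

lemma D2_zeros: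
  assumes "W22 \<gamma>" "D2_symmetric \<gamma>"
  shows "d1 \<gamma> (1/4) $ 1 = 0" "d1 \<gamma> (3/4) $ 1 = 0" "d1 \<gamma> 0 $ 3 = 0" "d1 \<gamma> (1/2) $ 3 = 0" "d1 \<gamma> 1 $ 3 = 0"
    and "\<gamma> 0 $ 1 = 0" "\<gamma> (1/4) $ 3 = 0"
    and "\<gamma> 0 $ 2 = 0" "\<gamma> (1/4) $ 2 = 0" "\<gamma> (1/2) $ 2 = 0" "\<gamma> (3/4) $ 2 = 0" "\<gamma> 1 $ 2 = 0"
proof -
  note c = D2_components[OF assms(2)] and d = D2_d1_components[OF assms]
  show x1: "d1 \<gamma> (1/4) $ 1 = 0" using d(4)[of "1/4"] by simp
  show "d1 \<gamma> (3/4) $ 1 = 0" using d(4)[of "-1/4"] d(1)[of "1/4"] x1 by simp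
  show z0: "d1 \<gamma> 0 $ 3 = 0" using d(3)[of 0] by simp
  show "d1 \<gamma> (1/2) $ 3 = 0" using d(6)[of 0] z0 by simp
  show "d1 \<gamma> 1 $ 3 = 0" using W22_d1_periodic[OF assms(1), of 0] z0 by simp
  show "\<gamma> 0 $ 1 = 0" using c(1)[of 0] by simp
  show "\<gamma> (1/4) $ 3 = 0" using c(6)[of "1/4"] by simp
  show y0: "\<gamma> 0 $ 2 = 0" using c(2)[of 0] by simp
  show y1: "\<gamma> (1/4) $ 2 = 0" using c(5)[of "1/4"] by simp
  show "\<gamma> (1/2) $ 2 = 0" using c(5)[of 0] y0 by simp
  show "\<gamma> (3/4) $ 2 = 0" using c(5)[of "-1/4"] c(2)[of "1/4"] y1 by simp
  show "\<gamma> 1 $ 2 = 0" using W22_periodic[OF assms(1), of 0] y0 by simp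
qed

text \<open>The other three quarters already cost pi^2 each, so the first has excess at most
  \<open>\<epsilon>\<close>. Since each component obeys its own sharp inequality there, no single
  component can exceed its bound by more than \<open>\<epsilon>\<close>.\<close>

lemma D2_quarter_stability:
  assumes W: "W22 \<gamma>" "regular \<gamma>" and D: "D2_symmetric \<gamma>" and len: "curve_length \<gamma> = 1"
    and \<epsilon>: "0 \<le> \<epsilon>" and E: "bending \<gamma> \<le> ennreal ((2 * pi)\<^sup>2 + \<epsilon>)"
    and t: "0 \<le> t" "t \<le> 1/4"
  shows "(tangent \<gamma> 1 t - tangent \<gamma> 1 0 * cos (2 * pi * arclen \<gamma> t))\<^sup>2 \<le> \<epsilon>"
    and "(tangent \<gamma> 3 t - tangent \<gamma> 3 (1/4) * sin (2 * pi * arclen \<gamma> t))\<^sup>2 \<le> \<epsilon>"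
    and "(tangent \<gamma> 2 t)\<^sup>2 \<le> \<epsilon>"
proof -
  interpret weight "\<lambda>t. norm (d1 \<gamma> t)" "arclen \<gamma>" by (rule arclen_weight[OF W])
  note arcs = D2_arclen(3-6)[OF W(1) D len] and zs = D2_zeros[OF W(1) D]
  define e where "e a b = tdir \<gamma> 1 a b + tdir \<gamma> 2 a b + tdir \<gamma> 3 a b" for a b
  have H01: "H1 (tangent \<gamma> i) (tangent' \<gamma> i) 0 1" for i by (rule tangent_H1[OF W])
  have sp: "e a c = e a b + e b c" if "0 \<le> a" "a \<le> b" "b \<le> c" "c \<le> 1" for a b c
    using dirichlet_split[OF H1_sub[OF H01 that(1,4)] that(2,3)] by (simp add: e_def)
  have "ennreal (e 0 1) \<le> ennreal ((2 * pi)\<^sup>2 + \<epsilon>)" using E unfolding bending_eq[OF W] e_def .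
  then have E': "e 0 1 \<le> (2 * pi)\<^sup>2 + \<epsilon>" using \<epsilon> by (subst (asm) ennreal_le_iff) auto
  have "pi\<^sup>2 \<le> e (1/4) (1/2)" "pi\<^sup>2 \<le> e (1/2) (3/4)" "pi\<^sup>2 \<le> e (3/4) 1"
    unfolding e_def by (rule quarter_energy(5)[OF W]; use arcs zs in simp)+
  moreover have "e 0 1 = e 0 (1/4) + e (1/4) (1/2) + e (1/2) (3/4) + e (3/4) 1"
    using sp[of 0 "1/4" 1] sp[of "1/4" "1/2" 1] sp[of "1/2" "3/4" 1] by simp
  ultimately have q: "e 0 (1/4) \<le> pi\<^sup>2 + \<epsilon>" using E' by (simp add: power_mult_distrib)
  have "(2 * pi)\<^sup>2 * (tmass \<gamma> 1 0 (1/4) + tmass \<gamma> 2 0 (1/4) + tmass \<gamma> 3 0 (1/4)) = pi\<^sup>2"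
    unfolding tmass_sum[OF W, of 0 "1/4", simplified] by (simp add: arcs power_mult_distrib)
  then have q': "e 0 (1/4) \<le> (2 * pi)\<^sup>2 * tmass \<gamma> 1 0 (1/4) + (2 * pi)\<^sup>2 * tmass \<gamma> 2 0 (1/4)
      + (2 * pi)\<^sup>2 * tmass \<gamma> 3 0 (1/4) + \<epsilon>"
    using q by (simp add: algebra_simps)
  have qe: "(2 * pi)\<^sup>2 * tmass \<gamma> 1 0 (1/4) \<le> tdir \<gamma> 1 0 (1/4)" "(2 * pi)\<^sup>2 * tmass \<gamma> 3 0 (1/4) \<le> tdir \<gamma> 3 0 (1/4)"
    "(4 * pi)\<^sup>2 * tmass \<gamma> 2 0 (1/4) \<le> tdir \<gamma> 2 0 (1/4)" "tmass \<gamma> 2 0 (1/4) \<ge> 0"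
    by (rule quarter_energy[OF W]; use arcs zs in simp)+
  \<comment> \<open>The mass term of component 2 uses up at most a quarter of its Dirichlet
    integral; the rest counts as excess.\<close>
  have four: "(2 * pi)\<^sup>2 * tmass \<gamma> 2 0 (1/4) \<le> tdir \<gamma> 2 0 (1/4) / 4"
    using qe(3) by (simp add: power_mult_distrib)
  have t2: "tdir \<gamma> 2 0 (1/4) \<ge> 0" by (rule dirichlet_nonneg[OF H1_sub[OF H01]]) auto
  have b1: "tdir \<gamma> 1 0 (1/4) \<le> (2 * pi)\<^sup>2 * tmass \<gamma> 1 0 (1/4) + \<epsilon>"
    and b3: "tdir \<gamma> 3 0 (1/4) \<le> (2 * pi)\<^sup>2 * tmass \<gamma> 3 0 (1/4) + \<epsilon>"
    and b2: "tdir \<gamma> 2 0 (1/4) * (1/4) \<le> \<epsilon>"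
    using q' qe four t2 \<epsilon> unfolding e_def by linarith+
  have H: "H1 (tangent \<gamma> i) (tangent' \<gamma> i) 0 (1/4)" for i by (rule H1_sub[OF H01]) auto
  have w: "2 * pi \<ge> 1" using pi_gt3 by simp
  have ang: "2 * pi * (arclen \<gamma> (1/4) - arclen \<gamma> 0) = pi/2" by (simp add: arcs)
  have "(tangent \<gamma> 1 t - tangent \<gamma> 1 0 * sin (2 * pi * (arclen \<gamma> (1/4) - arclen \<gamma> t)))\<^sup>2 \<le> \<epsilon>"
    by (rule sine_stability_right[OF H _ w ang b1 t]) (simp add: tangent_def zs)
  moreover have "2 * pi * (arclen \<gamma> (1/4) - arclen \<gamma> t) = pi/2 - 2 * pi * arclen \<gamma> t" by (simp add: arcs algebra_simps)
  ultimately show "(tangent \<gamma> 1 t - tangent \<gamma> 1 0 * cos (2 * pi * arclen \<gamma> t))\<^sup>2 \<le> \<epsilon>"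
    by (simp add: cos_sin_eq)
  have "(tangent \<gamma> 3 t - tangent \<gamma> 3 (1/4) * sin (2 * pi * (arclen \<gamma> t - arclen \<gamma> 0)))\<^sup>2 \<le> \<epsilon>"
    by (rule sine_stability_left[OF H _ w ang b3 t]) (simp add: tangent_def zs)
  then show "(tangent \<gamma> 3 t - tangent \<gamma> 3 (1/4) * sin (2 * pi * arclen \<gamma> t))\<^sup>2 \<le> \<epsilon>" by simp
  \<comment> \<open>\<open>\<gamma> t $ 2\<close> vanishes at both ends of the quarter, so its
    derivative has a zero in between; starting from that zero, the small Dirichlet integral bounds
    component 2 uniformly.\<close>
  have "\<exists>z. 0 < z \<and> z < 1/4 \<and> DERIV (\<lambda>t. \<gamma> t $ 2) z :> 0"
    by (rule Rolle) (use zs W22_deriv_component[OF W(1)] in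
      \<open>auto intro!: continuous_intros W22_cont[OF W(1)] simp: real_differentiable_def\<close>)
  then obtain z where z: "0 < z" "z < 1/4" "DERIV (\<lambda>t. \<gamma> t $ 2) z :> 0" by blast
  then have "d1 \<gamma> z $ 2 = 0" using DERIV_unique[OF W22_deriv_component[OF W(1)]] by blast
  then have "(tangent \<gamma> 2 t)\<^sup>2 \<le> tdir \<gamma> 2 0 (1/4) * (arclen \<gamma> (1/4) - arclen \<gamma> 0)"
    using z t by (intro H1_bound_from_zero[OF H, of z]) (auto simp: tangent_def)
  also have "\<dots> \<le> \<epsilon>" using b2 by (simp add: arcs)
  finally show "(tangent \<gamma> 2 t)\<^sup>2 \<le> \<epsilon>" .
qed

lemma (in weight) increment_le:
  assumes d: "\<And>t. t \<in> {a..b} \<Longrightarrow> (f has_real_derivative f' t) (at t)" and "a \<le> b"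
    and le: "\<And>t. t \<in> {a..b} \<Longrightarrow> \<bar>f' t\<bar> \<le> e * l t"
  shows "\<bar>f b - f a\<bar> \<le> e * (\<sigma> b - \<sigma> a)"
proof -
  have I: "(f' has_integral f b - f a) {a..b}"
    by (rule fundamental_theorem_of_calculus[OF \<open>a \<le> b\<close>])
      (use d in \<open>auto simp flip: has_real_derivative_iff_has_vector_derivative intro: has_field_derivative_at_within\<close>)
  have J: "((\<lambda>t. e * l t) has_integral e * (\<sigma> b - \<sigma> a)) {a..b}"
    by (intro has_integral_mult_right l_integral \<open>a \<le> b\<close>)
  have "f b - f a \<le> e * (\<sigma> b - \<sigma> a)"
    by (rule has_integral_le[OF I J]) (use le in \<open>force simp: abs_le_iff\<close>)
  moreover have "- (f b - f a) \<le> e * (\<sigma> b - \<sigma> a)"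
    by (rule has_integral_le[OF has_integral_neg[OF I] J]) (use le in \<open>force simp: abs_le_iff\<close>)
  ultimately show ?thesis by linarith
qed

text \<open>The amplitudes are tangent values at the ends where the cosine or sine is 1. There the
  other planar component vanishes and component 2 is at most \<open>e\<close>, so their squares are
  within e^2 of 1. Positions are integrated in arclength, over at most 1/4, from the end where they
  vanish.\<close>

lemma D2_almost_circle:
  assumes W: "W22 \<gamma>" "regular \<gamma>" and D: "D2_symmetric \<gamma>" and len: "curve_length \<gamma> = 1"
    and e: "0 \<le> e" and E: "bending \<gamma> \<le> ennreal ((2 * pi)\<^sup>2 + e\<^sup>2)"
  obtains A B where "1 - e\<^sup>2 \<le> A\<^sup>2" "A\<^sup>2 \<le> 1" "1 - e\<^sup>2 \<le> B\<^sup>2" "B\<^sup>2 \<le> 1"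
    and "\<And>t. 0 \<le> t \<Longrightarrow> t \<le> 1/4 \<Longrightarrow>
      \<bar>tangent \<gamma> 1 t - A * cos (2 * pi * arclen \<gamma> t)\<bar> \<le> e \<and>
      \<bar>tangent \<gamma> 3 t + B * sin (2 * pi * arclen \<gamma> t)\<bar> \<le> e \<and>
      \<bar>\<gamma> t $ 1 - A * sin (2 * pi * arclen \<gamma> t) / (2 * pi)\<bar> \<le> e / 4 \<and>
      \<bar>\<gamma> t $ 2\<bar> \<le> e / 4 \<and>
      \<bar>\<gamma> t $ 3 - B * cos (2 * pi * arclen \<gamma> t) / (2 * pi)\<bar> \<le> e / 4"
proof -
  interpret weight "\<lambda>t. norm (d1 \<gamma> t)" "arclen \<gamma>" by (rule arclen_weight[OF W])
  note arcs = D2_arclen(3-6)[OF W(1) D len] and zs = D2_zeros[OF W(1) D]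
  \<comment> \<open>The minus sign lets the third coordinate, a primitive of the third tangent
    component, follow \<open>B\<close> times a cosine.\<close>
  define A B where "A = tangent \<gamma> 1 0" and "B = - tangent \<gamma> 3 (1/4)"
  have st: "\<bar>tangent \<gamma> 1 t - A * cos (2 * pi * arclen \<gamma> t)\<bar> \<le> e" "\<bar>tangent \<gamma> 3 t + B * sin (2 * pi * arclen \<gamma> t)\<bar> \<le> e"
    "\<bar>tangent \<gamma> 2 t\<bar> \<le> e" if "0 \<le> t" "t \<le> 1/4" for t
    using D2_quarter_stability[OF W D len zero_le_power2 E that] power2_le_iff_abs_le[OF e]
    by (auto simp: A_def B_def)
  have lpos: "norm (d1 \<gamma> t) > 0" for t using W by (simp add: regular_def)
  have ts: "(tangent \<gamma> 1 t)\<^sup>2 + (tangent \<gamma> 2 t)\<^sup>2 + (tangent \<gamma> 3 t)\<^sup>2 = 1" for t by (rule tangent_sum[OF lpos])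
  have sq: "(tangent \<gamma> 2 t)\<^sup>2 \<le> e\<^sup>2" if "0 \<le> t" "t \<le> 1/4" for t
    using st(3)[OF that] by (metis abs_le_square_iff abs_of_nonneg e)
  have A: "1 - e\<^sup>2 \<le> A\<^sup>2" "A\<^sup>2 \<le> 1"
  proof -
    have "tangent \<gamma> 3 0 = 0" by (simp add: tangent_def zs)
    then have "A\<^sup>2 + (tangent \<gamma> 2 0)\<^sup>2 = 1" using ts[of 0] by (simp add: A_def)
    then show "1 - e\<^sup>2 \<le> A\<^sup>2" "A\<^sup>2 \<le> 1" using sq[of 0] by (auto, smt (verit) zero_le_power2)
  qed
  have B: "1 - e\<^sup>2 \<le> B\<^sup>2" "B\<^sup>2 \<le> 1"
  proof -
    have "tangent \<gamma> 1 (1/4) = 0" by (simp add: tangent_def zs)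
    then have "B\<^sup>2 + (tangent \<gamma> 2 (1/4))\<^sup>2 = 1" using ts[of "1/4"] by (simp add: B_def)
    then show "1 - e\<^sup>2 \<le> B\<^sup>2" "B\<^sup>2 \<le> 1" using sq[of "1/4"] by (auto, smt (verit) zero_le_power2)
  qed
  have angd: "((\<lambda>t. 2 * pi * arclen \<gamma> t) has_real_derivative 2 * pi * norm (d1 \<gamma> t)) (at t)" for t
    by (intro DERIV_cmult arclen_deriv W)
  have pos: "\<bar>\<gamma> t $ 1 - A * sin (2 * pi * arclen \<gamma> t) / (2 * pi)\<bar> \<le> e / 4 \<and> \<bar>\<gamma> t $ 2\<bar> \<le> e / 4 \<and>
      \<bar>\<gamma> t $ 3 - B * cos (2 * pi * arclen \<gamma> t) / (2 * pi)\<bar> \<le> e / 4" if t: "0 \<le> t" "t \<le> 1/4" for t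
  proof -
    define f where "f t = \<gamma> t $ 1 - A * sin (2 * pi * arclen \<gamma> t) / (2 * pi)" for t
    define g where "g t = \<gamma> t $ 3 - B * cos (2 * pi * arclen \<gamma> t) / (2 * pi)" for t
    have fd: "(f has_real_derivative (tangent \<gamma> 1 t - A * cos (2 * pi * arclen \<gamma> t)) * norm (d1 \<gamma> t)) (at t)" for t
    proof -
      have "(f has_real_derivative d1 \<gamma> t $ 1 - A * (cos (2 * pi * arclen \<gamma> t) * (2 * pi * norm (d1 \<gamma> t))) / (2 * pi)) (at t)"
        unfolding f_def
        by (intro DERIV_diff W22_deriv_component W DERIV_cdivide DERIV_cmult DERIV_chain2[OF DERIV_sin] angd)
      then show ?thesis using d1_eq_tangent[OF lpos, where i=1 and t=t] by (simp add: algebra_simps)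
    qed
    have gd: "(g has_real_derivative (tangent \<gamma> 3 t + B * sin (2 * pi * arclen \<gamma> t)) * norm (d1 \<gamma> t)) (at t)" for t
    proof -
      have "(g has_real_derivative d1 \<gamma> t $ 3 - B * (- sin (2 * pi * arclen \<gamma> t) * (2 * pi * norm (d1 \<gamma> t))) / (2 * pi)) (at t)"
        unfolding g_def
        by (intro DERIV_diff W22_deriv_component W DERIV_cdivide DERIV_cmult DERIV_chain2[OF DERIV_cos] angd)
      then show ?thesis using d1_eq_tangent[OF lpos, where i=3 and t=t] by (simp add: algebra_simps)
    qed
    have yd: "((\<lambda>t. \<gamma> t $ 2) has_real_derivative tangent \<gamma> 2 t * norm (d1 \<gamma> t)) (at t)" for t
      using W22_deriv_component[OF W(1), of 2 t] by (simp add: d1_eq_tangent[OF lpos, where i=2, symmetric])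
    have a0: "0 \<le> arclen \<gamma> t" "arclen \<gamma> t \<le> 1/4" using \<sigma>_le[of 0 t] \<sigma>_le[of t "1/4"] t arcs by auto
    have "\<bar>f t - f 0\<bar> \<le> e * (arclen \<gamma> t - arclen \<gamma> 0)"
      by (rule increment_le[OF fd]) (use t st(1) in \<open>auto simp: abs_mult mult_right_mono\<close>)
    moreover have "\<bar>\<gamma> t $ 2 - \<gamma> 0 $ 2\<bar> \<le> e * (arclen \<gamma> t - arclen \<gamma> 0)"
      by (rule increment_le[OF yd]) (use t st(3) in \<open>auto simp: abs_mult mult_right_mono\<close>)
    moreover have "e * (arclen \<gamma> t - arclen \<gamma> 0) \<le> e * (1/4)" using e a0 by (intro mult_left_mono) auto
    moreover have "\<bar>g (1/4) - g t\<bar> \<le> e * (arclen \<gamma> (1/4) - arclen \<gamma> t)"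
      by (rule increment_le[OF gd]) (use t st(2) in \<open>auto simp: abs_mult mult_right_mono\<close>)
    moreover have "e * (arclen \<gamma> (1/4) - arclen \<gamma> t) \<le> e * (1/4)" using e a0 arcs by (intro mult_left_mono) auto
    moreover have "f 0 = 0" "g (1/4) = 0" by (simp_all add: f_def g_def zs arcs)
    ultimately show ?thesis using zs unfolding f_def[symmetric] g_def[symmetric] by auto
  qed
  show thesis by (rule that[OF A B]) (use st pos in blast)
qed

text \<open>Perturbation estimates behind the hypotheses of \<open>star_shaped_curve_unknot\<close>,
  with \<open>k\<close> standing for 1/(2 pi). For the first sign a main term of at least 9/80 faces
  errors of at most 2/40. For the second, at least 81/800 faces at most 22/400 + 2/60, about 0.088.
  The signs \<open>a\<close> and \<open>b\<close> reduce everything to positive amplitudes.\<close>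

lemma near_circle_signs:
  fixes a b A B S C x z X Z k :: real
  assumes a: "a = 1 \<or> a = -1" and b: "b = 1 \<or> b = -1"
    and A: "9/10 \<le> a * A" "a * A \<le> 1" and B: "9/10 \<le> b * B" "b * B \<le> 1"
    and k: "1/8 \<le> k" "k \<le> 1/6" and SC: "S\<^sup>2 + C\<^sup>2 = 1"
    and X: "\<bar>X - A * C\<bar> \<le> 1/10" and Z: "\<bar>Z + B * S\<bar> \<le> 1/10"
    and x: "\<bar>x - A * S * k\<bar> \<le> 1/40" and z: "\<bar>z - B * C * k\<bar> \<le> 1/40"
  shows "a * x * S + b * z * C > 0" "a * b * (X * z - x * Z) > 0"
proof -
  have S: "\<bar>S\<bar> \<le> 1" and C: "\<bar>C\<bar> \<le> 1"
    using SC by (simp_all add: abs_square_le_1[symmetric]) (smt (verit) zero_le_power2)+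
  have aabs: "\<bar>a * u\<bar> = \<bar>u\<bar>" "\<bar>b * u\<bar> = \<bar>u\<bar>" for u using a b by auto
  define A1 B1 x1 z1 X1 Z1 where "A1 = a * A" and "B1 = b * B" and "x1 = a * x" and "z1 = b * z"
    and "X1 = a * X" and "Z1 = b * Z"
  have X1: "\<bar>X1 - A1 * C\<bar> \<le> 1/10" and x1: "\<bar>x1 - A1 * S * k\<bar> \<le> 1/40"
    using X x aabs(1)[of "X - A * C"] aabs(1)[of "x - A * S * k"]
    by (simp_all add: X1_def x1_def A1_def algebra_simps)
  have Z1: "\<bar>Z1 + B1 * S\<bar> \<le> 1/10" and z1: "\<bar>z1 - B1 * C * k\<bar> \<le> 1/40"
    using Z z aabs(2)[of "Z + B * S"] aabs(2)[of "z - B * C * k"]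
    by (simp_all add: Z1_def z1_def B1_def algebra_simps)
  have AB: "9/10 \<le> A1" "A1 \<le> 1" "9/10 \<le> B1" "B1 \<le> 1" using A B by (auto simp: A1_def B1_def)
  have prod: "\<bar>u * v\<bar> \<le> c * d" if "\<bar>u\<bar> \<le> c" "\<bar>v\<bar> \<le> d" for u v c d :: real
    unfolding abs_mult using that by (intro mult_mono) auto
  have p1: "\<bar>(x1 - A1 * S * k) * S\<bar> \<le> 1/40 * 1" by (rule prod[OF x1 S])
  have p2: "\<bar>(z1 - B1 * C * k) * C\<bar> \<le> 1/40 * 1" by (rule prod[OF z1 C])
  have low: "9/10 * (S\<^sup>2 + C\<^sup>2) \<le> A1 * S\<^sup>2 + B1 * C\<^sup>2"
    unfolding distrib_left using AB by (intro add_mono mult_right_mono) auto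
  have "9/10 * (1/8) \<le> (A1 * S\<^sup>2 + B1 * C\<^sup>2) * k"
    using low k unfolding SC by (intro mult_mono) auto
  moreover have "x1 * S + z1 * C = (A1 * S\<^sup>2 + B1 * C\<^sup>2) * k + (x1 - A1 * S * k) * S + (z1 - B1 * C * k) * C"
    by (simp add: algebra_simps power2_eq_square)
  ultimately have "x1 * S + z1 * C > 0" using p1 p2 by linarith
  then show "a * x * S + b * z * C > 0" by (simp add: x1_def z1_def)
  have AC: "\<bar>A1 * C\<bar> \<le> 1 * 1" "\<bar>B1 * S\<bar> \<le> 1 * 1" "\<bar>B1 * C\<bar> \<le> 1 * 1" "\<bar>A1 * S\<bar> \<le> 1 * 1"
    using AB S C by (intro prod; simp)+
  have k': "\<bar>k\<bar> \<le> 1/6" using k by simp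
  have "\<bar>X1\<bar> \<le> 11/10" "\<bar>Z1\<bar> \<le> 11/10" using X1 Z1 AC by linarith+
  then have q: "\<bar>X1 * (z1 - B1 * C * k)\<bar> \<le> 11/10 * (1/40)" "\<bar>Z1 * (x1 - A1 * S * k)\<bar> \<le> 11/10 * (1/40)"
    using x1 z1 by (intro prod; simp)+
  have r: "\<bar>(X1 - A1 * C) * (B1 * C * k)\<bar> \<le> 1/10 * (1 * 1 * (1/6))" "\<bar>(Z1 + B1 * S) * (A1 * S * k)\<bar> \<le> 1/10 * (1 * 1 * (1/6))"
    by (rule prod[OF X1 prod[OF AC(3) k']], rule prod[OF Z1 prod[OF AC(4) k']])
  have "81/100 \<le> A1 * B1" using mult_mono[of "9/10" A1 "9/10" B1] AB by simp
  then have "81/100 * (1/8) \<le> A1 * B1 * k" using k by (intro mult_mono) auto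
  moreover have "X1 * z1 - x1 * Z1 = A1 * B1 * k * (S\<^sup>2 + C\<^sup>2) + X1 * (z1 - B1 * C * k)
      + (X1 - A1 * C) * (B1 * C * k) - Z1 * (x1 - A1 * S * k) - (Z1 + B1 * S) * (A1 * S * k)"
    by (simp add: algebra_simps power2_eq_square)
  ultimately have "X1 * z1 - x1 * Z1 > 0" using q r unfolding SC by linarith
  then show "a * b * (X * z - x * Z) > 0" by (simp add: X1_def x1_def Z1_def z1_def algebra_simps)
qed

lemma inverse_2pi_bounds: "1/8 \<le> 1 / (2 * pi)" "1 / (2 * pi) \<le> 1/6"
  using pi_gt3 pi_less_4 by (auto simp: field_simps)

text \<open>An excess of (1/10)^2 gives amplitudes of modulus at least 9/10, tangent errors 1/10 and
  position errors 1/40, the tolerances of \<open>near_circle_signs\<close>. Both sign conditions are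
  invariant under the symmetries, so the first quarter suffices.\<close>

lemma D2_low_energy_unknot:
  assumes W: "W22 \<gamma>" "regular \<gamma>" and D: "D2_symmetric \<gamma>" and len: "curve_length \<gamma> = 1"
    and E: "bending \<gamma> \<le> ennreal ((2 * pi)\<^sup>2 + (1/10)\<^sup>2)"
  shows "knot_class_of (\<gamma> ` {0..1}) = unknot"
proof -
  obtain A B where A: "1 - (1/10)\<^sup>2 \<le> A\<^sup>2" "A\<^sup>2 \<le> 1" and B: "1 - (1/10)\<^sup>2 \<le> B\<^sup>2" "B\<^sup>2 \<le> 1"
    and st: "\<And>t. 0 \<le> t \<Longrightarrow> t \<le> 1/4 \<Longrightarrow>
      \<bar>tangent \<gamma> 1 t - A * cos (2 * pi * arclen \<gamma> t)\<bar> \<le> 1/10 \<and>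
      \<bar>tangent \<gamma> 3 t + B * sin (2 * pi * arclen \<gamma> t)\<bar> \<le> 1/10 \<and>
      \<bar>\<gamma> t $ 1 - A * sin (2 * pi * arclen \<gamma> t) / (2 * pi)\<bar> \<le> 1/10 / 4 \<and>
      \<bar>\<gamma> t $ 2\<bar> \<le> 1/10 / 4 \<and>
      \<bar>\<gamma> t $ 3 - B * cos (2 * pi * arclen \<gamma> t) / (2 * pi)\<bar> \<le> 1/10 / 4"
    by (rule D2_almost_circle[OF W D len _ E]) auto
  define a b :: real where "a = (if A > 0 then 1 else -1)" and "b = (if B > 0 then 1 else -1)"
  have ab: "a = 1 \<or> a = -1" "b = 1 \<or> b = -1" by (auto simp: a_def b_def)
  have abs9: "9/10 \<le> \<bar>u\<bar> \<and> \<bar>u\<bar> \<le> 1" if "1 - (1/10)\<^sup>2 \<le> u\<^sup>2" "u\<^sup>2 \<le> 1" for u :: real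
  proof -
    have "(9/10)\<^sup>2 \<le> \<bar>u\<bar>\<^sup>2" using that(1) by (simp add: power2_eq_square)
    then have "9/10 \<le> \<bar>u\<bar>" by (rule power2_le_imp_le) simp
    moreover have "\<bar>u\<bar> \<le> 1" using that(2) by (simp add: abs_square_le_1)
    ultimately show ?thesis by simp
  qed
  have aA: "a * A = \<bar>A\<bar>" "b * B = \<bar>B\<bar>" by (auto simp: a_def b_def)
  define p where "p t = a * \<gamma> t $ 1 * sin (2 * pi * arclen \<gamma> t) + b * \<gamma> t $ 3 * cos (2 * pi * arclen \<gamma> t)" for t
  define J where "J t = a * b * (d1 \<gamma> t $ 1 * \<gamma> t $ 3 - \<gamma> t $ 1 * d1 \<gamma> t $ 3)" for t
  note sym = D2_components[OF D] D2_d1_components[OF W(1) D] D2_arclen(1,2)[OF W(1) D len]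
  have ang: "2 * pi * (1/2 - s) = pi - 2 * pi * s" for s by (simp add: algebra_simps)
  have pJ: "p t > 0 \<and> J t > 0" for t
  proof (rule D2_extend[where P="\<lambda>t. p t > 0 \<and> J t > 0"])
    fix t :: real assume t: "0 \<le> t" "t \<le> 1/4"
    have lp: "norm (d1 \<gamma> t) > 0" using W by (simp add: regular_def)
    have q: "a * \<gamma> t $ 1 * sin (2 * pi * arclen \<gamma> t) + b * \<gamma> t $ 3 * cos (2 * pi * arclen \<gamma> t) > 0"
      "a * b * (tangent \<gamma> 1 t * \<gamma> t $ 3 - \<gamma> t $ 1 * tangent \<gamma> 3 t) > 0"
      by (rule near_circle_signs[where A=A and B=B and k="1 / (2 * pi)" and S="sin (2 * pi * arclen \<gamma> t)"
            and C="cos (2 * pi * arclen \<gamma> t)" and X="tangent \<gamma> 1 t" and Z="tangent \<gamma> 3 t"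
            and a=a and b=b and x="\<gamma> t $ 1" and z="\<gamma> t $ 3"];
          use ab aA abs9[OF A] abs9[OF B] inverse_2pi_bounds st[OF t] in simp)+
    have "J t = a * b * (tangent \<gamma> 1 t * \<gamma> t $ 3 - \<gamma> t $ 1 * tangent \<gamma> 3 t) * norm (d1 \<gamma> t)"
      unfolding J_def d1_eq_tangent[OF lp] by (simp add: algebra_simps)
    then show "p t > 0 \<and> J t > 0" using q lp by (simp add: p_def)
  qed (simp_all add: p_def J_def sym ang)
  show ?thesis
    by (rule star_shaped_curve_unknot[OF W(1) ab arclen_deriv[OF W(1)]])
      (use pJ D2_arclen(6)[OF W(1) D len] in \<open>auto simp: p_def J_def\<close>)
qed

section \<open>Circles compatible with the symmetry\<close>

definition signed_circ :: "real \<Rightarrow> real \<Rightarrow> real \<Rightarrow> real^3" where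
  "signed_circ a b t = vector [a * sin (2 * pi * t) / (2 * pi), 0, b * cos (2 * pi * t) / (2 * pi)]"

text \<open>A signed permutation of the coordinates carries \<open>circ\<close> to
  \<open>signed_circ a b\<close> with the same parameter.\<close>

lemma signed_circ_once_covered:
  assumes "a\<^sup>2 = 1" "b\<^sup>2 = 1" "\<And>t. \<Gamma> t = signed_circ a b t"
  shows "is_once_covered_circle \<Gamma>"
  unfolding is_once_covered_circle_def
proof (intro exI conjI allI)
  show "isometry3 (\<lambda>v. vector [a * v$2, v$3, b * v$1])"
    unfolding isometry3_def
  proof (intro allI)
    fix x y :: "real^3"
    have "(a * x$2 - a * y$2)\<^sup>2 = a\<^sup>2 * (x$2 - y$2)\<^sup>2" "(b * x$1 - b * y$1)\<^sup>2 = b\<^sup>2 * (x$1 - y$1)\<^sup>2"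
      by (simp_all add: power2_eq_square algebra_simps)
    then show "dist (vector [a * x$2, x$3, b * x$1] :: real^3) (vector [a * y$2, y$3, b * y$1]) = dist x y"
      using assms(1,2) by (simp add: dist_norm norm3_eq)
  qed
  show "reparam (\<lambda>t. t)" by (auto simp: reparam_def strict_mono_def continuous_on_id)
  show "\<Gamma> t = vector [a * circ t $ 2, circ t $ 3, b * circ t $ 1]" for t
    by (simp add: assms(3) signed_circ_def circ_def)
qed

lemma arclen_arclength: "arclength \<gamma> \<Longrightarrow> arclen \<gamma> t = t"
  by (simp add: arclen_def arclength_def)

lemma arclength_regular: "arclength \<gamma> \<Longrightarrow> regular \<gamma>"
  by (simp add: arclength_def regular_def)

text \<open>For \<open>e = 0\<close> all errors in \<open>D2_almost_circle\<close> vanish on the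
  first quarter, and the resulting formula has the same symmetries as the curve.\<close>

lemma D2_minimal_energy_circle:
  assumes W: "W22 \<gamma>" and al: "arclength \<gamma>" and D: "D2_symmetric \<gamma>"
    and E: "bending \<gamma> \<le> ennreal ((2 * pi)\<^sup>2)"
  obtains a b where "a\<^sup>2 = 1" "b\<^sup>2 = 1" "\<And>t. \<gamma> t = signed_circ a b t"
proof -
  have len: "curve_length \<gamma> = 1" using al by (simp add: curve_length_def arclength_def)
  obtain A B where A: "1 - 0\<^sup>2 \<le> A\<^sup>2" "A\<^sup>2 \<le> 1" and B: "1 - 0\<^sup>2 \<le> B\<^sup>2" "B\<^sup>2 \<le> 1"
    and st: "\<And>t. 0 \<le> t \<Longrightarrow> t \<le> 1/4 \<Longrightarrow>
      \<bar>tangent \<gamma> 1 t - A * cos (2 * pi * arclen \<gamma> t)\<bar> \<le> 0 \<and>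
      \<bar>tangent \<gamma> 3 t + B * sin (2 * pi * arclen \<gamma> t)\<bar> \<le> 0 \<and>
      \<bar>\<gamma> t $ 1 - A * sin (2 * pi * arclen \<gamma> t) / (2 * pi)\<bar> \<le> 0 / 4 \<and>
      \<bar>\<gamma> t $ 2\<bar> \<le> 0 / 4 \<and>
      \<bar>\<gamma> t $ 3 - B * cos (2 * pi * arclen \<gamma> t) / (2 * pi)\<bar> \<le> 0 / 4"
    by (rule D2_almost_circle[OF W arclength_regular[OF al] D len order_refl]) (use E in auto)
  have ang: "2 * pi * (1/2 - s) = pi - 2 * pi * s" for s by (simp add: algebra_simps)
  have "\<gamma> t = signed_circ A B t" for t
  proof (rule D2_extend[where P="\<lambda>t. \<gamma> t = signed_circ A B t"])
    fix t :: real assume "0 \<le> t" "t \<le> 1/4"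
    from st[OF this] show "\<gamma> t = signed_circ A B t"
      by (simp add: arclen_arclength[OF al] signed_circ_def vec3_eq_iff)
  qed (simp_all add: vec3_eq_iff D2_components[OF D] signed_circ_def ang)
  then show thesis using that[of A B] A B by simp
qed

text \<open>Rotating the solution back by the angle \<open>c * t\<close> gives the constants
  \<open>P\<close> and \<open>Q\<close>, in place of a uniqueness theorem for differential
  equations.\<close>

lemma rotation_ode:
  fixes \<alpha> \<beta> :: "real \<Rightarrow> real"
  assumes a: "\<And>t. (\<alpha> has_real_derivative - c * \<beta> t) (at t)"
    and b: "\<And>t. (\<beta> has_real_derivative c * \<alpha> t) (at t)"
  shows "\<alpha> t = \<alpha> 0 * cos (c * t) - \<beta> 0 * sin (c * t)" "\<beta> t = \<beta> 0 * cos (c * t) + \<alpha> 0 * sin (c * t)"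
proof -
  define P where "P t = \<alpha> t * cos (c * t) + \<beta> t * sin (c * t)" for t
  define Q where "Q t = \<beta> t * cos (c * t) - \<alpha> t * sin (c * t)" for t
  have cd: "((\<lambda>t. cos (c * t)) has_real_derivative - sin (c * t) * (c * 1)) (at t)"
    and sd: "((\<lambda>t. sin (c * t)) has_real_derivative cos (c * t) * (c * 1)) (at t)" for t
    by (intro DERIV_chain2[OF DERIV_cos] DERIV_chain2[OF DERIV_sin] DERIV_cmult DERIV_ident)+
  have "(P has_real_derivative (- c * \<beta> t) * cos (c * t) + (- sin (c * t) * (c * 1)) * \<alpha> t
      + ((c * \<alpha> t) * sin (c * t) + (cos (c * t) * (c * 1)) * \<beta> t)) (at t)" for t
    unfolding P_def by (intro DERIV_add DERIV_mult a b cd sd)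
  then have "\<forall>t. DERIV P t :> 0" by (simp add: algebra_simps)
  from DERIV_isconst_all[OF this, of t 0] have P: "P t = \<alpha> 0" by (simp add: P_def)
  have "(Q has_real_derivative (c * \<alpha> t) * cos (c * t) + (- sin (c * t) * (c * 1)) * \<beta> t
      - ((- c * \<beta> t) * sin (c * t) + (cos (c * t) * (c * 1)) * \<alpha> t)) (at t)" for t
    unfolding Q_def by (intro DERIV_diff DERIV_mult a b cd sd)
  then have "\<forall>t. DERIV Q t :> 0" by (simp add: algebra_simps)
  from DERIV_isconst_all[OF this, of t 0] have Q: "Q t = \<beta> 0" by (simp add: Q_def)
  have sc: "cos (c * t) * cos (c * t) + sin (c * t) * sin (c * t) = 1"
    using sin_cos_squared_add[of "c * t"] by (simp add: power2_eq_square)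
  have "\<alpha> 0 * cos (c * t) - \<beta> 0 * sin (c * t) = \<alpha> t * (cos (c * t) * cos (c * t) + sin (c * t) * sin (c * t))"
    unfolding P[symmetric] Q[symmetric] P_def Q_def by (simp only: algebra_simps)
  then show "\<alpha> t = \<alpha> 0 * cos (c * t) - \<beta> 0 * sin (c * t)" by (simp add: sc)
  have "\<beta> 0 * cos (c * t) + \<alpha> 0 * sin (c * t) = \<beta> t * (cos (c * t) * cos (c * t) + sin (c * t) * sin (c * t))"
    unfolding P[symmetric] Q[symmetric] P_def Q_def by (simp only: algebra_simps)
  then show "\<beta> t = \<beta> 0 * cos (c * t) + \<alpha> 0 * sin (c * t)" by (simp add: sc)
qed

text \<open>The reparametrization in \<open>is_once_covered_circle\<close> is merely continuous, so
  the trigonometric form is recovered from unit speed: a C^1 unit speed curve on a circle of radius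
  1/(2 pi) has constant angular momentum and solves a rotation equation. The symmetry then fixes the
  center and the axes.\<close>

lemma D2_circle_normal_form:
  assumes circle: "is_once_covered_circle \<Gamma>" and W: "W22 \<Gamma>" and al: "arclength \<Gamma>" and D: "D2_symmetric \<Gamma>"
  obtains a b where "a = 1 \<or> a = -1" "b = 1 \<or> b = -1" "\<And>t. \<Gamma> t = signed_circ a b t"
proof -
  obtain f \<phi> where iso: "isometry3 f" and \<Gamma>: "\<And>t. \<Gamma> t = f (circ (\<phi> t))"
    using circle unfolding is_once_covered_circle_def by blast
  define c0 where "c0 = f 0"
  define L where "L x = f x - c0" for x
  have "orthogonal_transformation L"
    unfolding orthogonal_transformation_isometry using iso by (simp add: L_def c0_def isometry3_def dist_norm)
  then have lin: "linear L" and inn: "\<And>x y. L x \<bullet> L y = x \<bullet> y"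
    by (auto simp: orthogonal_transformation_def)
  define e1 e2 where "e1 = L (axis 1 1)" and "e2 = L (axis 2 1)"
  have e: "e1 \<bullet> e1 = 1" "e2 \<bullet> e2 = 1" "e1 \<bullet> e2 = 0"
    unfolding e1_def e2_def inn by (simp_all add: inner3 axis_def)
  define \<alpha> \<beta> where "\<alpha> t = circ (\<phi> t) $ 1" and "\<beta> t = circ (\<phi> t) $ 2" for t
  have decomp: "\<Gamma> t = c0 + \<alpha> t *\<^sub>R e1 + \<beta> t *\<^sub>R e2" for t
  proof -
    have "circ (\<phi> t) = \<alpha> t *\<^sub>R axis 1 1 + \<beta> t *\<^sub>R axis 2 1"
      by (simp add: \<alpha>_def \<beta>_def circ_def vec3_eq_iff axis_def)
    then have "L (circ (\<phi> t)) = \<alpha> t *\<^sub>R e1 + \<beta> t *\<^sub>R e2"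
      by (simp add: linear_add[OF lin] linear_cmul[OF lin] e1_def e2_def)
    then show ?thesis by (simp add: \<Gamma> L_def algebra_simps)
  qed
  have rad: "(\<alpha> t)\<^sup>2 + (\<beta> t)\<^sup>2 = (1 / (2 * pi))\<^sup>2" for t
    by (simp add: \<alpha>_def \<beta>_def circ_def power_divide add_divide_distrib[symmetric])
  \<comment> \<open>As inner products with the curve the planar coordinates are differentiable,
    although \<open>circ (\<phi> t)\<close> is not known to be.\<close>
  have \<alpha>eq: "\<alpha> t = (\<Gamma> t - c0) \<bullet> e1" and \<beta>eq: "\<beta> t = (\<Gamma> t - c0) \<bullet> e2" for t
    using e by (simp_all add: decomp inner_add_left inner_commute[of e2 e1])
  define \<alpha>' \<beta>' where "\<alpha>' t = d1 \<Gamma> t \<bullet> e1" and "\<beta>' t = d1 \<Gamma> t \<bullet> e2" for t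
  have inner_deriv: "((\<lambda>t. (\<Gamma> t - c0) \<bullet> v) has_real_derivative d1 \<Gamma> t \<bullet> v) (at t)" for v t
    using bounded_linear.has_vector_derivative[OF bounded_linear_inner_left
        has_vector_derivative_diff[OF W22_deriv[OF W] has_vector_derivative_const[of c0]]]
    by (simp add: has_real_derivative_iff_has_vector_derivative)
  have \<alpha>d: "(\<alpha> has_real_derivative \<alpha>' t) (at t)" and \<beta>d: "(\<beta> has_real_derivative \<beta>' t) (at t)" for t
    unfolding \<alpha>'_def \<beta>'_def using inner_deriv[of e1 t] inner_deriv[of e2 t]
    unfolding \<alpha>eq[symmetric] \<beta>eq[symmetric] by simp_all
  have speed: "(\<alpha>' t)\<^sup>2 + (\<beta>' t)\<^sup>2 = 1" for t
  proof -
    have sc: "((\<lambda>t. h t *\<^sub>R v) has_vector_derivative h' *\<^sub>R v) (at t)"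
      if "(h has_real_derivative h') (at t)" for h h' and v :: "real^3"
      using has_vector_derivative_scaleR[OF that has_vector_derivative_const[of v]] by simp
    have "((\<lambda>t. c0 + \<alpha> t *\<^sub>R e1 + \<beta> t *\<^sub>R e2) has_vector_derivative 0 + \<alpha>' t *\<^sub>R e1 + \<beta>' t *\<^sub>R e2) (at t)"
      by (intro has_vector_derivative_add has_vector_derivative_const sc \<alpha>d \<beta>d)
    then have "d1 \<Gamma> t = \<alpha>' t *\<^sub>R e1 + \<beta>' t *\<^sub>R e2"
      unfolding decomp[symmetric] by (simp add: has_vector_derivative_d1)
    then have "d1 \<Gamma> t \<bullet> d1 \<Gamma> t = (\<alpha>' t)\<^sup>2 + (\<beta>' t)\<^sup>2"
      using e by (simp add: inner_add_left inner_add_right inner_commute[of e2 e1] power2_eq_square)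
    moreover have "d1 \<Gamma> t \<bullet> d1 \<Gamma> t = 1" using al by (simp add: arclength_def dot_square_norm)
    ultimately show ?thesis by simp
  qed
  have orth: "\<alpha> t * \<alpha>' t + \<beta> t * \<beta>' t = 0" for t
  proof -
    have "((\<lambda>t. \<alpha> t * \<alpha> t + \<beta> t * \<beta> t) has_real_derivative \<alpha>' t * \<alpha> t + \<alpha>' t * \<alpha> t + (\<beta>' t * \<beta> t + \<beta>' t * \<beta> t)) (at t)"
      by (intro DERIV_add DERIV_mult \<alpha>d \<beta>d)
    moreover have "(\<lambda>t. \<alpha> t * \<alpha> t + \<beta> t * \<beta> t) = (\<lambda>t. (1 / (2 * pi))\<^sup>2)"
      using rad by (simp add: power2_eq_square)
    ultimately have "\<alpha>' t * \<alpha> t + \<alpha>' t * \<alpha> t + (\<beta>' t * \<beta> t + \<beta>' t * \<beta> t) = 0"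
      using DERIV_unique DERIV_const by metis
    then show ?thesis by (simp add: algebra_simps)
  qed
  \<comment> \<open>Angular momentum. Its modulus is radius times speed by Lagrange's identity;
    continuity excludes a change of sign.\<close>
  define J where "J t = \<alpha> t * \<beta>' t - \<beta> t * \<alpha>' t" for t
  have J2: "(J t)\<^sup>2 = (1 / (2 * pi))\<^sup>2" for t
  proof -
    have "(J t)\<^sup>2 + (\<alpha> t * \<alpha>' t + \<beta> t * \<beta>' t)\<^sup>2 = ((\<alpha> t)\<^sup>2 + (\<beta> t)\<^sup>2) * ((\<alpha>' t)\<^sup>2 + (\<beta>' t)\<^sup>2)"
      by (simp add: J_def power2_eq_square algebra_simps)
    then show ?thesis by (simp add: orth rad speed)
  qed
  have Jc: "continuous_on UNIV J"
  proof -
    have "continuous_on UNIV \<alpha>" "continuous_on UNIV \<beta>"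
      using \<alpha>d \<beta>d by (meson DERIV_isCont continuous_at_imp_continuous_on)+
    moreover have "continuous_on UNIV \<alpha>'" "continuous_on UNIV \<beta>'"
      unfolding \<alpha>'_def \<beta>'_def by (intro continuous_intros W22_d1_cont W)+
    ultimately show ?thesis unfolding J_def by (intro continuous_intros)
  qed
  have Jpm: "J t = 1 / (2 * pi) \<or> J t = - (1 / (2 * pi))" for t
    using J2[of t] by (simp add: power2_eq_iff)
  have Jconst: "J t = J 0" for t
  proof (rule ccontr)
    assume ne: "J t \<noteq> J 0"
    have pp: "1 / (2 * pi) > 0" by simp
    have "\<exists>s. J s = 0"
    proof -
      have "connected (J ` UNIV)" by (intro connected_continuous_image Jc) auto
      moreover have "min (J 0) (J t) \<in> J ` UNIV" "max (J 0) (J t) \<in> J ` UNIV" by (auto simp: min_def max_def)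
      moreover have "min (J 0) (J t) \<le> 0" "0 \<le> max (J 0) (J t)" using Jpm[of 0] Jpm[of t] ne pp by auto
      ultimately have "0 \<in> J ` UNIV" by (meson connectedD_interval)
      then show ?thesis by force
    qed
    then obtain s where "J s = 0" by blast
    then show False using Jpm[of s] pp by auto
  qed
  define \<kappa> where "\<kappa> = 2 * pi * J 0"
  have \<kappa>: "\<kappa> = 1 \<or> \<kappa> = -1" using Jpm[of 0] by (auto simp: \<kappa>_def)
  have J\<kappa>: "J t = \<kappa> / (2 * pi)" for t using Jconst[of t] by (simp add: \<kappa>_def)
  have r2: "\<alpha> t * \<alpha> t + \<beta> t * \<beta> t = (1 / (2 * pi))\<^sup>2" for t using rad[of t] by (simp add: power2_eq_square)
  have der: "\<alpha>' t = - (2 * pi * \<kappa>) * \<beta> t" "\<beta>' t = (2 * pi * \<kappa>) * \<alpha> t" for t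
  proof -
    have o: "\<alpha> t * \<alpha>' t = - (\<beta> t * \<beta>' t)" using orth[of t] by simp
    have "\<alpha>' t * (\<alpha> t * \<alpha> t + \<beta> t * \<beta> t) = \<alpha> t * (\<alpha> t * \<alpha>' t) + \<beta> t * (\<beta> t * \<alpha>' t)" by (simp add: algebra_simps)
    also have "\<dots> = - \<beta> t * J t" unfolding o by (simp add: J_def algebra_simps)
    finally have "\<alpha>' t * (1 / (2 * pi))\<^sup>2 = - \<beta> t * (\<kappa> / (2 * pi))" unfolding r2 J\<kappa> .
    then show "\<alpha>' t = - (2 * pi * \<kappa>) * \<beta> t" by (simp add: field_simps power2_eq_square)
    have o': "\<beta> t * \<beta>' t = - (\<alpha> t * \<alpha>' t)" using orth[of t] by simp
    have "\<beta>' t * (\<alpha> t * \<alpha> t + \<beta> t * \<beta> t) = \<alpha> t * (\<alpha> t * \<beta>' t) + \<beta> t * (\<beta> t * \<beta>' t)" by (simp add: algebra_simps)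
    also have "\<dots> = \<alpha> t * J t" unfolding o' by (simp add: J_def algebra_simps)
    finally have "\<beta>' t * (1 / (2 * pi))\<^sup>2 = \<alpha> t * (\<kappa> / (2 * pi))" unfolding r2 J\<kappa> .
    then show "\<beta>' t = (2 * pi * \<kappa>) * \<alpha> t" by (simp add: field_simps power2_eq_square)
  qed
  have trig: "cos (2 * pi * \<kappa> * t) = cos (2 * pi * t)" "sin (2 * pi * \<kappa> * t) = \<kappa> * sin (2 * pi * t)" for t
    using \<kappa> by auto
  have sol: "\<alpha> t = \<alpha> 0 * cos (2 * pi * t) - \<beta> 0 * (\<kappa> * sin (2 * pi * t))"
    "\<beta> t = \<beta> 0 * cos (2 * pi * t) + \<alpha> 0 * (\<kappa> * sin (2 * pi * t))" for t
    using rotation_ode[of \<alpha> "2 * pi * \<kappa>" \<beta> t] \<alpha>d \<beta>d unfolding der trig by blast+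
  define V U where "V = \<alpha> 0 *\<^sub>R e1 + \<beta> 0 *\<^sub>R e2" and "U = \<kappa> *\<^sub>R (\<alpha> 0 *\<^sub>R e2 - \<beta> 0 *\<^sub>R e1)"
  have form: "\<Gamma> t = c0 + cos (2 * pi * t) *\<^sub>R V + sin (2 * pi * t) *\<^sub>R U" for t
    unfolding decomp[of t] sol[of t] V_def U_def
    by (simp add: algebra_simps)
  \<comment> \<open>Half a period reflects the circle in its center, and \<open>R2\<close> undoes a
    shift by half a period. Together they put the first and third coordinates of the center at 0;
    the second follows from \<open>\<Gamma> 0 $ 2 = 0\<close>.\<close>
  have anti: "\<Gamma> (t - 1/2) = 2 *\<^sub>R c0 - \<Gamma> t" for t
  proof -
    have a: "2 * pi * (t - 1/2) = 2 * pi * t - pi" by (simp add: algebra_simps)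
    show ?thesis unfolding form[of "t - 1/2"] form[of t] a by (simp add: scaleR_2)
  qed
  have R2: "R2 (2 *\<^sub>R c0 - \<Gamma> t) = \<Gamma> t" for t using D unfolding D2_symmetric_def anti by blast
  note zs = D2_zeros[OF W D]
  have c0: "c0 = 0"
  proof -
    have "R2 (2 *\<^sub>R c0 - \<Gamma> 0) $ i = \<Gamma> 0 $ i" for i by (simp only: R2)
    from this[of 1] this[of 2] this[of 3] show ?thesis using zs(8) by (simp add: vec3_eq_iff)
  qed
  have V: "\<Gamma> 0 = V" using form[of 0] c0 by simp
  have U: "\<Gamma> (1/4) = U" using form[of "1/4"] c0 by simp
  have nrm: "norm (\<Gamma> t) = 1 / (2 * pi)" for t
  proof -
    have "(norm (\<Gamma> t))\<^sup>2 = (\<alpha> t)\<^sup>2 + (\<beta> t)\<^sup>2"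
      unfolding decomp[of t] c0 power2_norm_eq_inner using e
      by (simp add: inner_add_left inner_add_right inner_commute[of e2 e1] power2_eq_square)
    then show ?thesis unfolding rad by (simp add: power2_eq_iff_nonneg)
  qed
  define a b where "a = 2 * pi * \<Gamma> (1/4) $ 1" and "b = 2 * pi * \<Gamma> 0 $ 3"
  have "(norm (\<Gamma> 0))\<^sup>2 = (\<Gamma> 0 $ 3)\<^sup>2" using zs by (simp add: norm3_squared)
  then have "b\<^sup>2 = 1" unfolding nrm by (simp add: b_def power_mult_distrib power_divide field_simps)
  moreover have "(norm (\<Gamma> (1/4)))\<^sup>2 = (\<Gamma> (1/4) $ 1)\<^sup>2" using zs by (simp add: norm3_squared)
  then have "a\<^sup>2 = 1" unfolding nrm by (simp add: a_def power_mult_distrib power_divide field_simps)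
  moreover have "\<Gamma> t = signed_circ a b t" for t
    unfolding form[of t] c0 V[symmetric] U[symmetric]
    using zs by (simp add: signed_circ_def vec3_eq_iff a_def b_def)
  ultimately show thesis using that by (simp add: power2_eq_1_iff)
qed

section \<open>Elastic knots and the circle\<close>

lemma ennpowr_mono:
  assumes "x \<le> y" "0 \<le> a" shows "ennpowr x a \<le> ennpowr y a"
proof (cases "y = \<infinity>")
  case False
  then have "x \<noteq> \<infinity>" using assms(1) by (auto simp: top_unique)
  moreover have "enn2real x \<le> enn2real y"
    using assms(1) False by (intro enn2real_mono) (auto simp: top.not_eq_extremum)
  ultimately show ?thesis using False assms(2)
    by (auto simp: ennpowr_def intro!: ennreal_leI powr_mono2)
qed (simp add: ennpowr_def)

lemma Cset_D:
  assumes "\<gamma> \<in> Cset \<K>"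
  shows "W22 \<gamma>" "curve_length \<gamma> = 1" "regular \<gamma>" "inj_on \<gamma> {0..<1}" "\<gamma> ` {0..1} \<in> \<K>"
  using assms by (auto simp: Cset_def)

lemma circ_xz_in_Cset: "circ_xz \<in> Cset unknot"
  by (simp add: Cset_def W22_circ_xz curve_length_circ_xz regular_circ_xz inj_circ_xz circ_xz_in_unknot)

lemma E_theta_ge:
  assumes "\<gamma> \<in> Cset \<K>" "2 < q"
  shows "bending \<gamma> + ennreal \<theta> * ennpowr (ennreal ((2 * pi) powr q)) (1 / (q - 2)) \<le> E_theta q \<theta> \<gamma>"
  unfolding E_theta_def using assms TP_ge[of \<gamma> q] Cset_D[OF assms(1)]
  by (intro add_mono order_refl mult_left_mono ennpowr_mono) auto

lemma E_theta_circ_xz_le: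
  assumes "2 < q"
  shows "E_theta q \<theta> circ_xz \<le> ennreal ((2 * pi)\<^sup>2) + ennreal \<theta> * ennpowr (ennreal ((2 * pi) powr q)) (1 / (q - 2))"
  unfolding E_theta_def bending_circ_xz using assms TP_circ_xz_le[of q]
  by (intro add_mono order_refl mult_left_mono ennpowr_mono) auto

lemma circ_xz_minimizer:
  assumes "2 < q" shows "sym_minimizer q unknot \<theta> circ_xz"
  unfolding sym_minimizer_def
proof (intro conjI ballI impI arclength_circ_xz D2_symmetric_circ_xz circ_xz_in_Cset)
  fix \<beta> assume \<beta>: "\<beta> \<in> Cset unknot"
  note E_theta_circ_xz_le[OF assms, of \<theta>]
  also have "ennreal ((2 * pi)\<^sup>2) + ennreal \<theta> * ennpowr (ennreal ((2 * pi) powr q)) (1 / (q - 2))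
      \<le> bending \<beta> + ennreal \<theta> * ennpowr (ennreal ((2 * pi) powr q)) (1 / (q - 2))"
    using bending_ge Cset_D[OF \<beta>] by (intro add_mono order_refl) auto
  also note E_theta_ge[OF \<beta> assms, of \<theta>]
  finally show "E_theta q \<theta> circ_xz \<le> E_theta q \<theta> \<beta>" .
qed

text \<open>The circle attains the lower bound of the tangent-point term. That bound is finite, so
  it cancels when the minimizer is compared with the circle.\<close>

lemma minimizer_bending:
  assumes q: "2 < q" and m: "sym_minimizer q unknot \<theta> \<Gamma>"
  shows "bending \<Gamma> \<le> ennreal ((2 * pi)\<^sup>2)"
proof -
  define T where "T = ennreal \<theta> * ennpowr (ennreal ((2 * pi) powr q)) (1 / (q - 2))"
  have T: "T \<noteq> \<infinity>" by (simp add: T_def ennpowr_def ennreal_mult_eq_top_iff)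
  have "bending \<Gamma> + T \<le> E_theta q \<theta> \<Gamma>"
    unfolding T_def using m by (intro E_theta_ge[OF _ q, of _ unknot]) (simp add: sym_minimizer_def)
  also have "\<dots> \<le> E_theta q \<theta> circ_xz"
    using m circ_xz_in_Cset D2_symmetric_circ_xz by (simp add: sym_minimizer_def)
  also have "\<dots> \<le> ennreal ((2 * pi)\<^sup>2) + T"
    unfolding T_def by (rule E_theta_circ_xz_le[OF q])
  finally show ?thesis using T by (simp add: ennreal_add_left_cancel_le add.commute[of _ T])
qed

text \<open>The circle minimizes for every parameter, so the constant sequence serves for any
  positive parameters tending to 0.\<close>

lemma elastic_unknot_exists:
  assumes "2 < q" shows "D2_elastic_knot q unknot circ_xz"
  unfolding D2_elastic_knot_def
proof (intro conjI exI allI)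
  show "tame_knot_class unknot" by (rule tame_unknot)
  show "\<exists>\<beta>\<in>Cset unknot. D2_symmetric \<beta>" using circ_xz_in_Cset D2_symmetric_circ_xz by blast
  show "(0::real) < inverse (real (Suc k))" for k by simp
  show "(\<lambda>k. inverse (real (Suc k))) \<longlonglongrightarrow> 0" by (rule LIMSEQ_inverse_real_of_nat)
  show "sym_minimizer q unknot (inverse (real (Suc k))) circ_xz" for k by (rule circ_xz_minimizer[OF assms])
  show "weak_W22_conv (\<lambda>k. circ_xz) circ_xz" by (simp add: weak_W22_conv_def)
  show "C1_conv (\<lambda>k. circ_xz) circ_xz" by (simp add: C1_conv_def uniform_limit_const)
qed (rule W22_circ_xz, rule arclength_circ_xz)

lemma C1_conv_pointwise:
  assumes "C1_conv \<Gamma> \<Gamma>0" shows "(\<lambda>k. \<Gamma> k t) \<longlonglongrightarrow> \<Gamma>0 t"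
  using assms unfolding C1_conv_def by (blast intro: tendsto_uniform_limitI)

text \<open>Each minimizer is one of four signed circles, and its signs can be read from the points
  at parameters 1/4 and 0. Pointwise convergence of the curves therefore makes the signs converge,
  and the limit has the same form.\<close>

lemma elastic_unknot_circle:
  assumes q: "2 < q" and E: "D2_elastic_knot q unknot \<Gamma>0"
  shows "is_once_covered_circle \<Gamma>0"
proof -
  obtain \<theta> \<Gamma> where min: "\<And>k. sym_minimizer q unknot (\<theta> k) (\<Gamma> k)" and conv: "C1_conv \<Gamma> \<Gamma>0"
    using E unfolding D2_elastic_knot_def by blast
  have "\<exists>a b. a\<^sup>2 = 1 \<and> b\<^sup>2 = 1 \<and> (\<forall>t. \<Gamma> k t = signed_circ a b t)" for k
  proof -
    have m: "W22 (\<Gamma> k)" "arclength (\<Gamma> k)" "D2_symmetric (\<Gamma> k)"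
      using min[of k] Cset_D(1) by (auto simp: sym_minimizer_def)
    show ?thesis by (rule D2_minimal_energy_circle[OF m minimizer_bending[OF q min]]) blast
  qed
  then obtain a b where ab: "\<And>k. (a k)\<^sup>2 = 1" "\<And>k. (b k)\<^sup>2 = 1" and \<Gamma>: "\<And>k t. \<Gamma> k t = signed_circ (a k) (b k) t"
    by metis
  have lim: "(\<lambda>k. signed_circ (a k) (b k) t $ i) \<longlonglongrightarrow> \<Gamma>0 t $ i" for t i
    using tendsto_vec_nth[OF C1_conv_pointwise[OF conv, of t], of i] unfolding \<Gamma> .
  define A B where "A = 2 * pi * \<Gamma>0 (1/4) $ 1" and "B = 2 * pi * \<Gamma>0 0 $ 3"
  have aA: "a \<longlonglongrightarrow> A"
    using tendsto_mult_left[OF lim[of "1/4" 1], of "2 * pi"] by (simp add: signed_circ_def A_def)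
  have bB: "b \<longlonglongrightarrow> B"
    using tendsto_mult_left[OF lim[of 0 3], of "2 * pi"] by (simp add: signed_circ_def B_def)
  have "(\<lambda>k. (a k)\<^sup>2) \<longlonglongrightarrow> A\<^sup>2" "(\<lambda>k. (b k)\<^sup>2) \<longlonglongrightarrow> B\<^sup>2" by (intro tendsto_intros aA bB)+
  then have AB: "A\<^sup>2 = 1" "B\<^sup>2 = 1" unfolding ab by (simp_all add: LIMSEQ_const_iff)
  have "\<Gamma>0 t = signed_circ A B t" for t
  proof -
    have "(\<lambda>k. a k * sin (2 * pi * t) / (2 * pi)) \<longlonglongrightarrow> A * sin (2 * pi * t) / (2 * pi)"
      "(\<lambda>k. b k * cos (2 * pi * t) / (2 * pi)) \<longlonglongrightarrow> B * cos (2 * pi * t) / (2 * pi)"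
      by (intro tendsto_intros aA bB; simp)+
    then have "(\<lambda>k. signed_circ (a k) (b k) t $ 1) \<longlonglongrightarrow> signed_circ A B t $ 1"
      "(\<lambda>k. signed_circ (a k) (b k) t $ 2) \<longlonglongrightarrow> signed_circ A B t $ 2"
      "(\<lambda>k. signed_circ (a k) (b k) t $ 3) \<longlonglongrightarrow> signed_circ A B t $ 3"
      unfolding signed_circ_def vector3_component by auto
    then show ?thesis unfolding vec3_eq_iff using LIMSEQ_unique[OF lim] by blast
  qed
  then show ?thesis by (rule signed_circ_once_covered[OF AB])
qed

text \<open>The symmetry survives pointwise limits, and a symmetric circle is a
  \<open>signed_circ a b\<close>, centered at the origin in the xz-plane. A minimizer close to it in
  C^1 satisfies \<open>star_shaped_curve_unknot\<close> with the identity as phase, and this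
  minimizer represents the class.\<close>

lemma elastic_circle_unknot:
  assumes K: "tame_knot_class \<K>" and E: "D2_elastic_knot q \<K> \<Gamma>0" and circle: "is_once_covered_circle \<Gamma>0"
  shows "\<K> = unknot"
proof -
  obtain \<theta> \<Gamma> where min: "\<And>k. sym_minimizer q \<K> (\<theta> k) (\<Gamma> k)" and conv: "C1_conv \<Gamma> \<Gamma>0"
    and W0: "W22 \<Gamma>0" "arclength \<Gamma>0"
    using E unfolding D2_elastic_knot_def by blast
  have D: "D2_symmetric (\<Gamma> k)" for k using min[of k] by (simp add: sym_minimizer_def)
  have Rlim: "R (\<Gamma>0 (\<psi> t)) = \<Gamma>0 t"
    if R: "bounded_linear R" and eq: "\<And>k. R (\<Gamma> k (\<psi> t)) = \<Gamma> k t" for R :: "real^3 \<Rightarrow> real^3" and \<psi> :: "real \<Rightarrow> real" and t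
    using bounded_linear.tendsto[OF R C1_conv_pointwise[OF conv, of "\<psi> t"]] C1_conv_pointwise[OF conv, of t]
    unfolding eq by (rule LIMSEQ_unique)
  have D0: "D2_symmetric \<Gamma>0"
    unfolding D2_symmetric_def
    using Rlim[OF bounded_linear_R(1), of "\<lambda>t. - t + 1/2"] Rlim[OF bounded_linear_R(2), of "\<lambda>t. t - 1/2"]
      Rlim[OF bounded_linear_R(3), of "\<lambda>t. - t"] D unfolding D2_symmetric_def by blast
  obtain a b where a: "a = 1 \<or> a = -1" and b: "b = 1 \<or> b = -1" and \<Gamma>0: "\<And>t. \<Gamma>0 t = signed_circ a b t"
    using D2_circle_normal_form[OF circle W0 D0] by blast
  have d1: "d1 \<Gamma>0 t = vector [a * cos (2 * pi * t), 0, - b * sin (2 * pi * t)]" for t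
  proof -
    have "\<Gamma>0 = signed_circ a b" using \<Gamma>0 by blast
    moreover have "(signed_circ a b has_vector_derivative vector [a * cos (2 * pi * t), 0, - b * sin (2 * pi * t)]) (at t)"
      unfolding signed_circ_def by (rule has_vector_derivative_vector3) (auto intro!: derivative_eq_intros)
    ultimately show ?thesis by (simp add: has_vector_derivative_d1)
  qed
  have "\<forall>\<^sub>F k in sequentially. \<forall>t\<in>UNIV. dist (\<Gamma> k t) (\<Gamma>0 t) < 1/40"
    "\<forall>\<^sub>F k in sequentially. \<forall>t\<in>UNIV. dist (d1 (\<Gamma> k) t) (d1 \<Gamma>0 t) < 1/40"
    by (rule uniform_limitD; use conv in \<open>simp add: C1_conv_def\<close>)+
  then have "\<forall>\<^sub>F k in sequentially. \<forall>t. dist (\<Gamma> k t) (\<Gamma>0 t) < 1/40 \<and> dist (d1 (\<Gamma> k) t) (d1 \<Gamma>0 t) < 1/40"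
    by eventually_elim auto
  \<comment> \<open>1/40 is the position tolerance of \<open>near_circle_signs\<close>; for
    derivatives it is stricter than the 1/10 asked for there.\<close>
  then obtain k where "\<forall>t. dist (\<Gamma> k t) (\<Gamma>0 t) < 1/40 \<and> dist (d1 (\<Gamma> k) t) (d1 \<Gamma>0 t) < 1/40"
    using eventually_happens'[OF sequentially_bot] by blast
  then have close: "norm (\<Gamma> k t - \<Gamma>0 t) < 1/40" "norm (d1 (\<Gamma> k) t - d1 \<Gamma>0 t) < 1/40" for t
    by (auto simp: dist_norm)
  have comp: "\<bar>\<Gamma> k t $ i - \<Gamma>0 t $ i\<bar> \<le> 1/40" "\<bar>d1 (\<Gamma> k) t $ i - d1 \<Gamma>0 t $ i\<bar> \<le> 1/40" for t i
    using component_le_norm_cart[of "\<Gamma> k t - \<Gamma>0 t" i] component_le_norm_cart[of "d1 (\<Gamma> k) t - d1 \<Gamma>0 t" i] close[of t]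
    by simp_all
  have k: "\<Gamma> k \<in> Cset \<K>" using min[of k] by (simp add: sym_minimizer_def)
  have pJ: "a * \<Gamma> k t $ 1 * sin (2 * pi * t) + b * \<Gamma> k t $ 3 * cos (2 * pi * t) > 0"
    "a * b * (d1 (\<Gamma> k) t $ 1 * \<Gamma> k t $ 3 - \<Gamma> k t $ 1 * d1 (\<Gamma> k) t $ 3) > 0" for t
  proof -
    have c: "\<bar>d1 (\<Gamma> k) t $ 1 - a * cos (2 * pi * t)\<bar> \<le> 1/10" "\<bar>d1 (\<Gamma> k) t $ 3 + b * sin (2 * pi * t)\<bar> \<le> 1/10"
      "\<bar>\<Gamma> k t $ 1 - a * sin (2 * pi * t) * (1 / (2 * pi))\<bar> \<le> 1/40" "\<bar>\<Gamma> k t $ 3 - b * cos (2 * pi * t) * (1 / (2 * pi))\<bar> \<le> 1/40"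
      using comp(2)[of t 1] comp(2)[of t 3] comp(1)[of t 1] comp(1)[of t 3]
      by (simp_all add: d1 \<Gamma>0 signed_circ_def)
    have aa: "9/10 \<le> a * a" "a * a \<le> 1" "9/10 \<le> b * b" "b * b \<le> 1" using a b by auto
    have sc: "(sin (2 * pi * t))\<^sup>2 + (cos (2 * pi * t))\<^sup>2 = 1" by simp
    note n = near_circle_signs[OF a b aa inverse_2pi_bounds sc c]
    show "a * \<Gamma> k t $ 1 * sin (2 * pi * t) + b * \<Gamma> k t $ 3 * cos (2 * pi * t) > 0"
      "a * b * (d1 (\<Gamma> k) t $ 1 * \<Gamma> k t $ 3 - \<Gamma> k t $ 1 * d1 (\<Gamma> k) t $ 3) > 0"
      by (rule n)+
  qed
  have "knot_class_of (\<Gamma> k ` {0..1}) = unknot"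
    by (rule star_shaped_curve_unknot[OF Cset_D(1)[OF k] a b DERIV_ident]) (use pJ in auto)
  then show ?thesis by (rule knot_class_eq_unknot[OF K Cset_D(5)[OF k]])
qed

section \<open>Infima of the bending energy\<close>

lemma Inf_bending: "Inf (bending ` {\<beta>. W22 \<beta> \<and> regular \<beta> \<and> curve_length \<beta> = 1}) = ennreal ((2 * pi)^2)"
proof (rule antisym)
  show "Inf (bending ` {\<beta>. W22 \<beta> \<and> regular \<beta> \<and> curve_length \<beta> = 1}) \<le> ennreal ((2 * pi)^2)"
    using W22_circ_xz regular_circ_xz curve_length_circ_xz
    by (intro INF_lower2[of circ_xz]) (auto simp: bending_circ_xz)
  show "ennreal ((2 * pi)^2) \<le> Inf (bending ` {\<beta>. W22 \<beta> \<and> regular \<beta> \<and> curve_length \<beta> = 1})"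
    using bending_ge by (intro INF_greatest) auto
qed

lemma Inf_bending_unknot: "Inf (bending ` {\<beta> \<in> Cset unknot. D2_symmetric \<beta>}) = ennreal ((2 * pi)^2)"
proof (rule antisym)
  show "Inf (bending ` {\<beta> \<in> Cset unknot. D2_symmetric \<beta>}) \<le> ennreal ((2 * pi)^2)"
    using circ_xz_in_Cset D2_symmetric_circ_xz
    by (intro INF_lower2[of circ_xz]) (auto simp: bending_circ_xz)
  show "ennreal ((2 * pi)^2) \<le> Inf (bending ` {\<beta> \<in> Cset unknot. D2_symmetric \<beta>})"
    using bending_ge Cset_D by (intro INF_greatest) auto
qed

text \<open>An infimum over the empty set would be infinite, so the equality itself supplies a
  symmetric curve, with excess below (1/10)^2, the threshold of
  \<open>D2_low_energy_unknot\<close>.\<close>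

lemma Inf_bending_imp_unknot:
  assumes K: "tame_knot_class \<K>" and I: "Inf (bending ` {\<beta> \<in> Cset \<K>. D2_symmetric \<beta>}) = ennreal ((2 * pi)^2)"
  shows "\<K> = unknot"
proof -
  have "Inf (bending ` {\<beta> \<in> Cset \<K>. D2_symmetric \<beta>}) < ennreal ((2 * pi)\<^sup>2 + (1/10)\<^sup>2)"
    unfolding I by (intro ennreal_lessI) (auto intro!: add_nonneg_pos)
  then obtain \<beta> where \<beta>: "\<beta> \<in> Cset \<K>" "D2_symmetric \<beta>" "bending \<beta> < ennreal ((2 * pi)\<^sup>2 + (1/10)\<^sup>2)"
    unfolding Inf_less_iff by auto
  note C = Cset_D[OF \<beta>(1)]
  have "knot_class_of (\<beta> ` {0..1}) = unknot"
    by (rule D2_low_energy_unknot[OF C(1,3) \<beta>(2) C(2)]) (use \<beta>(3) in simp)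
  then show ?thesis by (rule knot_class_eq_unknot[OF K C(5)])
qed

theorem theorem1p5:
  fixes q :: real
  assumes "2 < q" and "q \<le> 4"
  shows "(\<exists>\<Gamma>0. D2_elastic_knot q unknot \<Gamma>0) \<and>
         (\<forall>\<Gamma>0. D2_elastic_knot q unknot \<Gamma>0 \<longrightarrow> is_once_covered_circle \<Gamma>0) \<and>
         (\<forall>\<K> \<Gamma>0. tame_knot_class \<K> \<and> D2_elastic_knot q \<K> \<Gamma>0 \<and> is_once_covered_circle \<Gamma>0
                   \<longrightarrow> \<K> = unknot) \<and>
         (\<forall>\<K>. tame_knot_class \<K> \<longrightarrow>
            ((Inf (bending ` {\<beta> \<in> Cset \<K>. D2_symmetric \<beta>})
                = Inf (bending ` {\<beta>. W22 \<beta> \<and> regular \<beta> \<and> curve_length \<beta> = 1}) \<and>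
              Inf (bending ` {\<beta>. W22 \<beta> \<and> regular \<beta> \<and> curve_length \<beta> = 1}) = ennreal ((2 * pi)^2))
             \<longleftrightarrow> \<K> = unknot))"
proof (intro conjI allI impI)
  show "\<exists>\<Gamma>0. D2_elastic_knot q unknot \<Gamma>0" using elastic_unknot_exists[OF assms(1)] by blast
  show "is_once_covered_circle \<Gamma>0" if "D2_elastic_knot q unknot \<Gamma>0" for \<Gamma>0
    by (rule elastic_unknot_circle[OF assms(1) that])
  show "\<K> = unknot" if "tame_knot_class \<K> \<and> D2_elastic_knot q \<K> \<Gamma>0 \<and> is_once_covered_circle \<Gamma>0" for \<K> \<Gamma>0
    using elastic_circle_unknot that by blast
  show "(Inf (bending ` {\<beta> \<in> Cset \<K>. D2_symmetric \<beta>})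
                = Inf (bending ` {\<beta>. W22 \<beta> \<and> regular \<beta> \<and> curve_length \<beta> = 1}) \<and>
              Inf (bending ` {\<beta>. W22 \<beta> \<and> regular \<beta> \<and> curve_length \<beta> = 1}) = ennreal ((2 * pi)^2))
             \<longleftrightarrow> \<K> = unknot" if "tame_knot_class \<K>" for \<K>
    using Inf_bending_imp_unknot[OF that] Inf_bending Inf_bending_unknot by auto
qed

end
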